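(* Let $p\ge 0$ be an integer, $n=2p+1$ and $R>0$. Then the magnitude of the closed Euclidean ball $B^n_R\subset\mathbb{R}^n$ of radius $R$ is \[\left|B^n_R\right|=\frac{\det[\chi_{i+j+2}(R)]_{i,j=0}^p}{n!\,R\,\det[\chi_{i+j}(R)]_{i,j=0}^p}.\]
   Context: The reverse Bessel polynomials $\chi_i(R)\in\mathbb{Z}[R]$ are defined by $\chi_0(R)=1$, $\chi_1(R)=R$ and $\chi_{i+2}(R)=R^2\chi_i(R)+(2i+1)\chi_{i+1}(R)$ for $i\ge 0$. Magnitude: for a finite metric space $A$, a weighting is a function $w\colon A\to\mathbb{R}$ with $\sum_{x\in A}w(x)e^{-d(x,s)}=1$ for all $s\in A$, and the magnitude $|A|$ is $\sum_x w(x)$ (independent of the weighting; weightings exist for finite subsets of Euclidean space). For a compact subset $X$ of Euclidean space, the magnitude is $|X|=\lim_i|A_i|$ for any sequence of finite subsets $A_i\subset X$ converging to $X$ in the Hausdorff metric (Leinster–Meckes). *)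

theory Defs
  imports "HOL-Analysis.Analysis" "HOL-Combinatorics.Permutations"
begin

text \<open>Reverse Bessel polynomials, evaluated at a real number R.\<close>
fun chi :: "nat \<Rightarrow> real \<Rightarrow> real" where
  "chi 0 R = 1"
| "chi (Suc 0) R = R"
| "chi (Suc (Suc i)) R = R^2 * chi i R + real (2*i+1) * chi (Suc i) R"

definition det_sq :: "nat \<Rightarrow> (nat \<Rightarrow> nat \<Rightarrow> real) \<Rightarrow> real" where
  "det_sq n M = (\<Sum>\<sigma> | \<sigma> permutes {..<n}. of_int (sign \<sigma>) * (\<Prod>i<n. M i (\<sigma> i)))"

definition is_weighting :: "'a::metric_space set \<Rightarrow> ('a \<Rightarrow> real) \<Rightarrow> bool" where
  "is_weighting A w \<longleftrightarrow> (\<forall>s\<in>A. (\<Sum>x\<in>A. w x * exp (- dist x s)) = 1)"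

definition magnitude_fin :: "'a::metric_space set \<Rightarrow> real" where
  "magnitude_fin A = (THE m. \<exists>w. is_weighting A w \<and> m = (\<Sum>x\<in>A. w x))"

definition hausdorff_dist :: "'a::metric_space set \<Rightarrow> 'a set \<Rightarrow> real" where
  "hausdorff_dist A B = max (SUP a\<in>A. infdist a B) (SUP b\<in>B. infdist b A)"

definition magnitude :: "'a::metric_space set \<Rightarrow> real" where
  "magnitude X = (THE m. \<forall>A :: nat \<Rightarrow> 'a set.
      (\<forall>i. finite (A i) \<and> A i \<noteq> {} \<and> A i \<subseteq> X) \<and>
      (\<lambda>i. hausdorff_dist (A i) X) \<longlonglongrightarrow> 0
      \<longrightarrow> (\<lambda>i. magnitude_fin (A i)) \<longlonglongrightarrow> m)"

end

theory Submission
  imports Defs "Jordan_Normal_Form.Determinant" "HOL-Probability.Probability"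
begin

text \<open>
The exponential kernel is positive definite, so the magnitude of a compact set is \<open>M\<close> as soon as there
are finitely supported signed measures on it whose potentials tend uniformly to \<open>1\<close> and whose masses
and energies tend to \<open>M\<close>. In dimension \<open>n = 2 p + 1\<close> the kernel \<open>exp (- norm x)\<close> is the average, over
unit vectors \<open>u\<close>, of \<open>\<phi> \<bar>x \<bullet> u\<bar>\<close> with \<open>\<phi> t\<close> equal to \<open>exp (- t)\<close> times a polynomial of degree \<open>p\<close>. For
radial measures on the ball this reduces everything to their projection to a line: it suffices to
solve \<open>\<phi> * w = 1\<close> on \<open>[-R, R]\<close> and to compute the mass of \<open>w\<close>. The solution is
\<open>w = q + \<beta> (\<delta>\<^bsub>R\<^esub> + \<delta>\<^bsub>-R\<^esub>)\<close> with \<open>q\<close> an even polynomial of degree \<open>2 p\<close>; expanding \<open>q\<close> in powers of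
\<open>s\<^sup>2 - R\<^sup>2\<close> turns the equation into the linear system \<open>\<Sum>k. b k * chi (k + j) R = 0\<close> for \<open>j \<le> p\<close> with
prescribed \<open>b (p + 1)\<close>, whose matrix is the Hankel matrix of the denominator. Cramer's rule and the
recurrence of the reverse Bessel polynomials express the mass as the quotient of determinants. The
point masses are not projections of densities on the ball, but limits of such.
\<close>

hide_const (open) Module.smult
no_notation Matrix.scalar_prod (infix "\<bullet>" 70)
no_notation Matrix.vec_index (infixl "$" 100)

section \<open>Weightings and quadratic forms on finite sets\<close>

text \<open>The obstacle is that the ball need not carry an exact weighting measure. For
  \<open>p > 0\<close> a rotation-invariant measure on the ball projects to a measure without atoms
  at \<open>R\<close> and \<open>- R\<close>, whereas \<open>w\<close> has point masses there. So
  only approximate weightings are used. No uniform bound on the total variation of their densities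
  on the ball is available, but their projections have one, and every uniform estimate is made on
  the line; the density itself matters only for the mesh of the discretisation, which is chosen
  last. Odd dimension enters twice: hyperplane slices of the ball have even dimension
  \<open>2 * p\<close> and polynomial volume, and the averages of
  \<open>\<bar>x \<bullet> u\<bar> ^ m\<close> over directions have reciprocals polynomial in
  \<open>m\<close>, which makes \<open>phi p\<close> an exponential times a polynomial. The line
  equation has a polynomial solution because the even moments of \<open>phi p\<close> of order below
  \<open>2 * p\<close> vanish: convolution over the whole line sends polynomials of degree at most
  \<open>2 * p\<close> to constants, and the tails beyond \<open>R\<close> and \<open>- R\<close>
  are made to equal potentials of point masses. The moment of order \<open>2 * p\<close> is the
  source of the factorial in the formula.\<close>

definition zform :: "'a::metric_space set \<Rightarrow> 'a set \<Rightarrow> ('a \<Rightarrow> real) \<Rightarrow> ('a \<Rightarrow> real) \<Rightarrow> real" where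
  "zform A B v w = (\<Sum>x\<in>A. \<Sum>y\<in>B. v x * w y * exp (- dist x y))"

lemma zform_eq_potential: "zform A B v w = (\<Sum>x\<in>A. v x * (\<Sum>y\<in>B. w y * exp (- dist x y)))"
  by (simp add: zform_def sum_distrib_left mult.assoc)

lemma zform_commute: "zform A B v w = zform B A w v"
  unfolding zform_def
  by (subst sum.swap) (intro sum.cong refl, simp only: dist_commute mult.commute)

lemma zform_add_left: "zform A B (\<lambda>x. u x + t * v x) w = zform A B u w + t * zform A B v w"
  unfolding zform_def distrib_right sum.distrib sum_distrib_left mult.assoc ..

lemma zform_add_right: "zform A B w (\<lambda>x. u x + t * v x) = zform A B w u + t * zform A B w v"
  by (simp only: zform_commute[of A B] zform_add_left)

lemma discriminant_bound:
  fixes a b c :: real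
  assumes "\<And>t. 0 \<le> a + 2 * b * t + c * t\<^sup>2"
  shows "b\<^sup>2 \<le> a * c"
proof (cases "c = 0")
  case True
  have "b = 0"
  proof (rule ccontr)
    assume "b \<noteq> 0"
    then show False
      using assms[of "- (a + 1) / (2 * b)"] True by simp
  qed
  then show ?thesis using True by simp
next
  case False
  have "c \<ge> 0"
  proof (rule ccontr)
    assume c: "\<not> c \<ge> 0"
    \<comment> \<open>For negative \<open>c\<close> the quadratic term dominates for large
      \<open>t\<close>; this choice beats the linear term and \<open>a\<close> at once.\<close>
    define t where "t = 1 + \<bar>a\<bar> / \<bar>c\<bar> + 2 * \<bar>b\<bar> / \<bar>c\<bar>"
    have t1: "t \<ge> 1" by (simp add: t_def)
    have ct: "c * t = - \<bar>c\<bar> - \<bar>a\<bar> - 2 * \<bar>b\<bar>"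
      using c by (simp add: t_def field_simps)
    have "a + 2 * b * t + c * t\<^sup>2 = a + t * (2 * b + c * t)"
      by (simp add: power2_eq_square algebra_simps)
    also have "\<dots> \<le> a + t * (- \<bar>c\<bar> - \<bar>a\<bar>)"
      unfolding ct using t1 by (intro add_left_mono mult_left_mono) auto
    also have "\<dots> \<le> a + 1 * (- \<bar>c\<bar> - \<bar>a\<bar>)"
      using t1 by (intro add_left_mono mult_right_mono_neg) auto
    also have "\<dots> < 0" using c by auto
    finally show False using assms[of t] by simp
  qed
  with False have c: "c > 0" by simp
  have "0 \<le> c * (a + 2 * b * (- b / c) + c * (- b / c)\<^sup>2)"
    using assms[of "- b / c"] c by simp
  also have "\<dots> = a * c - b\<^sup>2"
    using c by (simp add: field_simps power2_eq_square)
  finally show ?thesis by simp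
qed

lemma zform_restrict:
  assumes "finite C" "A \<subseteq> C" "B \<subseteq> C"
  shows "zform C C (\<lambda>x. if x \<in> A then v x else 0) (\<lambda>x. if x \<in> B then w x else 0) = zform A B v w"
proof -
  have "zform A B v w = (\<Sum>x\<in>A. \<Sum>y\<in>C. v x * (if y \<in> B then w y else 0) * exp (- dist x y))"
    unfolding zform_def using assms by (intro sum.cong refl sum.mono_neutral_cong_left) auto
  also have "\<dots> = (\<Sum>x\<in>C. \<Sum>y\<in>C. (if x \<in> A then v x else 0) * (if y \<in> B then w y else 0) * exp (- dist x y))"
    using assms by (intro sum.mono_neutral_cong_left) auto
  finally show ?thesis by (simp add: zform_def)
qed

text \<open>Both weights are extended by zero to the union of their supports, where semidefiniteness
  makes a quadratic polynomial in \<open>t\<close> nonnegative.\<close>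

lemma zform_Cauchy_Schwarz:
  fixes X :: "'a::metric_space set"
  assumes psd: "\<And>A v. finite A \<Longrightarrow> A \<subseteq> X \<Longrightarrow> 0 \<le> zform A A v v"
    and AB: "finite A" "A \<subseteq> X" "finite B" "B \<subseteq> X"
  shows "(zform A B v w)\<^sup>2 \<le> zform A A v v * zform B B w w"
proof -
  define C where "C = A \<union> B"
  define v' where "v' = (\<lambda>x. if x \<in> A then v x else 0)"
  define w' where "w' = (\<lambda>x. if x \<in> B then w x else 0)"
  have C: "finite C" "C \<subseteq> X" "A \<subseteq> C" "B \<subseteq> C" using AB by (auto simp: C_def)
  have "(zform C C v' w')\<^sup>2 \<le> zform C C v' v' * zform C C w' w'"
  proof (rule discriminant_bound)
    fix t
    have "0 \<le> zform C C (\<lambda>x. v' x + t * w' x) (\<lambda>x. v' x + t * w' x)" by (intro psd C)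
    also have "\<dots> = zform C C v' v' + 2 * zform C C v' w' * t + zform C C w' w' * t\<^sup>2"
      using zform_commute[of C C w' v']
      by (simp add: zform_add_left zform_add_right power2_eq_square algebra_simps)
    finally show "0 \<le> zform C C v' v' + 2 * zform C C v' w' * t + zform C C w' w' * t\<^sup>2" .
  qed
  then show ?thesis
    unfolding v'_def w'_def using C by (simp add: zform_restrict)
qed

text \<open>Orthogonal projection of \<open>b\<close> onto the span of the \<open>s i\<close>, with
  one vector added at a time as in Gram-Schmidt. The vectors may be linearly dependent.\<close>

lemma exists_orthogonal_residual:
  fixes s :: "'i \<Rightarrow> 'a \<Rightarrow> real"
  assumes "finite I" "finite A"
  shows "\<exists>c. \<forall>j\<in>I. (\<Sum>x\<in>A. (b x - (\<Sum>i\<in>I. c i * s i x)) * s j x) = 0"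
  using assms(1)
proof (induction I arbitrary: b rule: finite_induct)
  case empty
  then show ?case by simp
next
  case (insert k I)
  obtain c where c: "\<And>j. j \<in> I \<Longrightarrow> (\<Sum>x\<in>A. (b x - (\<Sum>i\<in>I. c i * s i x)) * s j x) = 0"
    using insert.IH[of b] by blast
  obtain d where d: "\<And>j. j \<in> I \<Longrightarrow> (\<Sum>x\<in>A. (s k x - (\<Sum>i\<in>I. d i * s i x)) * s j x) = 0"
    using insert.IH[of "s k"] by blast
  define r' where "r' x = b x - (\<Sum>i\<in>I. c i * s i x)" for x
  define r where "r x = s k x - (\<Sum>i\<in>I. d i * s i x)" for x
  \<comment> \<open>If \<open>s k\<close> already lies in the span, then \<open>r\<close> vanishes
    on \<open>A\<close>, the quotient is \<open>0\<close> by convention, and its value does not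
    matter.\<close>
  define t where "t = (\<Sum>x\<in>A. r' x * r x) / (\<Sum>x\<in>A. r x * r x)"
  define e where "e i = (if i = k then t else c i - t * d i)" for i
  have res: "b x - (\<Sum>i\<in>insert k I. e i * s i x) = r' x - t * r x" for x
  proof -
    have "(\<Sum>i\<in>I. e i * s i x) = (\<Sum>i\<in>I. c i * s i x) - t * (\<Sum>i\<in>I. d i * s i x)"
      unfolding sum_distrib_left sum_subtractf[symmetric]
      using insert.hyps by (intro sum.cong) (auto simp: e_def algebra_simps)
    then show ?thesis
      using insert.hyps by (simp add: r'_def r_def e_def algebra_simps)
  qed
  have orthI: "(\<Sum>x\<in>A. (r' x - t * r x) * s j x) = 0" if "j \<in> I" for j
  proof -
    have "(\<Sum>x\<in>A. (r' x - t * r x) * s j x) = (\<Sum>x\<in>A. r' x * s j x) - t * (\<Sum>x\<in>A. r x * s j x)"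
      unfolding sum_distrib_left sum_subtractf[symmetric] left_diff_distrib mult.assoc ..
    then show ?thesis using c[OF that] d[OF that] by (simp add: r'_def r_def)
  qed
  have orthr: "(\<Sum>x\<in>A. (r' x - t * r x) * r x) = 0"
  proof (cases "(\<Sum>x\<in>A. r x * r x) = 0")
    case True
    then have "\<forall>x\<in>A. r x = 0"
      using assms(2) by (simp add: sum_nonneg_eq_0_iff)
    then show ?thesis by simp
  next
    case False
    have "(\<Sum>x\<in>A. (r' x - t * r x) * r x) = (\<Sum>x\<in>A. r' x * r x) - t * (\<Sum>x\<in>A. r x * r x)"
      unfolding sum_distrib_left sum_subtractf[symmetric] left_diff_distrib mult.assoc ..
    then show ?thesis using False by (simp add: t_def)
  qed
  have orthk: "(\<Sum>x\<in>A. (r' x - t * r x) * s k x) = 0"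
  proof -
    have sk: "s k x = r x + (\<Sum>i\<in>I. d i * s i x)" for x by (simp add: r_def)
    have "q * s k x = q * r x + (\<Sum>i\<in>I. d i * (q * s i x))" for q x
      unfolding sk distrib_left sum_distrib_left by (simp add: mult.left_commute)
    then have "(\<Sum>x\<in>A. (r' x - t * r x) * s k x)
        = (\<Sum>x\<in>A. (r' x - t * r x) * r x) + (\<Sum>x\<in>A. \<Sum>i\<in>I. d i * ((r' x - t * r x) * s i x))"
      by (simp only: sum.distrib)
    also have "(\<Sum>x\<in>A. \<Sum>i\<in>I. d i * ((r' x - t * r x) * s i x))
        = (\<Sum>i\<in>I. d i * (\<Sum>x\<in>A. (r' x - t * r x) * s i x))"
      by (subst sum.swap) (simp add: sum_distrib_left)
    also have "\<dots> = 0" using orthI by simp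
    finally show ?thesis using orthr by simp
  qed
  show ?case
    by (intro exI[of _ e]) (auto simp: res orthI orthk)
qed

text \<open>The hypothesis \<open>bound\<close> does the work of invertibility of the kernel matrix.
  The residual of the constant \<open>1\<close> modulo the kernel columns has energy
  \<open>0\<close>, hence mass \<open>0\<close> by \<open>bound\<close>; being orthogonal to
  \<open>1\<close> and to all columns, it is orthogonal to itself.\<close>

lemma weighting_exists:
  assumes "finite A" and bound: "\<And>v. (sum v A)\<^sup>2 \<le> M * zform A A v v"
  shows "\<exists>w. is_weighting A w"
proof -
  obtain c where c: "\<And>j. j \<in> A \<Longrightarrow>
      (\<Sum>x\<in>A. (1 - (\<Sum>i\<in>A. c i * exp (- dist i x))) * exp (- dist j x)) = 0"
    using exists_orthogonal_residual[OF assms(1) assms(1), of "\<lambda>_. 1" "\<lambda>i x. exp (- dist i x)"]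
    by blast
  define r where "r x = 1 - (\<Sum>i\<in>A. c i * exp (- dist i x))" for x
  have orth: "(\<Sum>x\<in>A. r x * exp (- dist j x)) = 0" if "j \<in> A" for j
    using c[OF that] by (simp add: r_def)
  have "zform A A r r = 0"
    using orth by (simp add: zform_eq_potential)
  with bound[of r] have r0: "sum r A = 0" by simp
  have "(\<Sum>x\<in>A. r x * r x) = (\<Sum>x\<in>A. r x - (\<Sum>i\<in>A. c i * (r x * exp (- dist i x))))"
  proof (intro sum.cong refl)
    fix x
    have "q * r x = q - (\<Sum>i\<in>A. c i * (q * exp (- dist i x)))" for q
      by (simp add: r_def right_diff_distrib sum_distrib_left mult.left_commute)
    then show "r x * r x = r x - (\<Sum>i\<in>A. c i * (r x * exp (- dist i x)))" .
  qed
  also have "\<dots> = sum r A - (\<Sum>i\<in>A. c i * (\<Sum>x\<in>A. r x * exp (- dist i x)))"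
    by (subst sum_subtractf, subst sum.swap) (simp add: sum_distrib_left)
  also have "\<dots> = 0" using r0 orth by simp
  finally have "\<forall>x\<in>A. r x = 0"
    using assms(1) by (simp add: sum_nonneg_eq_0_iff)
  then show ?thesis
    unfolding is_weighting_def r_def by (intro exI[of _ c]) auto
qed

lemma is_weighting_potential:
  assumes "is_weighting A w" "x \<in> A"
  shows "(\<Sum>y\<in>A. w y * exp (- dist x y)) = 1"
  using assms unfolding is_weighting_def by (metis (no_types, lifting) dist_commute sum.cong)

lemma zform_weighting:
  assumes "is_weighting A w"
  shows "zform A A v w = sum v A"
  using is_weighting_potential[OF assms] by (simp add: zform_eq_potential)

lemma magnitude_fin_eq:
  assumes "is_weighting A w"
  shows "magnitude_fin A = sum w A"
  unfolding magnitude_fin_def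
proof (rule the_equality)
  fix m assume "\<exists>w. is_weighting A w \<and> m = (\<Sum>x\<in>A. w x)"
  then obtain w' where w': "is_weighting A w'" "m = sum w' A" by blast
  have "zform A A w w' = sum w A" "zform A A w' w = sum w' A"
    using w'(1) assms by (simp_all add: zform_weighting)
  then show "m = sum w A" using w'(2) zform_commute by metis
qed (use assms in blast)

text \<open>A weighting has energy equal to its mass. Inserting it into \<open>bound\<close> gives
  the first claim, and Cauchy-Schwarz against it gives the second: the magnitude dominates every
  quotient of squared mass by energy.\<close>

lemma magnitude_fin_bounds:
  fixes X :: "'a::metric_space set"
  assumes psd: "\<And>A v. finite A \<Longrightarrow> A \<subseteq> X \<Longrightarrow> 0 \<le> zform A A v v"
    and A: "finite A" "A \<subseteq> X"
    and bound: "\<And>v. (sum v A)\<^sup>2 \<le> M * zform A A v v"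
    and M: "0 \<le> M"
  shows "magnitude_fin A \<le> M"
    and "(sum v A)\<^sup>2 \<le> magnitude_fin A * zform A A v v"
proof -
  obtain w where w: "is_weighting A w" using weighting_exists[OF A(1) bound] by blast
  note [simp] = magnitude_fin_eq[OF w] zform_weighting[OF w]
  have pos: "0 \<le> sum w A" using psd[OF A, of w] by simp
  show "magnitude_fin A \<le> M"
  proof (cases "sum w A = 0")
    case False
    with bound[of w] pos show ?thesis by (simp add: power2_eq_square)
  qed (use M in simp)
  show "(sum v A)\<^sup>2 \<le> magnitude_fin A * zform A A v v"
    using zform_Cauchy_Schwarz[OF psd A A, of v w] by (simp add: mult.commute)
qed

section \<open>Magnitude of a compact set from approximate weightings\<close>

lemma sum_pushforward:
  fixes v :: "'a \<Rightarrow> real"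
  assumes "finite B" "finite A" "a ` B \<subseteq> A"
  shows "(\<Sum>x\<in>A. (\<Sum>b\<in>{b\<in>B. a b = x}. v b) * g x) = (\<Sum>b\<in>B. v b * g (a b))"
proof -
  have "(\<Sum>x\<in>A. (\<Sum>b\<in>{b\<in>B. a b = x}. v b) * g x) = (\<Sum>x\<in>A. \<Sum>b\<in>{b\<in>B. a b = x}. v b * g (a b))"
    by (simp add: sum_distrib_right)
  also have "\<dots> = (\<Sum>b\<in>B. v b * g (a b))"
    using assms by (intro sum.group) auto
  finally show ?thesis .
qed

lemma infdist_le_hausdorff_dist:
  fixes X :: "'a::metric_space set"
  assumes "bounded X" "A \<noteq> {}" "A \<subseteq> X" "x \<in> X"
  shows "infdist x A \<le> hausdorff_dist A X"
proof -
  obtain a where a: "a \<in> A" using assms by blast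
  obtain e where e: "\<And>y. y \<in> X \<Longrightarrow> dist a y \<le> e"
    using assms(1) unfolding bounded_any_center[of X a] by blast
  have "infdist y A \<le> e" if "y \<in> X" for y
    using infdist_le[OF a, of y] e[OF that] by (simp add: dist_commute)
  then have "bdd_above ((\<lambda>b. infdist b A) ` X)"
    by (intro bdd_aboveI2)
  then have "infdist x A \<le> (SUP b\<in>X. infdist b A)"
    by (rule cSUP_upper[OF assms(4)])
  then show ?thesis by (simp add: hausdorff_dist_def)
qed

lemma hausdorff_dist_net_le:
  fixes X :: "'a::metric_space set"
  assumes "A \<noteq> {}" "A \<subseteq> X" "0 \<le> e" "X \<subseteq> (\<Union>a\<in>A. ball a e)"
  shows "0 \<le> hausdorff_dist A X" "hausdorff_dist A X \<le> e"
proof -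
  have zero: "infdist a X = 0" if "a \<in> A" for a
    using assms that infdist_zero by blast
  have A0: "(SUP a\<in>A. infdist a X) = 0"
    using assms(1) zero by simp
  have "infdist b A \<le> e" if b: "b \<in> X" for b
  proof -
    obtain a where "a \<in> A" "dist a b < e" using assms(4) b by auto
    then show ?thesis using infdist_le[of a A b] by (simp add: dist_commute)
  qed
  moreover have "X \<noteq> {}" using assms by auto
  ultimately have "(SUP b\<in>X. infdist b A) \<le> e"
    by (intro cSUP_least) auto
  then show "0 \<le> hausdorff_dist A X" "hausdorff_dist A X \<le> e"
    using A0 assms(3) by (simp_all add: hausdorff_dist_def)
qed

lemma exists_hausdorff_approximation:
  fixes X :: "'a::metric_space set"
  assumes "compact X" "X \<noteq> {}"
  shows "\<exists>A::nat \<Rightarrow> 'a set. (\<forall>i. finite (A i) \<and> A i \<noteq> {} \<and> A i \<subseteq> X) \<and>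
           (\<lambda>i. hausdorff_dist (A i) X) \<longlonglongrightarrow> 0"
proof -
  have "\<exists>k. finite k \<and> k \<subseteq> X \<and> X \<subseteq> (\<Union>x\<in>k. ball x (inverse (real (Suc i))))" for i
    using seq_compact_imp_totally_bounded[of X] assms(1) compact_imp_seq_compact
    by (metis inverse_positive_iff_positive of_nat_0_less_iff zero_less_Suc)
  then obtain A where A: "\<And>i. finite (A i)" "\<And>i. A i \<subseteq> X"
      "\<And>i. X \<subseteq> (\<Union>x\<in>A i. ball x (inverse (real (Suc i))))"
    by metis
  have ne: "A i \<noteq> {}" for i
    using A(3)[of i] assms(2) by auto
  have "(\<lambda>i. hausdorff_dist (A i) X) \<longlonglongrightarrow> 0"
  proof (rule tendsto_sandwich[OF _ _ tendsto_const LIMSEQ_inverse_real_of_nat])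
    show "\<forall>\<^sub>F i in sequentially. 0 \<le> hausdorff_dist (A i) X"
      using hausdorff_dist_net_le(1)[OF ne A(2) _ A(3)] by (intro always_eventually allI) simp
    show "\<forall>\<^sub>F i in sequentially. hausdorff_dist (A i) X \<le> inverse (real (Suc i))"
      using hausdorff_dist_net_le(2)[OF ne A(2) _ A(3)] by (intro always_eventually allI) simp
  qed
  with A(1,2) ne show ?thesis by (intro exI[of _ A] conjI allI)
qed

text \<open>Semicontinuity by transport: each atom of \<open>v\<close> moves to a nearest point of
  \<open>A i\<close>. The mass is unchanged and the energy converges, so a quotient of squared mass
  by energy exceeding \<open>c\<close> is eventually exceeded in \<open>A i\<close> as well.\<close>

lemma magnitude_lower_limit:
  fixes X :: "'a::metric_space set"
  assumes X: "compact X"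
    and psd: "\<And>A v. finite A \<Longrightarrow> A \<subseteq> X \<Longrightarrow> 0 \<le> zform A A v v"
    and A: "\<And>i. finite (A i)" "\<And>i. A i \<noteq> {}" "\<And>i. A i \<subseteq> X"
    and lim: "(\<lambda>i. hausdorff_dist (A i) X) \<longlonglongrightarrow> 0"
    and lower: "\<And>i v. (sum v (A i))\<^sup>2 \<le> magnitude_fin (A i) * zform (A i) (A i) v v"
    and B: "finite B" "B \<subseteq> X"
    and c: "c * zform B B v v < (sum v B)\<^sup>2"
  shows "\<forall>\<^sub>F i in sequentially. c < magnitude_fin (A i)"
proof -
  have near: "\<exists>a. a \<in> A i \<and> dist b a \<le> hausdorff_dist (A i) X" if "b \<in> B" for i b
  proof -
    have "\<exists>a\<in>A i. \<forall>y\<in>A i. dist b a \<le> dist b y"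
      using A(1,2)[of i] by (intro finite_imp_compact continuous_attains_inf continuous_intros)
    then obtain a where a: "a \<in> A i" "\<And>y. y \<in> A i \<Longrightarrow> dist b a \<le> dist b y" by blast
    have "dist b a \<le> infdist b (A i)"
      unfolding infdist_def using A(2)[of i] a(2) by (auto intro: cINF_greatest)
    also have "\<dots> \<le> hausdorff_dist (A i) X"
      using infdist_le_hausdorff_dist[OF compact_imp_bounded[OF X] A(2,3)] B(2) that by blast
    finally show ?thesis using a by blast
  qed
  define a where "a i b = (SOME a. a \<in> A i \<and> dist b a \<le> hausdorff_dist (A i) X)" for i b
  have a: "a i b \<in> A i" "dist b (a i b) \<le> hausdorff_dist (A i) X" if "b \<in> B" for i b
    using someI_ex[OF near[OF that, of i]] by (simp_all add: a_def)
  have a_lim: "(\<lambda>i. a i b) \<longlonglongrightarrow> b" if "b \<in> B" for b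
  proof -
    have "(\<lambda>i. dist b (a i b)) \<longlonglongrightarrow> 0"
    proof (rule tendsto_sandwich[OF _ _ tendsto_const lim])
      show "\<forall>\<^sub>F i in sequentially. dist b (a i b) \<le> hausdorff_dist (A i) X"
        using a(2)[OF that] by (intro always_eventually allI)
    qed simp
    then have "(\<lambda>i. dist (a i b) b) \<longlonglongrightarrow> 0"
      unfolding dist_commute[of b] .
    then show ?thesis by (rule tendsto_dist_iff[THEN iffD2])
  qed
  \<comment> \<open>Several atoms may be moved to the same point, so their weights are
    added.\<close>
  define u where "u i x = (\<Sum>b\<in>{b\<in>B. a i b = x}. v b)" for i x
  have push: "(\<Sum>x\<in>A i. u i x * g x) = (\<Sum>b\<in>B. v b * g (a i b))" for i g
  proof -
    have "a i ` B \<subseteq> A i" by (rule image_subsetI) (rule a(1))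
    from sum_pushforward[OF B(1) A(1) this]
    show ?thesis unfolding u_def .
  qed
  have mass: "sum (u i) (A i) = sum v B" for i
    using push[of i "\<lambda>_. 1"] by simp
  have form: "zform (A i) (A i) (u i) (u i)
      = (\<Sum>b\<in>B. v b * (\<Sum>c\<in>B. v c * exp (- dist (a i b) (a i c))))" for i
    by (subst zform_eq_potential, subst push, subst push, rule refl)
  have "(\<lambda>i. zform (A i) (A i) (u i) (u i)) \<longlonglongrightarrow> (\<Sum>b\<in>B. v b * (\<Sum>c\<in>B. v c * exp (- dist b c)))"
    unfolding form by (intro tendsto_sum tendsto_mult tendsto_const tendsto_exp tendsto_minus tendsto_dist a_lim)
  then have "(\<lambda>i. c * zform (A i) (A i) (u i) (u i)) \<longlonglongrightarrow> c * zform B B v v"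
    unfolding zform_eq_potential[of B B] by (intro tendsto_mult tendsto_const)
  then have ev: "\<forall>\<^sub>F i in sequentially. c * zform (A i) (A i) (u i) (u i) < (sum v B)\<^sup>2"
    by (rule order_tendstoD(2)[OF _ c])
  show ?thesis
    using ev
  proof eventually_elim
    case (elim i)
    show ?case
    proof (rule ccontr)
      assume "\<not> c < magnitude_fin (A i)"
      then have "magnitude_fin (A i) * zform (A i) (A i) (u i) (u i) \<le> c * zform (A i) (A i) (u i) (u i)"
        by (intro mult_right_mono psd A) simp
      with elim lower[of "u i" i] mass[of i] show False by simp
    qed
  qed
qed

text \<open>A weight \<open>u\<close> pairs with an approximate weighting to almost its own mass, so
  Cauchy-Schwarz bounds all finite subsets by \<open>M\<close>. Conversely the approximate weighting
  has squared mass over energy close to \<open>M\<close>, and transport carries this to nearby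
  subsets.\<close>

lemma magnitude_eqI:
  fixes X :: "'a::metric_space set"
  assumes X: "compact X" "X \<noteq> {}"
    and psd: "\<And>A v. finite A \<Longrightarrow> A \<subseteq> X \<Longrightarrow> 0 \<le> zform A A v v"
    and approx: "\<And>e. 0 < e \<Longrightarrow> \<exists>B v. finite B \<and> B \<subseteq> X \<and> \<bar>sum v B - M\<bar> \<le> e \<and>
        \<bar>zform B B v v - M\<bar> \<le> e \<and> (\<forall>x\<in>X. \<bar>(\<Sum>y\<in>B. v y * exp (- dist x y)) - 1\<bar> \<le> e)"
  shows "magnitude X = M"
proof -
  have upper: "(sum u A)\<^sup>2 \<le> M * zform A A u u" if A: "finite A" "A \<subseteq> X" for A u
  proof -
    define z where "z = zform A A u u"
    define t where "t = (\<Sum>x\<in>A. \<bar>u x\<bar>)"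
    have z0: "0 \<le> z" using psd[OF A] by (simp add: z_def)
    have le: "\<bar>sum u A\<bar> \<le> sqrt (z * (M + e)) + e * t" if e: "0 < e" for e
    proof -
      obtain B v where B: "finite B" "B \<subseteq> X" "\<bar>zform B B v v - M\<bar> \<le> e"
        and pot: "\<And>x. x \<in> X \<Longrightarrow> \<bar>(\<Sum>y\<in>B. v y * exp (- dist x y)) - 1\<bar> \<le> e"
        using approx[OF e] by blast
      define p where "p x = (\<Sum>y\<in>B. v y * exp (- dist x y))" for x
      have "(zform A B u v)\<^sup>2 \<le> z * zform B B v v"
        unfolding z_def by (rule zform_Cauchy_Schwarz[OF psd A B(1,2)])
      also have "\<dots> \<le> z * (M + e)"
        using B(3) z0 by (intro mult_left_mono) auto
      finally have cs: "\<bar>zform A B u v\<bar> \<le> sqrt (z * (M + e))"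
        by (rule real_le_rsqrt[of "\<bar>_\<bar>", unfolded power2_abs])
      have "\<bar>\<Sum>x\<in>A. u x * (p x - 1)\<bar> \<le> (\<Sum>x\<in>A. \<bar>u x * (p x - 1)\<bar>)"
        by (rule sum_abs)
      also have "\<dots> \<le> (\<Sum>x\<in>A. e * \<bar>u x\<bar>)"
      proof (rule sum_mono)
        fix x assume "x \<in> A"
        then have "\<bar>p x - 1\<bar> \<le> e" using pot A(2) by (auto simp: p_def)
        then show "\<bar>u x * (p x - 1)\<bar> \<le> e * \<bar>u x\<bar>"
          unfolding abs_mult by (metis abs_ge_zero mult.commute mult_left_mono)
      qed
      finally have err: "\<bar>\<Sum>x\<in>A. u x * (p x - 1)\<bar> \<le> e * t"
        by (simp add: t_def sum_distrib_left)
      have "sum u A = zform A B u v - (\<Sum>x\<in>A. u x * (p x - 1))"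
        by (simp add: zform_eq_potential p_def right_diff_distrib sum_subtractf)
      with cs err show ?thesis by linarith
    qed
    have "(\<lambda>n. sqrt (z * (M + inverse (real (Suc n)))) + inverse (real (Suc n)) * t)
        \<longlonglongrightarrow> sqrt (z * (M + 0)) + 0 * t"
      by (intro tendsto_intros LIMSEQ_inverse_real_of_nat)
    then have "\<bar>sum u A\<bar> \<le> sqrt (z * (M + 0)) + 0 * t"
      by (rule LIMSEQ_le_const) (use le in auto)
    then have abs_le: "\<bar>sum u A\<bar> \<le> sqrt (z * M)" by simp
    then have "0 \<le> sqrt (z * M)" by linarith
    then have "0 \<le> z * M" by simp
    moreover have "\<bar>sum u A\<bar>\<^sup>2 \<le> (sqrt (z * M))\<^sup>2"
      by (intro power_mono abs_le) simp
    ultimately show ?thesis by (simp add: z_def mult.commute)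
  qed
  obtain x0 where x0: "x0 \<in> X" using X(2) by blast
  \<comment> \<open>A one-point set has a weight of mass and energy \<open>1\<close>.\<close>
  have M1: "1 \<le> M"
    using upper[of "{x0}" "\<lambda>_. 1"] x0 by (simp add: zform_def)
  have conv: "(\<lambda>i. magnitude_fin (A i)) \<longlonglongrightarrow> M"
    if A: "\<And>i. finite (A i)" "\<And>i. A i \<noteq> {}" "\<And>i. A i \<subseteq> X"
      and lim: "(\<lambda>i. hausdorff_dist (A i) X) \<longlonglongrightarrow> 0" for A :: "nat \<Rightarrow> 'a set"
  proof (rule order_tendstoI)
    have bounds: "magnitude_fin (A i) \<le> M"
        "(sum v (A i))\<^sup>2 \<le> magnitude_fin (A i) * zform (A i) (A i) v v" for i v
      using magnitude_fin_bounds[OF psd A(1,3) upper[OF A(1,3)]] M1 by auto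
    show "\<forall>\<^sub>F i in sequentially. magnitude_fin (A i) < a" if "M < a" for a
      using bounds(1) that by (intro always_eventually allI) (meson le_less_trans)
    show "\<forall>\<^sub>F i in sequentially. a < magnitude_fin (A i)" if a: "a < M" for a
    proof -
      \<comment> \<open>A positive lower bound is needed so that the estimate of the energy can be
        multiplied by it. Positivity of \<open>h e\<close> says that the quotient still exceeds
        \<open>a'\<close> when mass and energy are both off by \<open>e\<close> in the unfavourable
        direction.\<close>
      define a' where "a' = max a (M / 2)"
      have a': "a \<le> a'" "a' < M" "0 < a'" using a M1 by (auto simp: a'_def)
      define h where "h e = (M - e)\<^sup>2 - a' * (M + e)" for e
      have "(h \<longlongrightarrow> (M - 0)\<^sup>2 - a' * (M + 0)) (at_right 0)"
        unfolding h_def by (intro tendsto_intros)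
      moreover have "0 < (M - 0)\<^sup>2 - a' * (M + 0)"
        using a' M1 by (simp add: power2_eq_square)
      ultimately have "\<forall>\<^sub>F e in at_right 0. 0 < h e"
        using order_tendstoD(1) by blast
      moreover have "\<forall>\<^sub>F e::real in at_right 0. e < 1"
        by (rule eventually_at_rightI[of 0 1]) auto
      moreover have "\<forall>\<^sub>F e::real in at_right 0. 0 < e"
        by (rule eventually_at_right_less)
      ultimately have "\<forall>\<^sub>F e in at_right 0. 0 < h e \<and> e < 1 \<and> 0 < e"
        by eventually_elim auto
      then obtain e where e: "0 < h e" "e < 1" "0 < e"
        using eventually_happens'[OF trivial_limit_at_right_real] by blast
      obtain B v where B: "finite B" "B \<subseteq> X" "\<bar>sum v B - M\<bar> \<le> e" "\<bar>zform B B v v - M\<bar> \<le> e"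
        using approx[OF e(3)] by blast
      have "a' * zform B B v v \<le> a' * (M + e)"
        using B(4) a'(3) by (intro mult_left_mono) auto
      also have "\<dots> < (M - e)\<^sup>2" using e(1) by (simp add: h_def)
      also have "\<dots> \<le> (sum v B)\<^sup>2"
        using B(3) e(2) M1 by (intro power_mono) auto
      finally have "a' * zform B B v v < (sum v B)\<^sup>2" .
      then have "\<forall>\<^sub>F i in sequentially. a' < magnitude_fin (A i)"
        by (intro magnitude_lower_limit[OF X(1) psd A lim bounds(2) B(1,2)])
      then show ?thesis
        by eventually_elim (use a'(1) in linarith)
    qed
  qed
  show ?thesis
    unfolding magnitude_def
  proof (rule the_equality)
    fix m assume m: "\<forall>A :: nat \<Rightarrow> 'a set. (\<forall>i. finite (A i) \<and> A i \<noteq> {} \<and> A i \<subseteq> X) \<and>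
      (\<lambda>i. hausdorff_dist (A i) X) \<longlonglongrightarrow> 0 \<longrightarrow> (\<lambda>i. magnitude_fin (A i)) \<longlonglongrightarrow> m"
    \<comment> \<open>Uniqueness of the limit requires that some approximating sequence exists;
      otherwise every \<open>m\<close> would satisfy the implication.\<close>
    obtain A :: "nat \<Rightarrow> 'a set" where A: "\<And>i. finite (A i) \<and> A i \<noteq> {} \<and> A i \<subseteq> X"
      "(\<lambda>i. hausdorff_dist (A i) X) \<longlonglongrightarrow> 0"
      using exists_hausdorff_approximation[OF X] by blast
    then have "(\<lambda>i. magnitude_fin (A i)) \<longlonglongrightarrow> M" by (intro conv) auto
    then show "m = M" using m A LIMSEQ_unique by blast
  next
    show "\<forall>A :: nat \<Rightarrow> 'a set. (\<forall>i. finite (A i) \<and> A i \<noteq> {} \<and> A i \<subseteq> X) \<and>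
      (\<lambda>i. hausdorff_dist (A i) X) \<longlonglongrightarrow> 0 \<longrightarrow> (\<lambda>i. magnitude_fin (A i)) \<longlonglongrightarrow> M"
      by (intro allI impI conv) simp_all
  qed
qed

section \<open>Positive definiteness of the exponential kernel\<close>

text \<open>Schur product argument: one factor \<open>x \<bullet> z\<close> expanded over
  \<open>Basis\<close> is absorbed into the weights, turning the form of order \<open>Suc k\<close>
  into a sum of forms of order \<open>k\<close>. The induction therefore runs over all
  \<open>a\<close>.\<close>

lemma inner_power_psd:
  fixes a :: "'a::euclidean_space \<Rightarrow> real"
  assumes "finite A"
  shows "0 \<le> (\<Sum>x\<in>A. \<Sum>z\<in>A. a x * a z * (x \<bullet> z) ^ k)"
proof (induction k arbitrary: a)
  case 0
  have "(\<Sum>x\<in>A. \<Sum>z\<in>A. a x * a z * (x \<bullet> z) ^ 0) = (sum a A)\<^sup>2"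
    by (simp add: power2_eq_square sum_product)
  then show ?case by simp
next
  case (Suc k)
  have "(\<Sum>x\<in>A. \<Sum>z\<in>A. a x * a z * (x \<bullet> z) ^ Suc k)
      = (\<Sum>x\<in>A. \<Sum>z\<in>A. \<Sum>b\<in>Basis. (a x * (x \<bullet> b)) * (a z * (z \<bullet> b)) * (x \<bullet> z) ^ k)"
  proof (intro sum.cong refl)
    fix x z
    have "a x * a z * (x \<bullet> z) ^ Suc k = a x * a z * (x \<bullet> z) ^ k * (\<Sum>b\<in>Basis. (x \<bullet> b) * (z \<bullet> b))"
      unfolding euclidean_inner[of x z, symmetric] by simp
    also have "\<dots> = (\<Sum>b\<in>Basis. (a x * (x \<bullet> b)) * (a z * (z \<bullet> b)) * (x \<bullet> z) ^ k)"
      unfolding sum_distrib_left by (intro sum.cong refl) (simp add: mult_ac)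
    finally show "a x * a z * (x \<bullet> z) ^ Suc k = \<dots>" .
  qed
  also have "\<dots> = (\<Sum>b\<in>Basis. \<Sum>x\<in>A. \<Sum>z\<in>A. (a x * (x \<bullet> b)) * (a z * (z \<bullet> b)) * (x \<bullet> z) ^ k)"
    by (subst sum.swap[of _ _ A], subst sum.swap[of _ _ A]) (rule refl)
  also have "\<dots> \<ge> 0"
    by (intro sum_nonneg Suc.IH)
  finally show ?case .
qed

text \<open>Expanding the squared distance leaves factors depending on one point only, which go into
  the weights, and the exponential of \<open>2 * c * (x \<bullet> z)\<close>, a power series with
  nonnegative coefficients.\<close>

lemma gaussian_kernel_psd:
  fixes v :: "'a::euclidean_space \<Rightarrow> real"
  assumes "finite A" "0 \<le> c"
  shows "0 \<le> (\<Sum>x\<in>A. \<Sum>z\<in>A. v x * v z * exp (- c * (dist x z)\<^sup>2))"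
proof -
  define a where "a x = v x * exp (- c * (norm x)\<^sup>2)" for x
  have eq: "v x * v z * exp (- c * (dist x z)\<^sup>2) = a x * a z * exp (2 * c * (x \<bullet> z))" for x z
  proof -
    have "- c * (dist x z)\<^sup>2 = - c * (norm x)\<^sup>2 + (- c * (norm z)\<^sup>2) + 2 * c * (x \<bullet> z)"
      by (simp add: dist_norm power2_norm_eq_inner inner_diff inner_commute algebra_simps)
    then show ?thesis by (simp only: a_def exp_add mult_ac)
  qed
  have lim: "(\<lambda>k. \<Sum>x\<in>A. \<Sum>z\<in>A. a x * a z * ((2 * c * (x \<bullet> z)) ^ k /\<^sub>R fact k)) sums
        (\<Sum>x\<in>A. \<Sum>z\<in>A. a x * a z * exp (2 * c * (x \<bullet> z)))"
    by (intro sums_sum sums_mult exp_converges)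
  have nonneg: "0 \<le> (\<Sum>x\<in>A. \<Sum>z\<in>A. a x * a z * ((2 * c * (x \<bullet> z)) ^ k /\<^sub>R fact k))" for k
  proof -
    have "(\<Sum>x\<in>A. \<Sum>z\<in>A. a x * a z * ((2 * c * (x \<bullet> z)) ^ k /\<^sub>R fact k))
        = (2 * c) ^ k / fact k * (\<Sum>x\<in>A. \<Sum>z\<in>A. a x * a z * (x \<bullet> z) ^ k)"
      unfolding sum_distrib_left by (intro sum.cong refl) (simp add: power_mult_distrib field_simps)
    then show ?thesis using inner_power_psd[OF assms(1), of a k] assms(2) by simp
  qed
  show ?thesis
    unfolding eq by (rule sums_le[OF nonneg sums_zero lim])
qed

text \<open>The Cauchy--Schloemilch substitution: the integral does not depend on \<open>r\<close>, since
  \<open>y \<mapsto> r / y\<close> reverses the sign of \<open>y - r / y\<close>.\<close>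
lemma Cauchy_Schloemilch:
  fixes f :: "real \<Rightarrow> real"
  assumes r: "0 < r"
    and f: "f absolutely_integrable_on UNIV" "continuous_on UNIV f" "\<And>x. f (- x) = f x"
  shows "(\<lambda>y. f (y - r / y)) absolutely_integrable_on {0<..}"
    and "integral {0<..} (\<lambda>y. f (y - r / y)) = integral UNIV f / 2"
proof -
  define h where "h y = f (y - r / y)" for y
  have inj: "inj_on (\<lambda>y. y - r / y) {0<..}"
  proof (rule inj_onI)
    fix x y :: real assume xy: "x \<in> {0<..}" "y \<in> {0<..}" "x - r / x = y - r / y"
    then have "(x - y) * (x * y + r) = 0" by (simp add: field_simps)
    moreover have "x * y + r > 0" using xy r by (simp add: add_pos_pos)
    ultimately show "x = y" by simp
  qed
  have surj: "(\<lambda>y. y - r / y) ` {0<..} = UNIV"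
  proof (intro equalityI subset_UNIV subsetI)
    fix z :: real
    define y where "y = (z + sqrt (z\<^sup>2 + 4 * r)) / 2"
    have "\<bar>z\<bar> < sqrt (z\<^sup>2 + 4 * r)"
      using r by (intro real_less_rsqrt) simp
    then have y: "0 < y" by (simp add: y_def)
    have "2 * y - z = sqrt (z\<^sup>2 + 4 * r)" by (simp add: y_def field_simps)
    then have "(2 * y - z)\<^sup>2 = z\<^sup>2 + 4 * r" using r by simp
    then have "y * y - r = z * y" by (simp add: power2_eq_square algebra_simps)
    then have "z = y - r / y" using y by (simp add: field_simps)
    with y show "z \<in> (\<lambda>y. y - r / y) ` {0<..}" by auto
  qed
  have der: "((\<lambda>y. y - r / y) has_field_derivative (1 + r / y\<^sup>2)) (at y within {0<..})"
    if "y \<in> {0<..}" for y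
    using that by (auto intro!: derivative_eq_intros simp: power2_eq_square)
  have lm: "{0<..} \<in> sets (lebesgue :: real measure)" by simp
  have full: "(\<lambda>y. \<bar>1 + r / y\<^sup>2\<bar> * h y) absolutely_integrable_on {0<..} \<and>
      integral {0<..} (\<lambda>y. \<bar>1 + r / y\<^sup>2\<bar> * h y) = integral UNIV f"
    unfolding h_def
    using has_absolute_integral_change_of_variables_1'[OF lm der inj, of f "integral UNIV f"] f(1) surj
    by simp
  have conth: "continuous_on {0<..} h"
    unfolding h_def by (intro continuous_on_compose2[OF f(2)] continuous_intros) auto
  have h_int: "h absolutely_integrable_on {0<..}"
  proof (rule measurable_bounded_by_integrable_imp_absolutely_integrable)
    show "h \<in> borel_measurable (lebesgue_on {0<..})"
      by (rule continuous_imp_measurable_on_sets_lebesgue[OF conth lm])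
    show "(\<lambda>y. norm (\<bar>1 + r / y\<^sup>2\<bar> * h y)) integrable_on {0<..}"
      using full unfolding absolutely_integrable_on_def by blast
    show "norm (h y) \<le> norm (\<bar>1 + r / y\<^sup>2\<bar> * h y)" if "y \<in> {0<..}" for y
    proof -
      have "1 * \<bar>h y\<bar> \<le> (1 + r / y\<^sup>2) * \<bar>h y\<bar>"
        using r by (intro mult_right_mono) auto
      moreover have "0 < 1 + r / y\<^sup>2" using r by (simp add: add_pos_nonneg)
      ultimately show ?thesis by (simp add: abs_mult)
    qed
  qed auto
  have inj2: "inj_on (\<lambda>y. r / y) {0<..}"
    using r by (auto simp: inj_on_def field_simps)
  have surj2: "(\<lambda>y. r / y) ` {0<..} = {0<..}"
  proof (intro equalityI subsetI)
    fix z :: real assume "z \<in> {0<..}"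
    then have "r / z \<in> {0<..}" "z = r / (r / z)" using r by auto
    then show "z \<in> (\<lambda>y. r / y) ` {0<..}" by blast
  qed (use r in auto)
  have der2: "((\<lambda>y. r / y) has_field_derivative (- r / y\<^sup>2)) (at y within {0<..})"
    if "y \<in> {0<..}" for y
    using that by (auto intro!: derivative_eq_intros simp: power2_eq_square)
  have h_inv: "h (r / y) = h y" if "y \<in> {0<..}" for y
    using that r f(3)[of "y - r / y"] by (simp add: h_def)
  have refl_int: "(\<lambda>y. \<bar>- r / y\<^sup>2\<bar> * h (r / y)) absolutely_integrable_on {0<..} \<and>
      integral {0<..} (\<lambda>y. \<bar>- r / y\<^sup>2\<bar> * h (r / y)) = integral {0<..} h"
    using has_absolute_integral_change_of_variables_1'[OF lm der2 inj2, of h "integral {0<..} h"]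
      h_int surj2 by simp
  \<comment> \<open>The Jacobian \<open>1 + r / y\<^sup>2\<close> has two summands; the inversion
    \<open>r / y\<close> shows that they contribute equally, hence the factor one half.\<close>
  have "integral UNIV f = integral {0<..} (\<lambda>y. h y + \<bar>- r / y\<^sup>2\<bar> * h (r / y))"
    unfolding conjunct2[OF full, symmetric]
    by (rule integral_cong) (use h_inv r in \<open>auto simp: abs_mult algebra_simps\<close>)
  also have "\<dots> = integral {0<..} h + integral {0<..} h"
    using h_int refl_int by (subst integral_add) (auto simp: absolutely_integrable_on_def)
  finally show "integral {0<..} (\<lambda>y. f (y - r / y)) = integral UNIV f / 2"
    by (simp add: h_def[abs_def])
  show "(\<lambda>y. f (y - r / y)) absolutely_integrable_on {0<..}"
    using h_int by (simp add: h_def[abs_def])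
qed

text \<open>By the Cauchy--Schloemilch substitution, \<open>exp (- r)\<close> is a positive mixture of the Gaussians
  \<open>exp (- (r / y)\<^sup>2)\<close>, up to scaling of \<open>r\<close>.\<close>
lemma exp_dist_psd:
  fixes v :: "'a::euclidean_space \<Rightarrow> real"
  assumes A: "finite A"
  shows "0 \<le> zform A A v v"
proof -
  define f where "f y = exp (- y\<^sup>2)" for y :: real
  have gauss: "has_bochner_integral lborel f (sqrt pi)"
    using has_bochner_integral_even_function[OF gaussian_moment_0] by (simp add: f_def[abs_def])
  have f_ai: "f absolutely_integrable_on UNIV"
    using gauss integrable_completion[of f lborel] borel_measurable_has_bochner_integral[OF gauss]
    by (simp add: has_bochner_integral_iff set_integrable_def)
  have f_int: "integral UNIV f = sqrt pi"
    using has_integral_integral_lborel[of f] gauss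
    unfolding has_bochner_integral_iff by (metis integral_unique)
  have f_cont: "continuous_on UNIV f" and f_even: "f (- x) = f x" for x
    unfolding f_def by (intro continuous_intros) simp
  \<comment> \<open>The shift by \<open>e\<close> keeps \<open>r x z\<close> positive on the
    diagonal too, as the substitution requires. It is removed by a limit at the end.\<close>
  have pos: "0 \<le> (\<Sum>x\<in>A. \<Sum>z\<in>A. v x * v z * exp (- sqrt ((dist x z)\<^sup>2 + e)))" if e: "0 < e" for e
  proof -
    define r where "r x z = sqrt ((dist x z)\<^sup>2 + e) / 2" for x z :: 'a
    have r0: "0 < r x z" for x z
      using e by (simp add: r_def add_nonneg_pos)
    note CS = Cauchy_Schloemilch[OF r0 f_ai f_cont f_even, unfolded f_int]
    define g where "g x z y = v x * v z * exp (- 2 * r x z) * f (y - r x z / y)" for x z y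
    have g_int: "g x z integrable_on {0<..}" for x z
      using CS(1)[of x z] unfolding g_def absolutely_integrable_on_def
      by (intro integrable_on_mult_right) auto
    have g_eq: "g x z y = exp (- y\<^sup>2) * exp (- e / (4 * y\<^sup>2)) * (v x * v z * exp (- (1 / (4 * y\<^sup>2)) * (dist x z)\<^sup>2))"
      if "0 < y" for x z y
    proof -
      have "(r x z)\<^sup>2 = ((dist x z)\<^sup>2 + e) / 4"
        using e by (simp add: r_def power_divide)
      \<comment> \<open>The cross term of the square cancels \<open>2 * r x z\<close>, so the
        squared distance separates from factors depending on \<open>y\<close> alone.\<close>
      then have "- 2 * r x z + - (y - r x z / y)\<^sup>2 = - y\<^sup>2 + - e / (4 * y\<^sup>2) + - (1 / (4 * y\<^sup>2)) * (dist x z)\<^sup>2"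
        using that by (simp add: power2_diff power_divide add_divide_distrib)
      then have "exp (- 2 * r x z) * exp (- (y - r x z / y)\<^sup>2)
          = exp (- y\<^sup>2) * exp (- e / (4 * y\<^sup>2)) * exp (- (1 / (4 * y\<^sup>2)) * (dist x z)\<^sup>2)"
        by (simp only: exp_add[symmetric])
      then show ?thesis by (simp only: g_def f_def mult_ac)
    qed
    have "integral {0<..} (\<lambda>y. \<Sum>x\<in>A. \<Sum>z\<in>A. g x z y) = (\<Sum>x\<in>A. \<Sum>z\<in>A. integral {0<..} (g x z))"
      using A by (subst integral_sum; (intro integrable_sum g_int)?)
        (auto intro!: sum.cong integral_sum integrable_sum g_int)
    also have "\<dots> = sqrt pi / 2 * (\<Sum>x\<in>A. \<Sum>z\<in>A. v x * v z * exp (- 2 * r x z))"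
      unfolding sum_distrib_left g_def by (intro sum.cong refl) (simp add: CS(2))
    finally have eq: "sqrt pi / 2 * (\<Sum>x\<in>A. \<Sum>z\<in>A. v x * v z * exp (- 2 * r x z))
        = integral {0<..} (\<lambda>y. \<Sum>x\<in>A. \<Sum>z\<in>A. g x z y)" by simp
    have "0 \<le> integral {0<..} (\<lambda>y. \<Sum>x\<in>A. \<Sum>z\<in>A. g x z y)"
    proof (rule integral_nonneg)
      show "(\<lambda>y. \<Sum>x\<in>A. \<Sum>z\<in>A. g x z y) integrable_on {0<..}"
        using A by (intro integrable_sum g_int)
      fix y :: real assume y: "y \<in> {0<..}"
      have "(\<Sum>x\<in>A. \<Sum>z\<in>A. g x z y) = exp (- y\<^sup>2) * exp (- e / (4 * y\<^sup>2)) *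
          (\<Sum>x\<in>A. \<Sum>z\<in>A. v x * v z * exp (- (1 / (4 * y\<^sup>2)) * (dist x z)\<^sup>2))"
        unfolding sum_distrib_left by (intro sum.cong refl g_eq) (use y in simp)
      also have "\<dots> \<ge> 0"
        by (intro mult_nonneg_nonneg gaussian_kernel_psd A) simp_all
      finally show "0 \<le> (\<Sum>x\<in>A. \<Sum>z\<in>A. g x z y)" .
    qed
    then have "0 \<le> (\<Sum>x\<in>A. \<Sum>z\<in>A. v x * v z * exp (- 2 * r x z))"
      unfolding eq[symmetric] using pi_gt_zero by (auto simp: zero_le_mult_iff)
    then show ?thesis by (simp add: r_def)
  qed
  have "((\<lambda>e. \<Sum>x\<in>A. \<Sum>z\<in>A. v x * v z * exp (- sqrt ((dist x z)\<^sup>2 + e)))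
      \<longlongrightarrow> (\<Sum>x\<in>A. \<Sum>z\<in>A. v x * v z * exp (- sqrt ((dist x z)\<^sup>2 + 0)))) (at_right 0)"
    by (intro tendsto_sum tendsto_mult tendsto_const tendsto_exp tendsto_minus tendsto_real_sqrt tendsto_add tendsto_ident_at)
  then have "0 \<le> (\<Sum>x\<in>A. \<Sum>z\<in>A. v x * v z * exp (- sqrt ((dist x z)\<^sup>2 + 0)))"
  proof (rule tendsto_lowerbound)
    show "\<forall>\<^sub>F e in at_right 0. 0 \<le> (\<Sum>x\<in>A. \<Sum>z\<in>A. v x * v z * exp (- sqrt ((dist x z)\<^sup>2 + e)))"
      using eventually_at_right_less[of "0::real"] by eventually_elim (rule pos)
  qed simp
  then show ?thesis by (simp add: zform_def)
qed

section \<open>Projections of radial measures\<close>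

lemma nn_integral_lborel_translate:
  fixes h :: "'a::euclidean_space \<Rightarrow> ennreal"
  assumes [measurable]: "h \<in> borel_measurable borel"
  shows "(\<integral>\<^sup>+x. h (c + x) \<partial>lborel) = (\<integral>\<^sup>+x. h x \<partial>lborel)"
proof -
  have "(\<integral>\<^sup>+x. h x \<partial>lborel) = (\<integral>\<^sup>+x. h x \<partial>distr lborel borel ((+) c))"
    by (simp only: lborel_distr_plus)
  also have "\<dots> = (\<integral>\<^sup>+x. h (c + x) \<partial>lborel)"
    by (subst nn_integral_distr) simp_all
  finally show ?thesis by simp
qed

text \<open>The image measure is translation invariant and agrees with \<open>lborel\<close> on the unit ball \<open>B\<close>;
  evaluating \<open>\<integral>\<integral> 1\<^bsub>A\<^esub>(f x) 1\<^bsub>B\<^esub>(f x - y)\<close> in both orders identifies the two measures.\<close>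
lemma lborel_distr_orthogonal:
  fixes f :: "'a::euclidean_space \<Rightarrow> 'a"
  assumes lin: "linear f" and nrm: "\<And>x. norm (f x) = norm x"
  shows "distr lborel borel f = lborel"
proof (rule measure_eqI)
  fix A :: "'a set" assume "A \<in> sets (distr lborel borel f)"
  then have A [measurable]: "A \<in> sets borel" by simp
  have f [measurable]: "f \<in> borel_measurable borel"
    using linear_continuous_on[of f UNIV] lin
    by (intro borel_measurable_continuous_onI) (simp add: linear_conv_bounded_linear)
  have "inj f"
    using lin nrm by (metis linear_injective_0 norm_eq_zero)
  then have "surj f" using lin by (simp add: linear_injective_imp_surjective)
  then obtain g where g: "\<And>y. f (g y) = y" by (metis surj_f_inv_f)
  define B where "B = cball (0::'a) 1"
  have B [measurable]: "B \<in> sets borel" by (simp add: B_def)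
  define \<beta> where "\<beta> = emeasure lborel B"
  have \<beta>: "\<beta> \<noteq> 0" "\<beta> \<noteq> \<infinity>"
    using emeasure_cball[of 1 "0::'a"] unit_ball_vol_pos[of "DIM('a)"]
    by (auto simp: \<beta>_def B_def simp del: unit_ball_vol_pos)
  have ball_trans: "(\<integral>\<^sup>+y. indicator B (c - y) \<partial>lborel) = \<beta>" for c :: 'a
  proof -
    have "(\<integral>\<^sup>+y. indicator B (c - y) \<partial>lborel) = (\<integral>\<^sup>+y. indicator (cball c 1) y \<partial>(lborel :: 'a measure))"
      by (intro nn_integral_cong) (auto simp: B_def indicator_def dist_norm norm_minus_commute)
    then show ?thesis by (simp add: \<beta>_def B_def emeasure_cball)
  qed
  have A_trans: "(\<integral>\<^sup>+y. indicator A (c + y) \<partial>lborel) = emeasure lborel A" for c :: 'a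
    by (subst nn_integral_lborel_translate) simp_all
  have "emeasure (distr lborel borel f) A = (\<integral>\<^sup>+x. indicator A (f x) \<partial>lborel)"
    using nn_integral_distr[of f lborel borel "indicator A"] by simp
  then have "\<beta> * emeasure (distr lborel borel f) A = (\<integral>\<^sup>+x. indicator A (f x) * \<beta> \<partial>lborel)"
    by (subst nn_integral_multc) (simp_all add: mult.commute)
  also have "\<dots> = (\<integral>\<^sup>+x. \<integral>\<^sup>+y. indicator A (f x) * indicator B (f x - y) \<partial>lborel \<partial>lborel)"
    by (intro nn_integral_cong) (simp add: nn_integral_cmult ball_trans)
  also have "\<dots> = (\<integral>\<^sup>+y. \<integral>\<^sup>+x. indicator A (f x) * indicator B (f x - y) \<partial>lborel \<partial>lborel)"
    by (rule lborel_pair.Fubini') simp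
  also have "\<dots> = (\<integral>\<^sup>+y. \<integral>\<^sup>+x. indicator A (f x + y) * indicator B x \<partial>lborel \<partial>lborel)"
  proof (rule nn_integral_cong)
    fix y :: 'a
    have "(\<integral>\<^sup>+x. indicator A (f x) * indicator B (f x - y) \<partial>lborel)
        = (\<integral>\<^sup>+x. indicator A (f (g y + x)) * indicator B (f (g y + x) - y) \<partial>lborel)"
      by (rule nn_integral_lborel_translate[symmetric]) simp
    also have "\<dots> = (\<integral>\<^sup>+x. indicator A (f x + y) * indicator B x \<partial>lborel)"
      by (intro nn_integral_cong)
        (simp add: linear_add[OF lin] g add.commute indicator_def B_def nrm)
    finally show "(\<integral>\<^sup>+x. indicator A (f x) * indicator B (f x - y) \<partial>lborel) = \<dots>" .
  qed
  also have "\<dots> = (\<integral>\<^sup>+x. \<integral>\<^sup>+y. indicator A (f x + y) * indicator B x \<partial>lborel \<partial>lborel)"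
    by (rule lborel_pair.Fubini') simp
  also have "\<dots> = (\<integral>\<^sup>+x. emeasure lborel A * indicator B x \<partial>lborel)"
    by (intro nn_integral_cong) (simp add: nn_integral_multc A_trans)
  also have "\<dots> = \<beta> * emeasure lborel A"
    by (subst nn_integral_cmult) (simp_all add: \<beta>_def mult.commute)
  finally show "emeasure (distr lborel borel f) A = emeasure lborel A"
    using \<beta> by (simp add: ennreal_mult_cancel_left)
qed simp

text \<open>The slice at height \<open>t\<close> is a ball of even dimension \<open>2 * p\<close>
  and radius \<open>sqrt (r\<^sup>2 - t\<^sup>2)\<close>, so its volume is polynomial in
  \<open>t\<close>.\<close>

lemma nn_integral_cball_Basis:
  fixes b :: "'a::euclidean_space" and g :: "real \<Rightarrow> ennreal"
  assumes b: "b \<in> Basis" and dim: "DIM('a) = 2 * p + 1" and r: "0 < r"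
    and g [measurable]: "g \<in> borel_measurable borel"
  shows "(\<integral>\<^sup>+x. indicator (cball 0 r) x * g (x \<bullet> b) \<partial>(lborel :: 'a measure))
    = (\<integral>\<^sup>+t. ennreal (unit_ball_vol (real (2 * p)) * (r\<^sup>2 - t\<^sup>2) ^ p) * indicator {-r..r} t * g t \<partial>lborel)"
proof -
  interpret product_sigma_finite "\<lambda>_. lborel :: real measure"
    by standard
  define B where "B = Basis - {b}"
  have B: "finite B" "b \<notin> B" "insert b B = Basis" "card B = 2 * p"
    using b dim by (auto simp: B_def)
  define e where "e f = (\<Sum>c\<in>Basis. f c *\<^sub>R c :: 'a)" for f
  have e_inner: "e f \<bullet> c = f c" if "c \<in> Basis" for f c
    using that by (simp add: e_def)
  have e_norm: "(norm (e f))\<^sup>2 = (f b)\<^sup>2 + (\<Sum>c\<in>B. (f c)\<^sup>2)" for f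
  proof -
    have "(norm (e f))\<^sup>2 = (\<Sum>c\<in>Basis. (f c)\<^sup>2)"
      unfolding power2_norm_eq_inner by (subst euclidean_inner) (simp add: e_inner power2_eq_square)
    then show ?thesis using B by (metis sum.insert)
  qed
  have [measurable]: "e \<in> borel_measurable (Pi\<^sub>M Basis (\<lambda>_. lborel))"
    unfolding e_def by simp
  have [measurable]: "cball (0::'a) r \<in> sets borel" by simp
  have "(\<integral>\<^sup>+x. indicator (cball 0 r) x * g (x \<bullet> b) \<partial>(lborel :: 'a measure))
      = (\<integral>\<^sup>+x. indicator (cball 0 r) x * g (x \<bullet> b) \<partial>distr (Pi\<^sub>M Basis (\<lambda>_. lborel)) borel e)"
    by (subst lborel_eq) (simp add: e_def[abs_def])
  also have "\<dots> = (\<integral>\<^sup>+f. indicator (cball 0 r) (e f) * g (f b) \<partial>Pi\<^sub>M Basis (\<lambda>_. lborel))"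
    by (subst nn_integral_distr) (measurable, simp add: e_inner[OF b])
  also have "\<dots> = (\<integral>\<^sup>+f. indicator (cball 0 r) (e f) * g (f b) \<partial>Pi\<^sub>M (insert b B) (\<lambda>_. lborel))"
    using B by simp
  also have "\<dots> = (\<integral>\<^sup>+t. \<integral>\<^sup>+f. indicator (cball 0 r) (e (f(b := t))) * g t \<partial>Pi\<^sub>M B (\<lambda>_. lborel) \<partial>lborel)"
  proof (subst product_nn_integral_insert_rev[OF B(1,2)])
    have [measurable]: "(\<lambda>f. f b) \<in> borel_measurable (Pi\<^sub>M Basis (\<lambda>_. lborel :: real measure))"
      using measurable_component_singleton[OF b, of "\<lambda>_. lborel :: real measure"] by simp
    have "(\<lambda>f. indicator (cball 0 r) (e f) * g (f b)) \<in> borel_measurable (Pi\<^sub>M Basis (\<lambda>_. lborel))"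
      by measurable
    then show "(\<lambda>f. indicator (cball 0 r) (e f) * g (f b)) \<in> borel_measurable (Pi\<^sub>M (insert b B) (\<lambda>_. lborel))"
      using B(3) by simp
  qed simp
  also have "\<dots> = (\<integral>\<^sup>+t. ennreal (unit_ball_vol (real (2 * p)) * (r\<^sup>2 - t\<^sup>2) ^ p) * indicator {-r..r} t * g t \<partial>lborel)"
  proof (rule nn_integral_cong_AE)
    \<comment> \<open>At these two heights the slice has radius \<open>0\<close>; they are discarded
      so that the radius is positive whenever the slice is nonempty.\<close>
    have "AE t in lborel. t \<notin> {-r, r}"
      by (intro AE_not_in countable_imp_null_set_lborel) auto
    then show "AE t in lborel. (\<integral>\<^sup>+f. indicator (cball 0 r) (e (f(b := t))) * g t \<partial>Pi\<^sub>M B (\<lambda>_. lborel))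
        = ennreal (unit_ball_vol (real (2 * p)) * (r\<^sup>2 - t\<^sup>2) ^ p) * indicator {-r..r} t * g t"
    proof eventually_elim
      case (elim t)
      define S where "S = {f. sqrt (\<Sum>c\<in>B. (f c)\<^sup>2) \<le> sqrt (r\<^sup>2 - t\<^sup>2)} \<inter> space (Pi\<^sub>M B (\<lambda>_. lborel :: real measure))"
      have S [measurable]: "S \<in> sets (Pi\<^sub>M B (\<lambda>_. lborel))"
        unfolding S_def using B(1) by measurable
      have ind: "indicator (cball 0 r) (e (f(b := t))) = (indicator S f :: ennreal)"
        if "f \<in> space (Pi\<^sub>M B (\<lambda>_. lborel))" for f
      proof -
        have "norm (e (f(b := t))) \<le> r \<longleftrightarrow> (norm (e (f(b := t))))\<^sup>2 \<le> r\<^sup>2"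
          using r by (simp add: power_mono_iff)
        also have "\<dots> \<longleftrightarrow> t\<^sup>2 + (\<Sum>c\<in>B. (f c)\<^sup>2) \<le> r\<^sup>2"
        proof -
          have "(\<Sum>c\<in>B. ((f(b := t)) c)\<^sup>2) = (\<Sum>c\<in>B. (f c)\<^sup>2)"
            using B(2) by (intro sum.cong) auto
          then show ?thesis by (simp add: e_norm)
        qed
        also have "\<dots> \<longleftrightarrow> sqrt (\<Sum>c\<in>B. (f c)\<^sup>2) \<le> sqrt (r\<^sup>2 - t\<^sup>2)"
          by auto
        finally show ?thesis using that by (simp add: S_def indicator_def)
      qed
      have "(\<integral>\<^sup>+f. indicator (cball 0 r) (e (f(b := t))) * g t \<partial>Pi\<^sub>M B (\<lambda>_. lborel))
          = (\<integral>\<^sup>+f. indicator S f * g t \<partial>Pi\<^sub>M B (\<lambda>_. lborel))"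
        by (intro nn_integral_cong) (simp add: ind)
      also have "\<dots> = emeasure (Pi\<^sub>M B (\<lambda>_. lborel)) S * g t"
        by (simp add: nn_integral_multc)
      also have "emeasure (Pi\<^sub>M B (\<lambda>_. lborel)) S
          = ennreal (unit_ball_vol (real (2 * p)) * (r\<^sup>2 - t\<^sup>2) ^ p) * indicator {-r..r} t"
      proof (cases "t \<in> {-r<..<r}")
        case True
        then have "t\<^sup>2 < r\<^sup>2" by (intro power2_strict_mono) auto
        then show ?thesis
          using emeasure_cball_aux[OF B(1), of "sqrt (r\<^sup>2 - t\<^sup>2)"] True
          by (simp add: S_def B(4) power_mult)
      next
        case False
        then have t: "\<bar>t\<bar> > r" using elim by auto
        then have "t\<^sup>2 > r\<^sup>2" using r by (metis abs_of_pos power2_abs power2_strict_mono)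
        \<comment> \<open>\<open>sqrt\<close> is negative on negative arguments, so the condition
          defining \<open>S\<close> fails outright.\<close>
        then have "sqrt (r\<^sup>2 - t\<^sup>2) < 0" by simp
        moreover have "0 \<le> sqrt (\<Sum>c\<in>B. (f c)\<^sup>2)" for f :: "'a \<Rightarrow> real"
          by (simp add: sum_nonneg)
        ultimately have "\<not> sqrt (\<Sum>c\<in>B. (f c)\<^sup>2) \<le> sqrt (r\<^sup>2 - t\<^sup>2)" for f :: "'a \<Rightarrow> real"
          by (meson leD le_less_trans)
        then have "S = {}"
          unfolding S_def by blast
        then show ?thesis using t r by (auto simp: indicator_def)
      qed
      finally show ?case .
    qed
  qed
  finally show ?thesis .
qed

text \<open>A rotation moves \<open>u\<close> to a coordinate axis. The statement uses the squared
  radius \<open>s\<close> with arbitrary sign because the layer-cake argument integrates over all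
  levels \<open>s\<close>; for \<open>s \<le> 0\<close> both domains lie in the null set of the
  origin.\<close>

lemma nn_integral_cball_unit:
  fixes u :: "real ^ 'n" and g :: "real \<Rightarrow> ennreal"
  assumes u: "norm u = 1" and dim: "CARD('n) = 2 * p + 1"
    and g [measurable]: "g \<in> borel_measurable borel"
  shows "(\<integral>\<^sup>+x. indicator {x. (norm x)\<^sup>2 \<le> s} x * g (x \<bullet> u) \<partial>lborel)
    = (\<integral>\<^sup>+t. ennreal (unit_ball_vol (real (2 * p)) * (s - t\<^sup>2) ^ p) * indicator {t. t\<^sup>2 \<le> s} t * g t \<partial>lborel)"
proof (cases "0 < s")
  case True
  define r where "r = sqrt s"
  have r: "0 < r" "r\<^sup>2 = s" using True by (simp_all add: r_def)
  have ball: "{x :: real ^ 'n. (norm x)\<^sup>2 \<le> s} = cball 0 r"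
    using r by (auto simp: r(2)[symmetric] power_mono_iff)
  have ival: "{t. t\<^sup>2 \<le> s} = {-r..r}"
    using r by (auto simp: r(2)[symmetric] abs_le_square_iff[symmetric])
  define b where "b = (axis undefined 1 :: real ^ 'n)"
  have b: "b \<in> Basis" "norm b = 1" by (simp_all add: b_def axis_in_Basis_iff)
  obtain f where f: "orthogonal_transformation f" "f b = u"
    using orthogonal_transformation_exists_1[OF b(2) u] by blast
  have f': "linear f" "\<And>x. norm (f x) = norm x"
    using f(1) orthogonal_transformation[of f] by simp_all
  have f_inner: "f x \<bullet> f b = x \<bullet> b" for x
    using f(1) unfolding orthogonal_transformation_def by blast
  have [measurable]: "f \<in> borel_measurable borel"
    using linear_continuous_on[of f UNIV] f'(1)
    by (intro borel_measurable_continuous_onI) (simp add: linear_conv_bounded_linear)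
  have "(\<integral>\<^sup>+x. indicator (cball 0 r) x * g (x \<bullet> u) \<partial>lborel)
      = (\<integral>\<^sup>+x. indicator (cball 0 r) x * g (x \<bullet> u) \<partial>distr lborel borel f)"
    by (simp only: lborel_distr_orthogonal[OF f'(1,2)])
  also have "\<dots> = (\<integral>\<^sup>+x. indicator (cball 0 r) x * g (x \<bullet> b) \<partial>lborel)"
    by (subst nn_integral_distr) (simp_all add: f(2)[symmetric] f'(2) f_inner indicator_def)
  finally show ?thesis
    unfolding ball ival
    using nn_integral_cball_Basis[OF b(1) _ r(1) g, of p] dim r(2) by simp
next
  case False
  have "(\<integral>\<^sup>+x. indicator {x :: real ^ 'n. (norm x)\<^sup>2 \<le> s} x * g (x \<bullet> u) \<partial>lborel) = (\<integral>\<^sup>+(x::real^'n). 0 \<partial>lborel)"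
  proof (rule nn_integral_cong_AE)
    show "AE x in lborel. indicator {x :: real ^ 'n. (norm x)\<^sup>2 \<le> s} x * g (x \<bullet> u) = 0"
      using AE_lborel_singleton[of "0 :: real ^ 'n"]
    proof eventually_elim
      case (elim x)
      then have "0 < (norm x)\<^sup>2" by simp
      then have "\<not> (norm x)\<^sup>2 \<le> s" using False by linarith
      then show ?case by simp
    qed
  qed
  moreover have "(\<integral>\<^sup>+t. ennreal (unit_ball_vol (real (2 * p)) * (s - t\<^sup>2) ^ p) * indicator {t. t\<^sup>2 \<le> s} t * g t \<partial>lborel)
      = (\<integral>\<^sup>+(t::real). 0 \<partial>lborel)"
  proof (rule nn_integral_cong_AE)
    show "AE t in lborel. ennreal (unit_ball_vol (real (2 * p)) * (s - t\<^sup>2) ^ p) * indicator {t. t\<^sup>2 \<le> s} t * g t = 0"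
      using AE_lborel_singleton[of "0 :: real"]
    proof eventually_elim
      case (elim t)
      then have "0 < t\<^sup>2" by simp
      then have "\<not> t\<^sup>2 \<le> s" using False by linarith
      then show ?case by simp
    qed
  qed
  ultimately show ?thesis by simp
qed

section \<open>Truncated powers as radial densities and their projections\<close>

definition tpower :: "nat \<Rightarrow> real \<Rightarrow> real" where
  "tpower j a = (if 0 \<le> a then a ^ j else 0)"

lemma tpower_nonneg [simp]: "0 \<le> tpower j a"
  by (simp add: tpower_def)

lemma tpower_measurable [measurable]: "tpower j \<in> borel_measurable borel"
  unfolding tpower_def by measurable

lemma nn_integral_tpower:
  "ennreal (tpower (Suc j) (s - q))
    = (\<integral>\<^sup>+r. ennreal (real (Suc j)) * (indicator {..s} r * ennreal (tpower j (r - q))) \<partial>lborel)"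
proof (cases "q \<le> s")
  case True
  have "(\<integral>\<^sup>+r. ennreal (real (Suc j) * (r - q) ^ j) * indicator {q..s} r \<partial>lborel)
      = ennreal ((s - q) ^ Suc j - (q - q) ^ Suc j)"
  proof (rule nn_integral_FTC_Icc)
    show "((\<lambda>r. (r - q) ^ Suc j) has_real_derivative real (Suc j) * (r - q) ^ j) (at r)" for r
      by (rule derivative_eq_intros refl | simp)+
  qed (use True in auto)
  moreover have "ennreal (real (Suc j)) * (indicator {..s} r * ennreal (tpower j (r - q)))
      = ennreal (real (Suc j) * (r - q) ^ j) * indicator {q..s} r" for r
    by (auto simp: indicator_def tpower_def ennreal_mult simp del: of_nat_Suc)
  ultimately show ?thesis using True by (simp add: tpower_def)
next
  case False
  then have "ennreal (real (Suc j)) * (indicator {..s} r * ennreal (tpower j (r - q))) = 0" for r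
    by (auto simp: indicator_def tpower_def)
  then have "(\<integral>\<^sup>+r. ennreal (real (Suc j)) * (indicator {..s} r * ennreal (tpower j (r - q))) \<partial>lborel) = (\<integral>\<^sup>+(r::real). 0 \<partial>lborel)"
    by (intro nn_integral_cong)
  then show ?thesis using False by (simp only: nn_integral_const) (simp add: tpower_def)
qed

text \<open>In closed form this is \<open>pi ^ p * fact j / fact (j + p)\<close>, starting from the
  volume \<open>pi ^ p / fact p\<close> of the unit ball in dimension \<open>2 * p\<close>.\<close>

fun proj_const :: "nat \<Rightarrow> nat \<Rightarrow> real" where
  "proj_const p 0 = unit_ball_vol (real (2 * p))"
| "proj_const p (Suc j) = proj_const p j * real (Suc j) / real (Suc (j + p))"

lemma proj_const_pos: "0 < proj_const p j"
  by (induction j) auto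

text \<open>Layer-cake decomposition: raising the exponent \<open>j\<close> integrates the case \<open>j\<close> over concentric balls.\<close>
lemma nn_integral_radial_projection:
  fixes u :: "real ^ 'n" and g :: "real \<Rightarrow> ennreal"
  assumes u: "norm u = 1" and dim: "CARD('n) = 2 * p + 1"
    and g [measurable]: "g \<in> borel_measurable borel"
  shows "(\<integral>\<^sup>+x. ennreal (tpower j (s - (norm x)\<^sup>2)) * g (x \<bullet> u) \<partial>lborel)
    = ennreal (proj_const p j) * (\<integral>\<^sup>+t. ennreal (tpower (j + p) (s - t\<^sup>2)) * g t \<partial>lborel)"
proof (induction j arbitrary: s)
  case 0
  have "(\<integral>\<^sup>+x. ennreal (tpower 0 (s - (norm x)\<^sup>2)) * g (x \<bullet> u) \<partial>lborel)
      = (\<integral>\<^sup>+x. indicator {x. (norm x)\<^sup>2 \<le> s} x * g (x \<bullet> u) \<partial>lborel)"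
    by (intro nn_integral_cong) (simp add: indicator_def tpower_def)
  also have "\<dots> = (\<integral>\<^sup>+t. ennreal (proj_const p 0) * (ennreal (tpower (0 + p) (s - t\<^sup>2)) * g t) \<partial>lborel)"
    unfolding nn_integral_cball_unit[OF u dim g, of s]
    by (intro nn_integral_cong) (auto simp: ennreal_mult' indicator_def tpower_def mult_ac)
  also have "\<dots> = ennreal (proj_const p 0) * (\<integral>\<^sup>+t. ennreal (tpower (0 + p) (s - t\<^sup>2)) * g t \<partial>lborel)"
    by (rule nn_integral_cmult) measurable
  finally show ?case .
next
  case (Suc j)
  have c: "ennreal (real (Suc j)) * ennreal (proj_const p j) = ennreal (proj_const p (Suc j)) * ennreal (real (Suc (j + p)))"
    using proj_const_pos[of p j] by (simp add: ennreal_mult[symmetric] field_simps del: of_nat_Suc)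
  have "(\<integral>\<^sup>+x. ennreal (tpower (Suc j) (s - (norm x)\<^sup>2)) * g (x \<bullet> u) \<partial>lborel)
      = (\<integral>\<^sup>+x. \<integral>\<^sup>+r. ennreal (real (Suc j)) * (indicator {..s} r * (ennreal (tpower j (r - (norm x)\<^sup>2)) * g (x \<bullet> u))) \<partial>lborel \<partial>lborel)"
    unfolding nn_integral_tpower
    by (intro nn_integral_cong, subst nn_integral_multc[symmetric]) (auto simp: mult_ac intro!: nn_integral_cong)
  also have "\<dots> = (\<integral>\<^sup>+r. \<integral>\<^sup>+x. ennreal (real (Suc j)) * (indicator {..s} r * (ennreal (tpower j (r - (norm x)\<^sup>2)) * g (x \<bullet> u))) \<partial>lborel \<partial>lborel)"
    by (rule lborel_pair.Fubini'[symmetric]) measurable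
  also have "\<dots> = (\<integral>\<^sup>+r. \<integral>\<^sup>+t. ennreal (real (Suc j)) * (indicator {..s} r * (ennreal (proj_const p j) * (ennreal (tpower (j + p) (r - t\<^sup>2)) * g t))) \<partial>lborel \<partial>lborel)"
    by (intro nn_integral_cong) (simp add: nn_integral_cmult Suc.IH)
  also have "\<dots> = (\<integral>\<^sup>+t. \<integral>\<^sup>+r. ennreal (real (Suc j)) * (indicator {..s} r * (ennreal (proj_const p j) * (ennreal (tpower (j + p) (r - t\<^sup>2)) * g t))) \<partial>lborel \<partial>lborel)"
    by (rule lborel_pair.Fubini') measurable
  also have "\<dots> = (\<integral>\<^sup>+t. ennreal (proj_const p (Suc j)) * (ennreal (tpower (Suc j + p) (s - t\<^sup>2)) * g t) \<partial>lborel)"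
  proof (rule nn_integral_cong)
    fix t :: real
    have "(\<integral>\<^sup>+r. ennreal (real (Suc j)) * (indicator {..s} r * (ennreal (proj_const p j) * (ennreal (tpower (j + p) (r - t\<^sup>2)) * g t))) \<partial>lborel)
        = (\<integral>\<^sup>+r. ennreal (real (Suc j)) * ennreal (proj_const p j) * (indicator {..s} r * ennreal (tpower (j + p) (r - t\<^sup>2))) * g t \<partial>lborel)"
      by (intro nn_integral_cong) (simp only: mult_ac)
    also have "\<dots> = (\<integral>\<^sup>+r. ennreal (proj_const p (Suc j)) * (ennreal (real (Suc (j + p))) * (indicator {..s} r * ennreal (tpower (j + p) (r - t\<^sup>2)))) * g t \<partial>lborel)"
      unfolding c by (simp only: mult.assoc)
    also have "\<dots> = ennreal (proj_const p (Suc j)) * ennreal (tpower (Suc (j + p)) (s - t\<^sup>2)) * g t"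
      unfolding nn_integral_tpower by (subst nn_integral_multc, measurable, subst nn_integral_cmult, measurable)
    finally show "(\<integral>\<^sup>+r. ennreal (real (Suc j)) * (indicator {..s} r * (ennreal (proj_const p j) * (ennreal (tpower (j + p) (r - t\<^sup>2)) * g t))) \<partial>lborel)
      = ennreal (proj_const p (Suc j)) * (ennreal (tpower (Suc j + p) (s - t\<^sup>2)) * g t)"
      by (simp only: add_Suc mult.assoc)
  qed
  also have "\<dots> = ennreal (proj_const p (Suc j)) * (\<integral>\<^sup>+t. ennreal (tpower (Suc j + p) (s - t\<^sup>2)) * g t \<partial>lborel)"
    by (rule nn_integral_cmult) measurable
  finally show ?case .
qed

section \<open>Half-range Beta integrals and radial moments over balls\<close>

definition half_beta :: "nat \<Rightarrow> nat \<Rightarrow> real" where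
  "half_beta p m = 2 ^ p * fact p / (\<Prod>i\<le>p. real (m + 2 * i + 1))"

lemma half_beta_pos: "0 < half_beta p m"
  by (auto simp: half_beta_def intro!: divide_pos_pos prod_pos)

lemma half_beta_Suc: "half_beta (Suc p) m = half_beta p m - half_beta p (m + 2)"
proof -
  define Q where "Q = (\<Prod>i<p. real (m + 2 * i + 3))"
  have Q: "Q > 0" by (auto simp: Q_def intro!: prod_pos)
  have 1: "(\<Prod>i\<le>p. real (m + 2 * i + 1)) = real (m + 1) * Q"
    unfolding Q_def by (subst prod.atMost_shift) (simp add: add_ac)
  have 2: "(\<Prod>i\<le>p. real (m + 2 + 2 * i + 1)) = Q * real (m + 2 * p + 3)"
    unfolding Q_def lessThan_Suc_atMost[symmetric] by (simp add: add_ac)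
  have 3: "(\<Prod>i\<le>Suc p. real (m + 2 * i + 1)) = real (m + 1) * Q * real (m + 2 * p + 3)"
    using 1 by (simp add: add_ac)
  have "2 ^ Suc p * fact (Suc p) / (real (m + 1) * Q * real (m + 2 * p + 3))
      = 2 ^ p * fact p / (real (m + 1) * Q) - 2 ^ p * fact p / (Q * real (m + 2 * p + 3))"
    using Q by (simp add: divide_simps) (simp add: algebra_simps)
  then show ?thesis unfolding half_beta_def 1 2 3 .
qed

text \<open>These are halves of Beta values with parameters \<open>(m + 1) / 2\<close> and
  \<open>p + 1\<close>. Splitting off one factor \<open>1 - t\<^sup>2\<close> gives the recursion in
  \<open>p\<close> with \<open>m\<close> varying.\<close>

lemma has_integral_half_beta: "((\<lambda>t. t ^ m * (1 - t\<^sup>2) ^ p) has_integral half_beta p m) {0..1}"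
proof (induction p arbitrary: m)
  case 0
  have "((\<lambda>t::real. t ^ m) has_integral (1 ^ Suc m / real (Suc m) - 0 ^ Suc m / real (Suc m))) {0..1}"
  proof (rule fundamental_theorem_of_calculus)
    fix x :: real
    have "((\<lambda>t. t ^ Suc m / real (Suc m)) has_real_derivative x ^ m) (at x within {0..1})"
      by (rule derivative_eq_intros refl | simp)+
    then show "((\<lambda>t. t ^ Suc m / real (Suc m)) has_vector_derivative x ^ m) (at x within {0..1})"
      by (simp only: has_real_derivative_iff_has_vector_derivative)
  qed simp
  then show ?case by (simp add: half_beta_def add.commute)
next
  case (Suc p)
  have "((\<lambda>t. t ^ m * (1 - t\<^sup>2) ^ p - t ^ (m + 2) * (1 - t\<^sup>2) ^ p) has_integral half_beta p m - half_beta p (m + 2)) {0..1}"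
    by (intro has_integral_diff Suc.IH)
  then show ?case
    by (simp add: half_beta_Suc power_add algebra_simps power2_eq_square)
qed

lemma has_integral_even_Icc:
  fixes f :: "real \<Rightarrow> real"
  assumes f: "(f has_integral c) {0..r}" and even: "\<And>t. f (- t) = f t" and r: "0 \<le> r"
  shows "(f has_integral (2 * c)) {-r..r}"
proof -
  have "((\<lambda>t. f (- t)) has_integral c) {-r..-0}"
    using f by (simp only: has_integral_reflect_real)
  then have "(f has_integral c) {-r..0}" by (simp add: even)
  from has_integral_combine[OF _ _ this f] r show ?thesis by simp
qed

lemma nn_integral_abs_power_tpower:
  "(\<integral>\<^sup>+t. ennreal (tpower p (1 - t\<^sup>2)) * ennreal (\<bar>t\<bar> ^ m) \<partial>lborel) = ennreal (2 * half_beta p m)"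
proof -
  have "((\<lambda>t. \<bar>t\<bar> ^ m * (1 - t\<^sup>2) ^ p) has_integral half_beta p m) {0..1}"
    by (rule has_integral_eq[OF _ has_integral_half_beta]) auto
  then have "((\<lambda>t. \<bar>t\<bar> ^ m * (1 - t\<^sup>2) ^ p) has_integral 2 * half_beta p m) {-1..1}"
    by (intro has_integral_even_Icc) auto
  moreover have "0 \<le> \<bar>t\<bar> ^ m * (1 - t\<^sup>2) ^ p" if "t \<in> {-1..1}" for t :: real
    using that by (auto simp: abs_square_le_1)
  ultimately have "(\<integral>\<^sup>+t. ennreal (\<bar>t\<bar> ^ m * (1 - t\<^sup>2) ^ p) * indicator {-1..1} t \<partial>lborel) = ennreal (2 * half_beta p m)"
    by (intro nn_integral_has_integral_lebesgue')
  moreover have "ennreal (tpower p (1 - t\<^sup>2)) * ennreal (\<bar>t\<bar> ^ m)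
      = ennreal (\<bar>t\<bar> ^ m * (1 - t\<^sup>2) ^ p) * indicator {-1..1} t" for t :: real
    by (auto simp: tpower_def indicator_def ennreal_mult[symmetric] mult.commute abs_square_le_1 abs_le_iff)
  ultimately show ?thesis by simp
qed

lemma nn_integral_ball_scale:
  fixes h :: "'a::euclidean_space \<Rightarrow> ennreal"
  assumes [measurable]: "h \<in> borel_measurable borel" and h: "\<And>x. h (c *\<^sub>R x) = h x" and c: "0 < c"
  shows "(\<integral>\<^sup>+x. indicator (cball 0 c) x * h x \<partial>lborel)
    = ennreal (c ^ DIM('a)) * (\<integral>\<^sup>+x. indicator (cball 0 1) x * h x \<partial>lborel)"
proof -
  have [measurable]: "cball (0::'a) r \<in> sets borel" for r by simp
  have "(\<integral>\<^sup>+x. indicator (cball 0 c) x * h x \<partial>lborel)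
      = (\<integral>\<^sup>+x. indicator (cball 0 c) x * h x \<partial>density (distr lborel borel (\<lambda>x::'a. 0 + c *\<^sub>R x)) (\<lambda>_. ennreal (\<bar>c\<bar> ^ DIM('a))))"
    using c by (subst lborel_affine[of c 0]) simp_all
  also have "\<dots> = (\<integral>\<^sup>+x. ennreal (c ^ DIM('a)) * (indicator (cball 0 c) (c *\<^sub>R x) * h (c *\<^sub>R x)) \<partial>lborel)"
    using c by (simp add: nn_integral_density nn_integral_distr)
  also have "\<dots> = (\<integral>\<^sup>+x. ennreal (c ^ DIM('a)) * (indicator (cball 0 1) x * h x) \<partial>lborel)"
    using c by (intro nn_integral_cong) (simp add: h indicator_def)
  also have "\<dots> = ennreal (c ^ DIM('a)) * (\<integral>\<^sup>+x. indicator (cball 0 1) x * h x \<partial>lborel)"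
    by (rule nn_integral_cmult) measurable
  finally show ?thesis .
qed

text \<open>A replacement for polar coordinates: \<open>1 - norm x ^ m\<close> is the integral of
  \<open>m * t ^ (m - 1)\<close> from \<open>norm x\<close> to \<open>1\<close>. After exchanging
  the integrals, the inner one runs over a ball of radius \<open>t\<close> and scales like
  \<open>t ^ DIM('a)\<close>, since \<open>h\<close> is homogeneous of degree zero.\<close>

lemma nn_integral_ball_radial_moment:
  fixes h :: "'a::euclidean_space \<Rightarrow> ennreal"
  assumes [measurable]: "h \<in> borel_measurable borel" and h: "\<And>c x. 0 < c \<Longrightarrow> h (c *\<^sub>R x) = h x"
    and fin: "(\<integral>\<^sup>+x. indicator (cball 0 1) x * h x \<partial>lborel) < \<infinity>"
  shows "(\<integral>\<^sup>+x. indicator (cball 0 1) x * (ennreal (norm x ^ m) * h x) \<partial>lborel)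
    = ennreal (DIM('a) / (DIM('a) + m)) * (\<integral>\<^sup>+x. indicator (cball 0 1) x * h x \<partial>lborel)"
proof (cases m)
  case 0
  then show ?thesis by simp
next
  case (Suc k)
  let ?n = "DIM('a)"
  define I where "I = (\<integral>\<^sup>+x. indicator (cball 0 1) x * h x \<partial>lborel)"
  define J where "J = (\<integral>\<^sup>+x. indicator (cball 0 1) x * (ennreal (norm x ^ m) * h x) \<partial>lborel)"
  have [measurable]: "cball (0::'a) r \<in> sets borel" for r by simp
  have pow: "ennreal (1 - a ^ m) = (\<integral>\<^sup>+t. ennreal (real m * t ^ k) * indicator {a..1} t \<partial>lborel)"
    if "0 \<le> a" "a \<le> 1" for a :: real
  proof -
    have "(\<integral>\<^sup>+t. ennreal (real m * t ^ k) * indicator {a..1} t \<partial>lborel) = ennreal (1 ^ m - a ^ m)"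
    proof (rule nn_integral_FTC_Icc)
      show "((\<lambda>t. t ^ m) has_real_derivative real m * t ^ k) (at t)" for t
        unfolding Suc by (rule derivative_eq_intros refl | simp)+
    qed (use that in auto)
    then show ?thesis by simp
  qed
  have "(\<integral>\<^sup>+x. indicator (cball 0 1) x * (ennreal (1 - norm x ^ m) * h x) \<partial>lborel)
      = (\<integral>\<^sup>+x. \<integral>\<^sup>+t. (if norm x \<le> t \<and> t \<le> 1 then ennreal (real m * t ^ k) * h x else 0) \<partial>lborel \<partial>lborel)"
  proof (rule nn_integral_cong)
    fix x :: 'a
    show "indicator (cball 0 1) x * (ennreal (1 - norm x ^ m) * h x)
        = (\<integral>\<^sup>+t. (if norm x \<le> t \<and> t \<le> 1 then ennreal (real m * t ^ k) * h x else 0) \<partial>lborel)"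
    proof (cases "norm x \<le> 1")
      case True
      have "(\<integral>\<^sup>+t. (if norm x \<le> t \<and> t \<le> 1 then ennreal (real m * t ^ k) * h x else 0) \<partial>lborel)
          = (\<integral>\<^sup>+t. ennreal (real m * t ^ k) * indicator {norm x..1} t * h x \<partial>lborel)"
        by (intro nn_integral_cong) (auto simp: indicator_def)
      also have "\<dots> = ennreal (1 - norm x ^ m) * h x"
        using True by (subst nn_integral_multc) (simp_all add: pow)
      finally show ?thesis using True by simp
    next
      case False
      then have "(\<integral>\<^sup>+t. (if norm x \<le> t \<and> t \<le> 1 then ennreal (real m * t ^ k) * h x else 0) \<partial>lborel) = (\<integral>\<^sup>+(t::real). 0 \<partial>lborel)"
        by (intro nn_integral_cong) auto
      with False show ?thesis by (simp add: indicator_def)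
    qed
  qed
  also have "\<dots> = (\<integral>\<^sup>+t. \<integral>\<^sup>+x. (if norm x \<le> t \<and> t \<le> 1 then ennreal (real m * t ^ k) * h x else 0) \<partial>lborel \<partial>lborel)"
    by (rule lborel_pair.Fubini'[symmetric]) measurable
  also have "\<dots> = (\<integral>\<^sup>+t. ennreal (real m * t ^ (k + ?n)) * indicator {0..1} t * I \<partial>lborel)"
  proof (rule nn_integral_cong_AE)
    show "AE t in lborel. (\<integral>\<^sup>+x. (if norm x \<le> t \<and> t \<le> 1 then ennreal (real m * t ^ k) * h x else 0) \<partial>lborel)
        = ennreal (real m * t ^ (k + ?n)) * indicator {0..1} t * I"
      using AE_lborel_singleton[of "0::real"]
    proof eventually_elim
      case (elim t)
      show ?case
      proof (cases "0 < t \<and> t \<le> 1")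
        case True
        have "(\<integral>\<^sup>+x. (if norm x \<le> t \<and> t \<le> 1 then ennreal (real m * t ^ k) * h x else 0) \<partial>lborel)
            = (\<integral>\<^sup>+x. ennreal (real m * t ^ k) * (indicator (cball 0 t) x * h x) \<partial>lborel)"
          using True by (intro nn_integral_cong) (auto simp: indicator_def)
        also have "\<dots> = ennreal (real m * t ^ k) * (ennreal (t ^ ?n) * I)"
        proof -
          have "(\<integral>\<^sup>+x. indicator (cball 0 t) x * h x \<partial>lborel) = ennreal (t ^ ?n) * I"
            unfolding I_def using True by (intro nn_integral_ball_scale h) simp_all
          then show ?thesis by (subst nn_integral_cmult) simp_all
        qed
        finally show ?thesis
          using True by (simp add: ennreal_mult power_add mult.assoc)
      next
        case False
        have "\<not> (norm x \<le> t \<and> t \<le> 1)" for x :: 'a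
          using False elim norm_ge_zero[of x] by linarith
        then show ?thesis using False elim by (auto simp: indicator_def)
      qed
    qed
  qed
  also have "\<dots> = ennreal (real m / real (?n + m)) * I"
  proof -
    have "(\<integral>\<^sup>+t. ennreal (real m * t ^ (k + ?n)) * indicator {0..1} t \<partial>lborel)
        = ennreal (real m / real (?n + m) * 1 ^ (?n + m) - real m / real (?n + m) * 0 ^ (?n + m))"
    proof (rule nn_integral_FTC_Icc)
      fix t :: real
      have D: "((\<lambda>t. real m / real (?n + m) * t ^ (?n + m)) has_real_derivative
          real m / real (?n + m) * (real (?n + m) * t ^ (?n + m - Suc 0))) (at t)"
        by (rule DERIV_cmult[OF DERIV_pow])
      have cancel: "a / b * (b * c) = a * c" if "b \<noteq> 0" for a b c :: real
        using that by simp
      have e: "?n + m - Suc 0 = k + ?n" and "real (?n + m) \<noteq> 0" using Suc by simp_all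
      from D show "((\<lambda>t. real m / real (?n + m) * t ^ (?n + m)) has_real_derivative real m * t ^ (k + ?n)) (at t)"
        unfolding e cancel[OF \<open>real (?n + m) \<noteq> 0\<close>] .
    qed auto
    then show ?thesis using Suc by (subst nn_integral_multc) simp_all
  qed
  finally have K: "(\<integral>\<^sup>+x. indicator (cball 0 1) x * (ennreal (1 - norm x ^ m) * h x) \<partial>lborel)
      = ennreal (real m / real (?n + m)) * I" .
  have "I = (\<integral>\<^sup>+x. indicator (cball 0 1) x * (ennreal (norm x ^ m) * h x)
      + indicator (cball 0 1) x * (ennreal (1 - norm x ^ m) * h x) \<partial>lborel)"
    unfolding I_def
  proof (intro nn_integral_cong)
    fix x :: 'a
    have "ennreal (norm x ^ m) + ennreal (1 - norm x ^ m) = 1" if "norm x \<le> 1"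
      using that by (subst ennreal_plus[symmetric]) (simp_all add: power_le_one)
    then show "indicator (cball 0 1) x * h x = indicator (cball 0 1) x * (ennreal (norm x ^ m) * h x)
      + indicator (cball 0 1) x * (ennreal (1 - norm x ^ m) * h x)"
      by (auto simp: indicator_def distrib_right[symmetric])
  qed
  also have "\<dots> = J + ennreal (real m / real (?n + m)) * I"
    unfolding K[symmetric] J_def by (rule nn_integral_add) measurable
  finally have IJ: "I = J + ennreal (real m / real (?n + m)) * I" .
  \<comment> \<open>Finiteness allows the equation \<open>IJ\<close> to be solved for
    \<open>J\<close> in the reals.\<close>
  obtain i where i: "I = ennreal i" "0 \<le> i"
    using fin by (auto simp: I_def[symmetric] less_top_ennreal)
  have "J \<le> I" by (subst IJ) simp
  then obtain j where j: "J = ennreal j" "0 \<le> j"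
    using i by (cases J) (auto simp: top_unique)
  have "i = j + real m / real (?n + m) * i"
    using IJ i j by (simp add: ennreal_mult[symmetric] ennreal_plus[symmetric] del: ennreal_plus)
  moreover have "0 < real ?n + real m" by (simp add: add_pos_nonneg)
  ultimately have "j = real ?n / real (?n + m) * i"
    by (simp add: field_simps)
  then show ?thesis
    unfolding I_def[symmetric] J_def[symmetric] i j using i(2) by (simp add: ennreal_mult[symmetric])
qed

section \<open>The exponential kernel as an average over directions\<close>

text \<open>In dimension \<open>2 p + 1\<close> the kernel \<open>exp (- norm x)\<close> is the average over directions \<open>u\<close> of
  \<open>phi p \<bar>x \<bullet> u\<bar>\<close>: \<open>mu p m\<close> is the average of \<open>\<bar>x \<bullet> u\<bar> ^ m\<close> over directions for a unit vector \<open>x\<close>, so the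
  power series coefficients \<open>phic p m\<close> of \<open>phi p\<close> are those of the exponential divided by \<open>mu p m\<close>.\<close>
fun ell :: "nat \<Rightarrow> real poly" where
  "ell 0 = 1"
| "ell (Suc l) = smult (1 / real (2 * l + 1)) (pCons 0 (pderiv (ell l) - ell l)) + ell l"

definition phi :: "nat \<Rightarrow> real \<Rightarrow> real" where
  "phi p t = exp (- t) * poly (ell p) t"

definition mu :: "nat \<Rightarrow> nat \<Rightarrow> real" where
  "mu p m = (\<Prod>k<p. real (2 * k + 1) / real (m + 2 * k + 1))"

definition phic :: "nat \<Rightarrow> nat \<Rightarrow> real" where
  "phic p m = (-1) ^ m / fact m / mu p m"

lemma mu_pos: "0 < mu p m"
  by (auto simp: mu_def intro!: prod_pos)

lemma phic_Suc: "phic (Suc l) m = phic l m + real m * phic l m / real (2 * l + 1)"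
proof -
  have "mu (Suc l) m = mu l m * (real (2 * l + 1) / real (m + 2 * l + 1))"
    by (simp add: mu_def)
  then have "phic (Suc l) m = phic l m * (real (m + 2 * l + 1) / real (2 * l + 1))"
    by (simp add: phic_def)
  also have "real (m + 2 * l + 1) / real (2 * l + 1) = 1 + real m / real (2 * l + 1)"
    by (simp add: field_simps)
  finally show ?thesis by (simp add: distrib_left)
qed

lemma DERIV_phi: "(phi l has_real_derivative exp (- t) * poly (pderiv (ell l) - ell l) t) (at t within S)"
proof -
  have "((\<lambda>t. exp (- t)) has_real_derivative - exp (- t)) (at t within S)"
    by (rule derivative_eq_intros refl | simp)+
  from DERIV_mult[OF this has_field_derivative_at_within[OF poly_DERIV[of "ell l"]]]
  have "((\<lambda>t. exp (- t) * poly (ell l) t) has_real_derivative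
      - exp (- t) * poly (ell l) t + poly (pderiv (ell l)) t * exp (- t)) (at t within S)" .
  moreover have "- exp (- t) * poly (ell l) t + poly (pderiv (ell l)) t * exp (- t) = exp (- t) * poly (pderiv (ell l) - ell l) t"
    by (simp add: algebra_simps)
  ultimately show ?thesis by (simp only: phi_def[abs_def])
qed

lemma phi_Suc: "phi (Suc l) t = phi l t + t * (exp (- t) * poly (pderiv (ell l) - ell l) t) / real (2 * l + 1)"
proof -
  have "e * (1 / c * (t * x) + y) = e * y + t * (e * x) / c" for e c x y :: real
    by (simp add: distrib_left mult_ac)
  note eq = this
  show ?thesis
    unfolding phi_def ell.simps poly_add poly_smult poly_pCons add_0 by (rule eq)
qed

text \<open>The recursion for \<open>ell\<close> says that \<open>phi (Suc l)\<close> is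
  \<open>phi l\<close> plus \<open>t / (2 * l + 1)\<close> times its derivative. This multiplies the
  coefficient of \<open>t ^ m\<close> by \<open>(m + 2 * l + 1) / (2 * l + 1)\<close>, the
  reciprocal of the new factor of \<open>mu\<close>.\<close>

lemma phi_sums: "(\<lambda>m. phic p m * t ^ m) sums phi p t"
proof (induction p arbitrary: t)
  case 0
  have "(\<lambda>m. (- t) ^ m /\<^sub>R fact m) sums exp (- t)" by (rule exp_converges)
  moreover have "(- t) ^ m /\<^sub>R fact m = phic 0 m * t ^ m" for m
    by (simp add: phic_def mu_def power_minus[of t] field_simps)
  ultimately show ?case by (simp add: phi_def)
next
  case (Suc l)
  have fs: "phi l = (\<lambda>x. \<Sum>n. phic l n * x ^ n)"
    using Suc.IH by (auto simp: sums_iff)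
  have summ: "summable (\<lambda>n. phic l n * x ^ n)" for x
    using Suc.IH[of x] by (simp add: sums_iff)
  have "DERIV (phi l) t :> (\<Sum>n. diffs (phic l) n * t ^ n)"
    unfolding fs by (rule termdiffs_strong_converges_everywhere[OF summ])
  from DERIV_unique[OF DERIV_phi this]
  have D: "exp (- t) * poly (pderiv (ell l) - ell l) t = (\<Sum>n. diffs (phic l) n * t ^ n)" .
  have "summable (\<lambda>n. diffs (phic l) n * t ^ n)"
    by (rule termdiff_converges_all[OF summ])
  then have "(\<lambda>n. diffs (phic l) n * t ^ n) sums (exp (- t) * poly (pderiv (ell l) - ell l) t)"
    unfolding D by (rule summable_sums)
  then have "(\<lambda>n. t * (diffs (phic l) n * t ^ n)) sums (t * (exp (- t) * poly (pderiv (ell l) - ell l) t))"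
    by (rule sums_mult)
  moreover have "t * (diffs (phic l) n * t ^ n) = real (Suc n) * phic l (Suc n) * t ^ Suc n" for n
    by (simp add: diffs_def)
  ultimately have "(\<lambda>n. real (Suc n) * phic l (Suc n) * t ^ Suc n) sums (t * (exp (- t) * poly (pderiv (ell l) - ell l) t))"
    by simp
  then have "(\<lambda>n. real n * phic l n * t ^ n) sums (t * (exp (- t) * poly (pderiv (ell l) - ell l) t))"
    using sums_Suc_iff[of "\<lambda>n. real n * phic l n * t ^ n"] by simp
  then have "(\<lambda>n. phic l n * t ^ n + real n * phic l n * t ^ n / real (2 * l + 1)) sums
      (phi l t + t * (exp (- t) * poly (pderiv (ell l) - ell l) t) / real (2 * l + 1))"
    by (intro sums_add sums_divide Suc.IH)
  then show ?case
    unfolding phi_Suc phic_Suc by (simp add: algebra_simps)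
qed

text \<open>The normalised surface measure of the unit sphere, obtained from volume alone. Since
  \<open>sgn 0 = 0\<close>, its points have norm \<open>1\<close> only almost everywhere.\<close>

definition direction_measure :: "('a::euclidean_space) measure" where
  "direction_measure = distr (uniform_measure lborel (cball 0 1)) borel sgn"

lemma emeasure_unit_cball:
  "emeasure lborel (cball (0::'a::euclidean_space) 1) \<noteq> 0" "emeasure lborel (cball (0::'a) 1) \<noteq> \<infinity>"
  using emeasure_cball[of 1 "0::'a"] unit_ball_vol_pos[of "DIM('a)"]
  by (auto simp del: unit_ball_vol_pos)

lemma sgn_measurable [measurable]: "(sgn :: 'a::euclidean_space \<Rightarrow> 'a) \<in> borel_measurable borel"
  unfolding sgn_div_norm[abs_def] by measurable

lemma sets_direction_measure [simp, measurable_cong]: "sets direction_measure = sets borel"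
  and space_direction_measure [simp]: "space direction_measure = UNIV"
  by (simp_all add: direction_measure_def)

lemma prob_space_direction_measure: "prob_space (direction_measure :: ('a::euclidean_space) measure)"
  unfolding direction_measure_def
  using emeasure_unit_cball[where 'a='a]
  by (intro prob_space.prob_space_distr prob_space_uniform_measure) auto

lemma AE_direction_measure: "AE u in (direction_measure :: ('a::euclidean_space) measure). norm u = 1"
proof -
  have "AE x in uniform_measure lborel (cball (0::'a) 1). norm (sgn x) = 1"
  proof (rule AE_uniform_measureI)
    show "AE x in lborel. x \<in> cball (0::'a) 1 \<longrightarrow> norm (sgn x) = 1"
      using AE_lborel_singleton[of "0::'a"] by eventually_elim (simp add: norm_sgn)
  qed simp
  then show ?thesis
    unfolding direction_measure_def by (subst AE_distr_iff) auto
qed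

text \<open>The first factor undoes the radial moment in dimension \<open>2 * p + 1\<close>; the
  second is the normalised moment of one coordinate over the ball.\<close>

lemma half_beta_mu: "real (2 * p + 1 + m) / real (2 * p + 1) * (half_beta p m / half_beta p 0) = mu p m"
proof -
  define A where "A = (\<Prod>k<p. real (m + 2 * k + 1))"
  define B where "B = (\<Prod>k<p. real (2 * k + 1))"
  have pos: "A > 0" "B > 0" by (auto simp: A_def B_def intro!: prod_pos)
  have "half_beta p m = 2 ^ p * fact p / (A * real (2 * p + 1 + m))" "half_beta p 0 = 2 ^ p * fact p / (B * real (2 * p + 1))"
    by (simp_all add: half_beta_def A_def B_def lessThan_Suc_atMost[symmetric] add_ac)
  moreover have "mu p m = B / A" by (simp add: mu_def A_def B_def prod_dividef)
  moreover have "n / d * (c / (A * n) / (c / (B * d))) = B / A" if "n \<noteq> 0" "d \<noteq> 0" "c \<noteq> 0" for n d c :: real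
    using that pos by (simp add: field_simps)
  ultimately show ?thesis by simp
qed

text \<open>The integral of \<open>\<bar>x \<bullet> y\<bar> ^ m\<close> over the unit ball is
  computed twice: by projecting to the line through \<open>x\<close>, which gives
  \<open>half_beta\<close>, and by splitting \<open>y\<close> into norm and direction.\<close>

lemma nn_integral_direction_power:
  fixes x :: "real ^ 'n"
  assumes dim: "CARD('n) = 2 * p + 1"
  shows "(\<integral>\<^sup>+u. ennreal (\<bar>x \<bullet> u\<bar> ^ m) \<partial>direction_measure) = ennreal (norm x ^ m * mu p m)"
proof -
  define vol where "vol = 2 * proj_const p 0 * half_beta p 0"
  have vol: "0 < vol" by (simp add: vol_def half_beta_pos)
  have [measurable]: "cball (0::real^'n) r \<in> sets borel" for r by simp
  have ball: "indicator (cball 0 1) y = ennreal (tpower 0 (1 - (norm y)\<^sup>2))" for y :: "real ^ 'n"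
    by (simp add: tpower_def indicator_def power_le_one_iff abs_square_le_1)
  have proj: "(\<integral>\<^sup>+y. indicator (cball 0 1) y * ennreal (\<bar>e \<bullet> y\<bar> ^ k) \<partial>lborel) = ennreal (2 * proj_const p 0 * half_beta p k)"
    if "norm e = 1" for e :: "real ^ 'n" and k
  proof -
    have "(\<integral>\<^sup>+y. indicator (cball 0 1) y * ennreal (\<bar>e \<bullet> y\<bar> ^ k) \<partial>lborel)
        = ennreal (proj_const p 0) * ennreal (2 * half_beta p k)"
      using nn_integral_radial_projection[OF that dim, of "\<lambda>t. ennreal (\<bar>t\<bar> ^ k)" 0 1]
      unfolding add_0 nn_integral_abs_power_tpower by (simp add: ball inner_commute[of e] del: proj_const.simps)
    then show ?thesis
      using proj_const_pos[of p 0] half_beta_pos[of p k]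
      by (simp add: ennreal_mult[symmetric] mult_ac del: proj_const.simps)
  qed
  have emeas: "emeasure lborel (cball (0 :: real ^ 'n) 1) = ennreal vol"
    using proj[of "axis undefined 1" 0] by (simp add: vol_def)
  have J: "(\<integral>\<^sup>+y. indicator (cball 0 1) y * ennreal (\<bar>x \<bullet> y\<bar> ^ m) \<partial>lborel)
      = ennreal (norm x ^ m * (2 * proj_const p 0 * half_beta p m))"
  proof (cases "x = 0")
    case True
    then show ?thesis
      using emeas by (cases "m = 0") (simp_all add: vol_def power_0_left)
  next
    case False
    define e where "e = x /\<^sub>R norm x"
    have e: "norm e = 1" "x = norm x *\<^sub>R e" using False by (simp_all add: e_def)
    have "(\<integral>\<^sup>+y. indicator (cball 0 1) y * ennreal (\<bar>x \<bullet> y\<bar> ^ m) \<partial>lborel)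
        = (\<integral>\<^sup>+y. ennreal (norm x ^ m) * (indicator (cball 0 1) y * ennreal (\<bar>e \<bullet> y\<bar> ^ m)) \<partial>lborel)"
    proof (rule nn_integral_cong)
      fix y
      have "\<bar>x \<bullet> y\<bar> ^ m = norm x ^ m * \<bar>e \<bullet> y\<bar> ^ m"
        by (subst e(2)) (simp add: abs_mult power_mult_distrib)
      then show "indicator (cball 0 1) y * ennreal (\<bar>x \<bullet> y\<bar> ^ m)
          = ennreal (norm x ^ m) * (indicator (cball 0 1) y * ennreal (\<bar>e \<bullet> y\<bar> ^ m))"
        by (simp add: ennreal_mult mult_ac)
    qed
    also have "\<dots> = ennreal (norm x ^ m) * ennreal (2 * proj_const p 0 * half_beta p m)"
      unfolding proj[OF e(1), symmetric] by (rule nn_integral_cmult) measurable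
    finally show ?thesis
      using half_beta_pos[of p m] by (simp add: ennreal_mult)
  qed
  define I where "I = (\<integral>\<^sup>+y. indicator (cball 0 1) y * ennreal (\<bar>x \<bullet> sgn y\<bar> ^ m) \<partial>lborel)"
  have "I \<le> (\<integral>\<^sup>+y. ennreal (norm x ^ m) * indicator (cball 0 1) (y :: real ^ 'n) \<partial>lborel)"
    unfolding I_def
  proof (rule nn_integral_mono)
    fix y :: "real ^ 'n"
    have "\<bar>x \<bullet> sgn y\<bar> \<le> norm x * 1"
      by (rule order_trans[OF Cauchy_Schwarz_ineq2]) (intro mult_left_mono, simp_all add: norm_sgn)
    then show "indicator (cball 0 1) y * ennreal (\<bar>x \<bullet> sgn y\<bar> ^ m) \<le> ennreal (norm x ^ m) * indicator (cball 0 1) y"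
      by (simp add: indicator_def power_mono)
  qed
  also have "\<dots> = ennreal (norm x ^ m) * ennreal vol"
    by (subst nn_integral_cmult) (simp_all add: emeas)
  also have "\<dots> < \<infinity>" by (simp add: ennreal_mult_less_top)
  finally have fin: "I < \<infinity>" .
  have "(\<integral>\<^sup>+y. indicator (cball 0 1) y * (ennreal (norm y ^ m) * ennreal (\<bar>x \<bullet> sgn y\<bar> ^ m)) \<partial>lborel)
      = ennreal (DIM(real ^ 'n) / (DIM(real ^ 'n) + m)) * I"
    unfolding I_def
    by (rule nn_integral_ball_radial_moment) (use fin in \<open>simp_all add: I_def sgn_scaleR\<close>)
  moreover have "ennreal (norm y ^ m) * ennreal (\<bar>x \<bullet> sgn y\<bar> ^ m) = ennreal (\<bar>x \<bullet> y\<bar> ^ m)" for y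
  proof -
    have "norm y ^ m * \<bar>x \<bullet> sgn y\<bar> ^ m = (norm y * \<bar>x \<bullet> sgn y\<bar>) ^ m"
      by (simp add: power_mult_distrib)
    also have "norm y * \<bar>x \<bullet> sgn y\<bar> = \<bar>x \<bullet> (norm y *\<^sub>R sgn y)\<bar>"
      by (simp add: abs_mult)
    also have "norm y *\<^sub>R sgn y = y" by (cases "y = 0") (simp_all add: sgn_div_norm)
    finally show ?thesis by (simp add: ennreal_mult[symmetric])
  qed
  ultimately have IJ: "ennreal (norm x ^ m * (2 * proj_const p 0 * half_beta p m)) = ennreal (real (2 * p + 1) / real (2 * p + 1 + m)) * I"
    using J dim by simp
  obtain i where i: "I = ennreal i" "0 \<le> i"
    using fin by (auto simp: less_top_ennreal)
  have "norm x ^ m * (2 * proj_const p 0 * half_beta p m) = real (2 * p + 1) / real (2 * p + 1 + m) * i"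
    using IJ i half_beta_pos[of p m] proj_const_pos[of p 0]
    by (simp add: ennreal_mult[symmetric] del: proj_const.simps of_nat_add of_nat_Suc)
  then have i_eq: "i / vol = norm x ^ m * (real (2 * p + 1 + m) / real (2 * p + 1) * (half_beta p m / half_beta p 0))"
  proof -
    have "i / (2 * k * h) = x * (n / d * (h' / h))"
      if "x * (2 * k * h') = d / n * i" "n \<noteq> 0" "d \<noteq> 0" "k \<noteq> 0" "h \<noteq> 0" for x k h h' d n :: real
    proof -
      have i: "i = n / d * (x * (2 * k * h'))" using that by simp
      show ?thesis unfolding i using that(2-) by (simp add: field_simps)
    qed
    note quotient = this
    have "real (2 * p + 1 + m) \<noteq> 0" "real (2 * p + 1) \<noteq> 0" "proj_const p 0 \<noteq> 0" "half_beta p 0 \<noteq> 0"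
      using half_beta_pos[of p 0] proj_const_pos[of p 0] by linarith+
    from quotient[OF \<open>norm x ^ m * _ = _\<close> this] show ?thesis
      unfolding vol_def .
  qed
  have "(\<integral>\<^sup>+u. ennreal (\<bar>x \<bullet> u\<bar> ^ m) \<partial>direction_measure)
      = (\<integral>\<^sup>+y. ennreal (\<bar>x \<bullet> sgn y\<bar> ^ m) \<partial>uniform_measure lborel (cball 0 1))"
    unfolding direction_measure_def by (subst nn_integral_distr) simp_all
  also have "\<dots> = I / ennreal vol"
    unfolding I_def by (subst nn_integral_uniform_measure) (simp_all add: emeas mult.commute)
  also have "\<dots> = ennreal (i / vol)"
    using i vol by (simp add: divide_ennreal)
  finally show ?thesis unfolding i_eq half_beta_mu .
qed

lemma phi_measurable [measurable]: "phi p \<in> borel_measurable borel"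
  unfolding phi_def[abs_def] by (intro borel_measurable_continuous_onI continuous_intros)

lemma power_le_fact_exp:
  fixes t :: real
  assumes "0 \<le> t"
  shows "t ^ k * exp (- t) \<le> fact k"
proof -
  have "t ^ k /\<^sub>R fact k \<le> (\<Sum>n. t ^ n /\<^sub>R fact n)"
    using assms sum_le_suminf[of "\<lambda>n. t ^ n /\<^sub>R fact n" "{k}"] summable_exp_generic[of t] by simp
  then have "t ^ k / fact k \<le> exp t" by (simp add: exp_def field_simps)
  then show ?thesis by (simp add: exp_minus field_simps)
qed

lemma exp_poly_bounded: "\<exists>C::real. \<forall>t\<ge>0. \<bar>exp (- t) * poly f t\<bar> \<le> C"
proof (intro exI allI impI)
  fix t :: real assume t: "0 \<le> t"
  have "\<bar>exp (- t) * poly f t\<bar> = \<bar>\<Sum>i\<le>degree f. coeff f i * (t ^ i * exp (- t))\<bar>"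
    by (simp add: poly_altdef sum_distrib_left mult_ac)
  also have "\<dots> \<le> (\<Sum>i\<le>degree f. \<bar>coeff f i * (t ^ i * exp (- t))\<bar>)"
    by (rule sum_abs)
  also have "\<dots> \<le> (\<Sum>i\<le>degree f. \<bar>coeff f i\<bar> * fact i)"
  proof (rule sum_mono)
    fix i
    have "\<bar>coeff f i\<bar> * (t ^ i * exp (- t)) \<le> \<bar>coeff f i\<bar> * fact i"
      by (intro mult_left_mono power_le_fact_exp t) simp
    then show "\<bar>coeff f i * (t ^ i * exp (- t))\<bar> \<le> \<bar>coeff f i\<bar> * fact i"
      using t by (simp add: abs_mult)
  qed
  finally show "\<bar>exp (- t) * poly f t\<bar> \<le> (\<Sum>i\<le>degree f. \<bar>coeff f i\<bar> * fact i)" .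
qed

lemma phi_bounded: "\<exists>C. \<forall>t\<ge>0. \<bar>phi p t\<bar> \<le> C"
  unfolding phi_def by (rule exp_poly_bounded)

lemma phi_lipschitz: "\<exists>L\<ge>0. \<forall>s\<ge>0. \<forall>t\<ge>0. \<bar>phi p s - phi p t\<bar> \<le> L * \<bar>s - t\<bar>"
proof -
  obtain C where C: "\<And>t. 0 \<le> t \<Longrightarrow> \<bar>exp (- t) * poly (pderiv (ell p) - ell p) t\<bar> \<le> C"
    using exp_poly_bounded by blast
  have "0 \<le> C" using C[of 0] by linarith
  moreover have "\<bar>phi p s - phi p t\<bar> \<le> C * \<bar>s - t\<bar>" if "0 \<le> s" "0 \<le> t" for s t
    using field_differentiable_bound[of "{0..}" "phi p" _ C s t, OF _ DERIV_phi] C that by simp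
  ultimately show ?thesis by blast
qed

lemma integrable_direction:
  fixes f :: "'a::euclidean_space \<Rightarrow> real"
  assumes [measurable]: "f \<in> borel_measurable borel" and "\<And>u. norm u = 1 \<Longrightarrow> \<bar>f u\<bar> \<le> C"
  shows "integrable direction_measure f"
proof -
  interpret prob_space "direction_measure :: 'a measure" by (rule prob_space_direction_measure)
  show ?thesis
    using AE_direction_measure[where 'a = 'a]
    by (intro integrable_const_bound[of _ C]) (auto elim!: eventually_mono intro!: assms(2))
qed

lemma integral_direction_power:
  fixes x :: "real ^ 'n"
  assumes dim: "CARD('n) = 2 * p + 1"
  shows "(\<integral>u. \<bar>x \<bullet> u\<bar> ^ m \<partial>direction_measure) = norm x ^ m * mu p m"
proof -
  have "(\<integral>u. \<bar>x \<bullet> u\<bar> ^ m \<partial>direction_measure) = enn2real (\<integral>\<^sup>+u. ennreal (\<bar>x \<bullet> u\<bar> ^ m) \<partial>direction_measure)"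
    by (rule integral_eq_nn_integral) simp_all
  then show ?thesis
    using mu_pos[of p m] by (simp add: nn_integral_direction_power[OF dim])
qed

lemma exp_norm_eq_direction_average:
  fixes x :: "real ^ 'n"
  assumes dim: "CARD('n) = 2 * p + 1"
  shows "(\<integral>u. phi p \<bar>x \<bullet> u\<bar> \<partial>direction_measure) = exp (- norm x)"
proof -
  have int: "integrable direction_measure (\<lambda>u. phic p m * \<bar>x \<bullet> u\<bar> ^ m)" for m
  proof (rule integrable_direction)
    fix u :: "real ^ 'n" assume "norm u = 1"
    then have "\<bar>x \<bullet> u\<bar> \<le> norm x" using Cauchy_Schwarz_ineq2[of x u] by simp
    then have "\<bar>x \<bullet> u\<bar> ^ m \<le> norm x ^ m" by (intro power_mono) auto
    then show "\<bar>phic p m * \<bar>x \<bullet> u\<bar> ^ m\<bar> \<le> \<bar>phic p m\<bar> * norm x ^ m"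
      by (simp add: abs_mult mult_left_mono)
  qed simp
  have val: "phic p m * (norm x ^ m * mu p m) = (- norm x) ^ m /\<^sub>R fact m" for m
    using mu_pos[of p m] by (simp add: phic_def power_minus[of "norm x"] field_simps)
  \<comment> \<open>The absolute values average to the terms of the series of
    \<open>exp (norm x)\<close>, whose convergence justifies exchanging sum and average.\<close>
  have norm_val: "(\<integral>u. norm (phic p m * \<bar>x \<bullet> u\<bar> ^ m) \<partial>direction_measure) = norm x ^ m /\<^sub>R fact m" for m
  proof -
    have "(\<integral>u. norm (phic p m * \<bar>x \<bullet> u\<bar> ^ m) \<partial>direction_measure) = \<bar>phic p m\<bar> * (norm x ^ m * mu p m)"
      by (simp add: abs_mult integral_direction_power[OF dim])
    also have "\<bar>phic p m\<bar> = 1 / fact m / mu p m"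
      using mu_pos[of p m] by (simp add: phic_def power_abs)
    finally show ?thesis using mu_pos[of p m] by (simp add: field_simps)
  qed
  have "summable (\<lambda>m. norm (phic p m * \<bar>x \<bullet> u\<bar> ^ m))" for u
  proof -
    have "summable (\<lambda>m. phic p m * (\<bar>x \<bullet> u\<bar> + 1) ^ m)"
      using phi_sums by (rule sums_summable)
    then show ?thesis by (rule powser_insidea) simp
  qed
  moreover have "summable (\<lambda>m. \<integral>u. norm (phic p m * \<bar>x \<bullet> u\<bar> ^ m) \<partial>direction_measure)"
    unfolding norm_val by (rule summable_exp_generic)
  ultimately have "(\<integral>u. (\<Sum>m. phic p m * \<bar>x \<bullet> u\<bar> ^ m) \<partial>direction_measure)
      = (\<Sum>m. \<integral>u. phic p m * \<bar>x \<bullet> u\<bar> ^ m \<partial>direction_measure)"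
    by (intro integral_suminf int AE_I2)
  also have "\<dots> = (\<Sum>m. (- norm x) ^ m /\<^sub>R fact m)"
    by (simp add: integral_direction_power[OF dim] val)
  also have "\<dots> = exp (- norm x)" by (simp add: exp_def)
  also have "(\<lambda>u. \<Sum>m. phic p m * \<bar>x \<bullet> u\<bar> ^ m) = (\<lambda>u. phi p \<bar>x \<bullet> u\<bar>)"
    using phi_sums by (simp add: sums_iff)
  finally show ?thesis .
qed

section \<open>Polynomial radial densities and signed test functions\<close>

definition tpoly :: "real poly \<Rightarrow> real \<Rightarrow> real" where
  "tpoly F a = (if 0 \<le> a then poly F a else 0)"

text \<open>For densities polynomial in \<open>s - (norm x)\<^sup>2\<close>, projection to a line
  acts on coefficients and raises every exponent by \<open>p\<close>. So every projected profile
  vanishes to order \<open>p\<close> in \<open>s - t\<^sup>2\<close>.\<close>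

definition proj_poly :: "nat \<Rightarrow> real poly \<Rightarrow> real poly" where
  "proj_poly p F = (\<Sum>j\<le>degree F. monom (coeff F j * proj_const p j) (j + p))"

lemma tpoly_measurable [measurable]: "tpoly F \<in> borel_measurable borel"
proof -
  have [measurable]: "poly F \<in> borel_measurable borel"
    by (intro borel_measurable_continuous_onI continuous_intros)
  show ?thesis unfolding tpoly_def[abs_def] by measurable
qed

lemma tpoly_eq_sum: "tpoly F a = (\<Sum>j\<le>degree F. coeff F j * tpower j a)"
  by (simp add: tpoly_def tpower_def poly_altdef)

lemma tpoly_proj_poly: "tpoly (proj_poly p F) a = (\<Sum>j\<le>degree F. coeff F j * (proj_const p j * tpower (j + p) a))"
  by (simp add: tpoly_def tpower_def proj_poly_def poly_sum poly_monom mult_ac)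

lemma integrable_tpower:
  fixes g :: "'a::euclidean_space \<Rightarrow> real"
  assumes [measurable]: "g \<in> borel_measurable borel" and g: "\<And>x. \<bar>g x\<bar> \<le> C"
  shows "integrable lborel (\<lambda>x::'a. tpower j (s - (norm x)\<^sup>2) * g x)"
proof (rule Bochner_Integration.integrable_bound)
  define r where "r = sqrt \<bar>s\<bar>"
  show "integrable lborel (\<lambda>x::'a. \<bar>s\<bar> ^ j * C * indicator (cball 0 r) x)"
    using emeasure_lborel_cball_finite[of "0::'a" r]
    by (intro integrable_mult_right integrable_real_indicator) simp_all
  show "AE x in lborel. norm (tpower j (s - (norm x)\<^sup>2) * g x) \<le> norm (\<bar>s\<bar> ^ j * C * indicator (cball 0 r) x)"
  proof (rule AE_I2)
    fix x :: 'a
    have C: "0 \<le> C" using g[of x] by linarith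
    show "norm (tpower j (s - (norm x)\<^sup>2) * g x) \<le> norm (\<bar>s\<bar> ^ j * C * indicator (cball 0 r) x)"
    proof (cases "(norm x)\<^sup>2 \<le> s")
      case True
      then have "norm x \<le> r" unfolding r_def by (intro real_le_rsqrt) simp
      have "\<bar>(s - (norm x)\<^sup>2) ^ j\<bar> \<le> \<bar>s\<bar> ^ j"
        unfolding power_abs using True zero_le_power2[of "norm x"] by (intro power_mono) linarith+
      with True \<open>norm x \<le> r\<close> show ?thesis
        by (simp add: tpower_def abs_mult mult_mono g C)
    qed (simp add: tpower_def)
  qed
qed simp

text \<open>The nonnegative case applied to indicators identifies the push-forward of the radial
  density as a measure on the line, which then integrates signed \<open>g\<close> as well.\<close>

lemma integral_radial_projection:
  fixes u :: "real ^ 'n" and g :: "real \<Rightarrow> real"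
  assumes u: "norm u = 1" and dim: "CARD('n) = 2 * p + 1"
    and [measurable]: "g \<in> borel_measurable borel"
  shows "(\<integral>x. tpower j (s - (norm x)\<^sup>2) * g (x \<bullet> u) \<partial>lborel) = (\<integral>t. proj_const p j * tpower (j + p) (s - t\<^sup>2) * g t \<partial>lborel)"
proof -
  define M where "M = density (lborel :: (real ^ 'n) measure) (\<lambda>x. ennreal (tpower j (s - (norm x)\<^sup>2)))"
  define N where "N = density lborel (\<lambda>t. ennreal (proj_const p j * tpower (j + p) (s - t\<^sup>2)))"
  have nonneg: "0 \<le> proj_const p j * tpower (j + p) a" for a
    using proj_const_pos[of p j] by simp
  have [measurable_cong, simp]: "sets M = sets borel" "sets N = sets borel"
    by (simp_all add: M_def N_def)
  have "distr M borel (\<lambda>x. x \<bullet> u) = N"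
  proof (rule measure_eqI)
    fix S assume "S \<in> sets (distr M borel (\<lambda>x. x \<bullet> u))"
    then have [measurable]: "S \<in> sets borel" by simp
    have "emeasure (distr M borel (\<lambda>x. x \<bullet> u)) S = (\<integral>\<^sup>+x. indicator S (x \<bullet> u) \<partial>M)"
      using nn_integral_distr[of "\<lambda>x. x \<bullet> u" M borel "indicator S"] by simp
    also have "\<dots> = (\<integral>\<^sup>+x. ennreal (tpower j (s - (norm x)\<^sup>2)) * indicator S (x \<bullet> u) \<partial>lborel)"
      unfolding M_def by (rule nn_integral_density) measurable
    also have "\<dots> = ennreal (proj_const p j) * (\<integral>\<^sup>+t. ennreal (tpower (j + p) (s - t\<^sup>2)) * indicator S t \<partial>lborel)"
      by (rule nn_integral_radial_projection[OF u dim]) measurable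
    also have "\<dots> = (\<integral>\<^sup>+t. ennreal (proj_const p j) * (ennreal (tpower (j + p) (s - t\<^sup>2)) * indicator S t) \<partial>lborel)"
      by (rule nn_integral_cmult[symmetric]) measurable
    also have "\<dots> = emeasure N S"
      unfolding N_def using proj_const_pos[of p j]
      by (subst emeasure_density) (auto simp: ennreal_mult mult.assoc intro!: nn_integral_cong)
    finally show "emeasure (distr M borel (\<lambda>x. x \<bullet> u)) S = emeasure N S" .
  qed simp
  then have "(\<integral>x. g (x \<bullet> u) \<partial>M) = (\<integral>t. g t \<partial>N)"
    using integral_distr[of "\<lambda>x. x \<bullet> u" M borel g] by simp
  then show ?thesis
    unfolding M_def N_def
    by (subst (asm) integral_real_density; measurable?) (subst (asm) integral_real_density; simp add: nonneg)
qed

lemma integrable_tpoly: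
  fixes g :: "'a::euclidean_space \<Rightarrow> real"
  assumes [measurable]: "g \<in> borel_measurable borel" and g: "\<And>x. \<bar>g x\<bar> \<le> C"
  shows "integrable lborel (\<lambda>x::'a. tpoly F (s - (norm x)\<^sup>2) * g x)"
  unfolding tpoly_eq_sum sum_distrib_right mult.assoc
  by (intro Bochner_Integration.integrable_sum integrable_mult_right integrable_tpower[OF assms])

lemma integral_tpoly_projection:
  fixes u :: "real ^ 'n" and g :: "real \<Rightarrow> real"
  assumes u: "norm u = 1" and dim: "CARD('n) = 2 * p + 1"
    and [measurable]: "g \<in> borel_measurable borel" and g: "\<And>x. \<bar>g x\<bar> \<le> C"
  shows "(\<integral>x. tpoly F (s - (norm x)\<^sup>2) * g (x \<bullet> u) \<partial>lborel) = (\<integral>t. tpoly (proj_poly p F) (s - t\<^sup>2) * g t \<partial>lborel)"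
proof -
  have "(\<integral>x. tpoly F (s - (norm x)\<^sup>2) * g (x \<bullet> u) \<partial>lborel)
      = (\<Sum>j\<le>degree F. coeff F j * (\<integral>x. tpower j (s - (norm x)\<^sup>2) * g (x \<bullet> u) \<partial>lborel))"
    unfolding tpoly_eq_sum sum_distrib_right mult.assoc
    by (subst Bochner_Integration.integral_sum) (auto intro!: integrable_mult_right integrable_tpower g)
  also have "\<dots> = (\<Sum>j\<le>degree F. coeff F j * (\<integral>t. proj_const p j * tpower (j + p) (s - t\<^sup>2) * g t \<partial>lborel))"
    by (simp only: integral_radial_projection[OF u dim assms(3)])
  also have "\<dots> = (\<integral>t. tpoly (proj_poly p F) (s - t\<^sup>2) * g t \<partial>lborel)"
  proof -
    have "integrable lborel (\<lambda>t::real. tpower j (s - t\<^sup>2) * g t)" for j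
      using integrable_tpower[OF assms(3) g, of j s] by (simp add: power2_norm_eq_inner power2_eq_square)
    then show ?thesis
      unfolding tpoly_proj_poly sum_distrib_right mult.assoc
      by (subst Bochner_Integration.integral_sum) (auto intro!: integrable_mult_right)
  qed
  finally show ?thesis .
qed

section \<open>Discretisation\<close>

lemma compact_measurable_partition:
  fixes X :: "'a::euclidean_space set"
  assumes "compact X" "0 < d"
  shows "\<exists>(N::nat) b P. (\<forall>i<N. b i \<in> X \<and> P i \<in> sets borel \<and> P i \<subseteq> X \<and> (\<forall>x\<in>P i. dist (b i) x < d)) \<and>
    disjoint_family_on P {..<N} \<and> (\<Union>i<N. P i) = X"
proof -
  obtain k where k: "finite k" "k \<subseteq> X" "X \<subseteq> (\<Union>x\<in>k. ball x d)"
    using seq_compact_imp_totally_bounded[of X] assms compact_imp_seq_compact by metis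
  obtain b where b: "bij_betw b {..<card k} k"
    using ex_bij_betw_nat_finite[OF k(1)] by (auto simp: atLeast0LessThan)
  define A where "A i = X \<inter> ball (b i) d" for i
  define P where "P = disjointed A"
  have [measurable]: "X \<in> sets borel" using assms(1) by (simp add: borel_compact)
  have "A i \<in> sets borel" for i unfolding A_def by simp
  then have "P i \<in> sets borel" for i
    unfolding P_def using sets.range_disjointed_sets[of A borel] by auto
  moreover have "P i \<subseteq> A i" for i
    unfolding P_def by (rule disjointed_subset)
  moreover have "b i \<in> X" if "i < card k" for i
    using b k(2) that unfolding bij_betw_def by blast
  moreover have "disjoint_family_on P {..<card k}"
    unfolding P_def by (rule disjoint_family_on_mono[OF subset_UNIV disjoint_family_disjointed])
  moreover have "(\<Union>i<card k. P i) = X"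
  proof -
    have "(\<Union>i<card k. P i) = (\<Union>i<card k. A i)"
      unfolding P_def using finite_UN_disjointed_eq[of A "card k"] by (simp add: atLeast0LessThan)
    also have "\<dots> = X"
    proof (intro equalityI subsetI)
      fix x assume x: "x \<in> X"
      then obtain y where "y \<in> k" "x \<in> ball y d" using k(3) by blast
      moreover obtain i where "i < card k" "b i = y"
        using b \<open>y \<in> k\<close> unfolding bij_betw_def by (metis imageE lessThan_iff)
      ultimately show "x \<in> (\<Union>i<card k. A i)" using x by (auto simp: A_def)
    qed (auto simp: A_def)
    finally show ?thesis .
  qed
  moreover have "P i \<subseteq> X" "\<And>x. x \<in> P i \<Longrightarrow> dist (b i) x < d" for i
    using \<open>P i \<subseteq> A i\<close> by (auto simp: A_def)
  ultimately show ?thesis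
    by (intro exI[of _ "card k"] exI[of _ b] exI[of _ P] conjI allI impI ballI) simp_all
qed

text \<open>The mass of each small cell is placed at a point within distance \<open>d\<close> of it.
  Atoms and weights are fixed before the test function, because the same finite measure is later
  tested against the kernel at every point and against the potential.\<close>

lemma discretise_integral:
  fixes X :: "'a::euclidean_space set" and f :: "'a \<Rightarrow> real"
  assumes X: "compact X" and d: "0 < d" and f: "integrable lborel f" and supp: "\<forall>x. x \<notin> X \<longrightarrow> f x = 0"
  shows "\<exists>B v. finite B \<and> B \<subseteq> X \<and> (\<Sum>b\<in>B. \<bar>v b\<bar>) \<le> (\<integral>x. \<bar>f x\<bar> \<partial>lborel) \<and>
    (\<forall>g K L. g \<in> borel_measurable borel \<longrightarrow> (\<forall>x. \<bar>g x\<bar> \<le> K) \<longrightarrow> 0 \<le> L \<longrightarrow> (\<forall>x y. \<bar>g x - g y\<bar> \<le> L * dist x y) \<longrightarrow>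
      \<bar>(\<Sum>b\<in>B. v b * g b) - (\<integral>x. f x * g x \<partial>lborel)\<bar> \<le> L * d * (\<integral>x. \<bar>f x\<bar> \<partial>lborel))"
proof -
  obtain N b P where bP: "\<And>i. i < N \<Longrightarrow> b i \<in> X" "\<And>i. i < (N::nat) \<Longrightarrow> P i \<in> sets borel"
      "\<And>i x. i < N \<Longrightarrow> x \<in> P i \<Longrightarrow> dist (b i) x < d"
    and disj: "disjoint_family_on P {..<N}" and UN: "(\<Union>i<N. P i) = X"
    using compact_measurable_partition[OF X d] by blast
  have split_sum: "h x = (\<Sum>i<N. indicator (P i) x * h x)" if "\<And>x. x \<notin> X \<Longrightarrow> h x = 0" for h :: "'a \<Rightarrow> real" and x
  proof -
    have "(\<Sum>i<N. indicator (P i) x * h x) = indicator X x * h x"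
      unfolding sum_distrib_right[symmetric] UN[symmetric]
      by (subst indicator_UN_disjoint[OF finite_lessThan disj]) (rule refl)
    then show ?thesis using that[of x] by (cases "x \<in> X") simp_all
  qed
  have piece: "integrable lborel (\<lambda>x. indicator (P i) x * h x)" if "i < N" "integrable lborel h" for i and h :: "'a \<Rightarrow> real"
    using integrable_mult_indicator[of "P i" lborel h] bP(2)[OF that(1)] that(2) by simp
  have split_int: "(\<integral>x. h x \<partial>lborel) = (\<Sum>i<N. \<integral>x. indicator (P i) x * h x \<partial>lborel)"
    if h: "integrable lborel h" "\<And>x. x \<notin> X \<Longrightarrow> h x = 0" for h :: "'a \<Rightarrow> real"
  proof -
    have "(\<integral>x. h x \<partial>lborel) = (\<integral>x. (\<Sum>i<N. indicator (P i) x * h x) \<partial>lborel)"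
      by (rule Bochner_Integration.integral_cong[OF refl split_sum]) (rule h(2))
    also have "\<dots> = (\<Sum>i<N. \<integral>x. indicator (P i) x * h x \<partial>lborel)"
      using piece h(1) by (intro Bochner_Integration.integral_sum) simp
    finally show ?thesis .
  qed
  define w where "w i = (\<integral>x. indicator (P i) x * f x \<partial>lborel)" for i
  \<comment> \<open>Cells may share a representative, so the weights are collected per
    point.\<close>
  define v where "v y = (\<Sum>i\<in>{i\<in>{..<N}. b i = y}. w i)" for y
  define B where "B = b ` {..<N}"
  have B: "finite B" "B \<subseteq> X" using bP(1) by (auto simp: B_def)
  have f_abs: "integrable lborel (\<lambda>x. \<bar>f x\<bar>)" using f by simp
  have abs_split: "(\<integral>x. \<bar>f x\<bar> \<partial>lborel) = (\<Sum>i<N. \<integral>x. indicator (P i) x * \<bar>f x\<bar> \<partial>lborel)"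
    by (rule split_int[OF f_abs]) (simp add: supp)
  have "\<bar>w i\<bar> \<le> (\<integral>x. indicator (P i) x * \<bar>f x\<bar> \<partial>lborel)" for i
    using integral_norm_bound[of lborel "\<lambda>x. indicator (P i) x * f x"] by (simp add: w_def abs_mult)
  then have w_sum: "(\<Sum>i<N. \<bar>w i\<bar>) \<le> (\<integral>x. \<bar>f x\<bar> \<partial>lborel)"
    unfolding abs_split by (intro sum_mono)
  have "(\<Sum>y\<in>B. \<bar>v y\<bar>) \<le> (\<Sum>y\<in>B. \<Sum>i\<in>{i\<in>{..<N}. b i = y}. \<bar>w i\<bar>)"
    unfolding v_def by (intro sum_mono sum_abs)
  also have "\<dots> = (\<Sum>i<N. \<bar>w i\<bar>)"
    using B(1) by (intro sum.group) (auto simp: B_def)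
  finally have tv: "(\<Sum>y\<in>B. \<bar>v y\<bar>) \<le> (\<integral>x. \<bar>f x\<bar> \<partial>lborel)" using w_sum by linarith
  have err: "\<bar>(\<Sum>y\<in>B. v y * g y) - (\<integral>x. f x * g x \<partial>lborel)\<bar> \<le> L * d * (\<integral>x. \<bar>f x\<bar> \<partial>lborel)"
    if [measurable]: "g \<in> borel_measurable borel" and K: "\<And>x. \<bar>g x\<bar> \<le> K" and L: "0 \<le> L" "\<And>x y. \<bar>g x - g y\<bar> \<le> L * dist x y" for g K L
  proof -
    have [measurable]: "f \<in> borel_measurable borel" using f by simp
    have bounded_int: "integrable lborel (\<lambda>x. f x * h x)"
      if [measurable]: "h \<in> borel_measurable borel" and "\<And>x. \<bar>h x\<bar> \<le> C" for h C
    proof (rule Bochner_Integration.integrable_bound)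
      show "integrable lborel (\<lambda>x. C * f x)" using f by simp
      show "AE x in lborel. norm (f x * h x) \<le> norm (C * f x)"
      proof (rule AE_I2)
        fix x
        have "\<bar>h x\<bar> \<le> \<bar>C\<bar>" using that(2)[of x] by linarith
        then show "norm (f x * h x) \<le> norm (C * f x)"
          unfolding real_norm_def abs_mult by (subst mult.commute) (rule mult_right_mono, auto)
      qed
    qed simp
    have fg: "integrable lborel (\<lambda>x. f x * g x)" by (rule bounded_int[OF that(1) K]) 
    have fd: "integrable lborel (\<lambda>x. f x * (g c - g x))" for c
    proof (rule bounded_int)
      show "\<bar>g c - g x\<bar> \<le> 2 * K" for x using K[of c] K[of x] by linarith
    qed simp
    have "(\<Sum>y\<in>B. v y * g y) = (\<Sum>i<N. w i * g (b i))"
      unfolding v_def by (rule sum_pushforward) (auto simp: B_def)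
    moreover have "(\<integral>x. f x * g x \<partial>lborel) = (\<Sum>i<N. \<integral>x. indicator (P i) x * (f x * g x) \<partial>lborel)"
      by (rule split_int[OF fg]) (simp add: supp)
    moreover have "w i * g (b i) - (\<integral>x. indicator (P i) x * (f x * g x) \<partial>lborel)
        = (\<integral>x. indicator (P i) x * (f x * (g (b i) - g x)) \<partial>lborel)" if "i < N" for i
    proof -
      have "w i * g (b i) = (\<integral>x. indicator (P i) x * (f x * g (b i)) \<partial>lborel)"
        unfolding w_def by (simp add: mult.assoc[symmetric])
      also have "\<dots> - (\<integral>x. indicator (P i) x * (f x * g x) \<partial>lborel)
          = (\<integral>x. indicator (P i) x * (f x * g (b i)) - indicator (P i) x * (f x * g x) \<partial>lborel)"
        using that f fg by (intro Bochner_Integration.integral_diff[symmetric] piece) simp_all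
      finally show ?thesis by (simp add: right_diff_distrib)
    qed
    ultimately have "(\<Sum>y\<in>B. v y * g y) - (\<integral>x. f x * g x \<partial>lborel)
        = (\<Sum>i<N. \<integral>x. indicator (P i) x * (f x * (g (b i) - g x)) \<partial>lborel)"
      by (simp add: sum_subtractf[symmetric])
    also have "\<bar>\<dots>\<bar> \<le> (\<Sum>i<N. \<bar>\<integral>x. indicator (P i) x * (f x * (g (b i) - g x)) \<partial>lborel\<bar>)"
      by (rule sum_abs)
    also have "\<dots> \<le> (\<Sum>i<N. \<integral>x. L * d * (indicator (P i) x * \<bar>f x\<bar>) \<partial>lborel)"
    proof (rule sum_mono)
      fix i assume "i \<in> {..<N}"
      then have i: "i < N" by simp
      have "\<bar>\<integral>x. indicator (P i) x * (f x * (g (b i) - g x)) \<partial>lborel\<bar>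
          \<le> (\<integral>x. \<bar>indicator (P i) x * (f x * (g (b i) - g x))\<bar> \<partial>lborel)"
        using integral_norm_bound[of lborel "\<lambda>x. indicator (P i) x * (f x * (g (b i) - g x))"] by simp
      also have "\<dots> \<le> (\<integral>x. L * d * (indicator (P i) x * \<bar>f x\<bar>) \<partial>lborel)"
      proof (rule integral_mono)
        show "integrable lborel (\<lambda>x. \<bar>indicator (P i) x * (f x * (g (b i) - g x))\<bar>)"
          using piece[OF i fd] by (rule integrable_abs)
        show "integrable lborel (\<lambda>x. L * d * (indicator (P i) x * \<bar>f x\<bar>))"
          using piece[OF i f_abs] by (rule integrable_mult_right)
        fix x
        show "\<bar>indicator (P i) x * (f x * (g (b i) - g x))\<bar> \<le> L * d * (indicator (P i) x * \<bar>f x\<bar>)"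
        proof (cases "x \<in> P i")
          case True
          have "\<bar>g (b i) - g x\<bar> \<le> L * d"
            using L(2)[of "b i" x] mult_left_mono[OF less_imp_le[OF bP(3)[OF i True]] L(1)] by linarith
          then have "\<bar>f x\<bar> * \<bar>g (b i) - g x\<bar> \<le> \<bar>f x\<bar> * (L * d)" by (rule mult_left_mono) simp
          then show ?thesis using True by (simp add: abs_mult mult.commute)
        qed simp
      qed
      finally show "\<bar>\<integral>x. indicator (P i) x * (f x * (g (b i) - g x)) \<partial>lborel\<bar>
          \<le> (\<integral>x. L * d * (indicator (P i) x * \<bar>f x\<bar>) \<partial>lborel)" .
    qed
    also have "\<dots> = L * d * (\<integral>x. \<bar>f x\<bar> \<partial>lborel)"
      unfolding abs_split sum_distrib_left by simp
    finally show ?thesis .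
  qed
  show ?thesis
    by (intro exI[of _ B] exI[of _ v] conjI allI impI B tv err) blast+
qed

section \<open>The ball and its one-dimensional profile\<close>

lemma exp_neg_dist_lipschitz:
  "\<bar>exp (- dist x y) - exp (- dist x z)\<bar> \<le> dist y (z :: 'a::metric_space)"
proof -
  have *: "exp (- a) - exp (- b) \<le> b - a" if "0 \<le> a" "a \<le> b" for a b :: real
  proof -
    have "exp (- a) - exp (- b) = exp (- a) * (1 - exp (- (b - a)))"
      by (simp add: algebra_simps exp_add[symmetric])
    also have "\<dots> \<le> 1 * (b - a)"
    proof (rule mult_mono)
      show "1 - exp (- (b - a)) \<le> b - a" using exp_ge_add_one_self[of "- (b - a)"] by linarith
    qed (use that in auto)
    finally show ?thesis by simp
  qed
  have "\<bar>exp (- dist x y) - exp (- dist x z)\<bar> \<le> \<bar>dist x y - dist x z\<bar>"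
    using *[of "dist x y" "dist x z"] *[of "dist x z" "dist x y"]
    by (cases "dist x y \<le> dist x z") (simp_all add: abs_if)
  also have "\<dots> \<le> dist y z"
    using dist_triangle[of x y z] dist_triangle[of x z y] by (simp add: abs_if dist_commute)
  finally show ?thesis .
qed

lemma integrable_mult_bounded:
  fixes f g :: "'a \<Rightarrow> real"
  assumes f: "integrable M f" and [measurable]: "g \<in> borel_measurable M" and g: "\<And>x. \<bar>g x\<bar> \<le> C"
  shows "integrable M (\<lambda>x. f x * g x)" "\<bar>\<integral>x. f x * g x \<partial>M\<bar> \<le> C * (\<integral>x. \<bar>f x\<bar> \<partial>M)"
proof -
  have [measurable]: "f \<in> borel_measurable M" using f by simp
  have le: "\<bar>f x * g x\<bar> \<le> C * \<bar>f x\<bar>" for x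
    unfolding abs_mult by (subst mult.commute) (rule mult_right_mono[OF g], simp)
  show 1: "integrable M (\<lambda>x. f x * g x)"
  proof (rule Bochner_Integration.integrable_bound)
    show "integrable M (\<lambda>x. C * \<bar>f x\<bar>)" using f by simp
    show "AE x in M. norm (f x * g x) \<le> norm (C * \<bar>f x\<bar>)"
      using le by (intro AE_I2) (metis abs_ge_self order_trans real_norm_def)
  qed simp
  have "\<bar>\<integral>x. f x * g x \<partial>M\<bar> \<le> (\<integral>x. \<bar>f x * g x\<bar> \<partial>M)"
    using integral_norm_bound[of M "\<lambda>x. f x * g x"] by simp
  also have "\<dots> \<le> (\<integral>x. C * \<bar>f x\<bar> \<partial>M)"
    using 1 f by (intro integral_mono le) simp_all
  finally show "\<bar>\<integral>x. f x * g x \<partial>M\<bar> \<le> C * (\<integral>x. \<bar>f x\<bar> \<partial>M)" by simp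
qed

lemma measure_direction_measure_UNIV [simp]: "measure (direction_measure :: ('a::euclidean_space) measure) UNIV = 1"
  using prob_space.prob_space[OF prob_space_direction_measure[where 'a = 'a]] by simp

lemma Fubini_direction:
  fixes f :: "'a::euclidean_space \<Rightarrow> real" and k :: "'a \<Rightarrow> 'a \<Rightarrow> real"
  assumes f: "integrable lborel f"
    and k [measurable]: "case_prod k \<in> borel_measurable (borel \<Otimes>\<^sub>M borel)" and C: "\<And>y u. \<bar>k y u\<bar> \<le> C"
  shows "(\<integral>y. f y * (\<integral>u. k y u \<partial>direction_measure) \<partial>lborel) = (\<integral>u. (\<integral>y. f y * k y u \<partial>lborel) \<partial>direction_measure)"
proof -
  interpret prob_space "direction_measure :: 'a measure" by (rule prob_space_direction_measure)
  interpret P: pair_sigma_finite lborel "direction_measure :: 'a measure" ..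
  have [measurable]: "f \<in> borel_measurable borel" using f by simp
  have km [measurable]: "case_prod k \<in> borel_measurable (lborel \<Otimes>\<^sub>M (direction_measure :: 'a measure))"
    using k by (simp cong: measurable_cong_sets sets_pair_measure_cong)
  have k2: "k y \<in> borel_measurable direction_measure" for y
    using measurable_Pair2[OF km, of y] by simp
  have k_int: "integrable direction_measure (k y)" for y
    using k2 C by (intro integrable_const_bound[of _ C]) auto
  have le: "(\<integral>u. \<bar>k y u\<bar> \<partial>direction_measure) \<le> C" for y
    using integral_mono[OF integrable_abs[OF k_int[of y]], of "\<lambda>_. C"] C by simp
  have "integrable (lborel \<Otimes>\<^sub>M direction_measure) (\<lambda>(y, u). f y * k y u)"
  proof (rule P.Fubini_integrable)
    show "integrable lborel (\<lambda>y. \<integral>u. norm (case (y, u) of (y, u) \<Rightarrow> f y * k y u) \<partial>direction_measure)"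
    proof -
      have "integrable lborel (\<lambda>y. \<bar>f y\<bar> * (\<integral>u. \<bar>k y u\<bar> \<partial>direction_measure))"
      proof (rule integrable_mult_bounded(1))
        show "(\<lambda>y. \<integral>u. \<bar>k y u\<bar> \<partial>direction_measure) \<in> borel_measurable lborel"
          using km by (intro borel_measurable_lebesgue_integral) (simp add: case_prod_beta')
        show "\<bar>\<integral>u. \<bar>k y u\<bar> \<partial>direction_measure\<bar> \<le> C" for y
          using le[of y] by (simp add: abs_of_nonneg)
      qed (use f in simp)
      then show ?thesis by (simp add: abs_mult)
    qed
    show "AE y in lborel. integrable direction_measure (\<lambda>u. case (y, u) of (y, u) \<Rightarrow> f y * k y u)"
      using k_int by (intro AE_I2) simp
  qed measurable
  from P.Fubini_integral[OF this] show ?thesis by simp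
qed

text \<open>The potential on the ball is the average of the line potential \<open>H\<close> over
  directions, and the energy is an integral of \<open>w * H\<close> on the line. The energy error is
  thus controlled by \<open>C\<close>, which is uniform in \<open>e\<close>; the total variation
  \<open>T\<close> of the density on the ball is not, and is countered by the mesh \<open>d\<close>
  chosen after \<open>F\<close>.\<close>

lemma ball_magnitude_from_profile:
  fixes R C M :: real
  assumes dim: "CARD('n) = 2 * p + 1" and R: "0 < R"
    and profile: "\<And>e. 0 < e \<Longrightarrow> \<exists>F. (\<forall>c. \<bar>c\<bar> \<le> R \<longrightarrow> \<bar>(\<integral>t. tpoly (proj_poly p F) (R\<^sup>2 - t\<^sup>2) * phi p \<bar>c - t\<bar> \<partial>lborel) - 1\<bar> \<le> e) \<and>
        \<bar>(\<integral>t. tpoly (proj_poly p F) (R\<^sup>2 - t\<^sup>2) \<partial>lborel) - M\<bar> \<le> e \<and>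
        (\<integral>t. \<bar>tpoly (proj_poly p F) (R\<^sup>2 - t\<^sup>2)\<bar> \<partial>lborel) \<le> C"
  shows "magnitude (cball (0 :: real ^ 'n) R) = M"
proof (rule magnitude_eqI)
  show "compact (cball (0 :: real ^ 'n) R)" "cball (0 :: real ^ 'n) R \<noteq> {}" using R by auto
  show "0 \<le> zform A A v v" if "finite A" for A and v :: "real ^ 'n \<Rightarrow> real"
    by (rule exp_dist_psd[OF that])
next
  fix e' :: real assume e': "0 < e'"
  obtain D where D: "\<And>t. 0 \<le> t \<Longrightarrow> \<bar>phi p t\<bar> \<le> D" using phi_bounded by blast
  have C: "0 \<le> C"
  proof -
    obtain F where "(\<integral>t. \<bar>tpoly (proj_poly p F) (R\<^sup>2 - t\<^sup>2)\<bar> \<partial>lborel) \<le> C"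
      using profile[of 1] by auto
    moreover have "0 \<le> (\<integral>t. \<bar>tpoly (proj_poly p F) (R\<^sup>2 - t\<^sup>2)\<bar> \<partial>lborel)" by simp
    ultimately show ?thesis by linarith
  qed
  \<comment> \<open>The budget for the energy: \<open>e * C\<close> for replacing \<open>H\<close>
    by \<open>1\<close>, \<open>2 * e\<close> for discretising both arguments, and \<open>e\<close>
    for the mass.\<close>
  define e where "e = e' / (C + 3)"
  have e: "0 < e" "e * (C + 3) = e'" using e' C by (simp_all add: e_def)
  obtain F where F: "\<And>c. \<bar>c\<bar> \<le> R \<Longrightarrow> \<bar>(\<integral>t. tpoly (proj_poly p F) (R\<^sup>2 - t\<^sup>2) * phi p \<bar>c - t\<bar> \<partial>lborel) - 1\<bar> \<le> e"
      "\<bar>(\<integral>t. tpoly (proj_poly p F) (R\<^sup>2 - t\<^sup>2) \<partial>lborel) - M\<bar> \<le> e"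
      "(\<integral>t. \<bar>tpoly (proj_poly p F) (R\<^sup>2 - t\<^sup>2)\<bar> \<partial>lborel) \<le> C"
    using profile[OF e(1)] by blast
  define f where "f x = tpoly F (R\<^sup>2 - (norm x)\<^sup>2)" for x :: "real ^ 'n"
  define w where "w t = tpoly (proj_poly p F) (R\<^sup>2 - t\<^sup>2)" for t :: real
  define H where "H c = (\<integral>t. w t * phi p \<bar>c - t\<bar> \<partial>lborel)" for c
  define pot where "pot x = (\<integral>y. f y * exp (- dist x y) \<partial>lborel)" for x
  define T where "T = (\<integral>x. \<bar>f x\<bar> \<partial>lborel)"
  have T: "0 \<le> T" by (simp add: T_def)
  have [measurable]: "f \<in> borel_measurable borel" "w \<in> borel_measurable borel"
    unfolding f_def[abs_def] w_def[abs_def] by measurable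
  have f_int: "integrable lborel f"
    using integrable_tpoly[of "\<lambda>_ :: real ^ 'n. 1" 1 F "R\<^sup>2"] by (simp add: f_def[abs_def])
  have w_int: "integrable lborel w"
    using integrable_tpoly[of "\<lambda>_ :: real. 1" 1 "proj_poly p F" "R\<^sup>2"] by (simp add: w_def[abs_def])
  have supp: "\<forall>x. x \<notin> cball 0 R \<longrightarrow> f x = 0"
  proof (intro allI impI)
    fix x :: "real ^ 'n" assume "x \<notin> cball 0 R"
    then have "R < norm x" by simp
    then have "R\<^sup>2 < (norm x)\<^sup>2" using R by (intro power_strict_mono) auto
    then show "f x = 0" by (simp add: f_def tpoly_def)
  qed
  have H_meas [measurable]: "H \<in> borel_measurable borel"
    unfolding H_def[abs_def] by measurable
  have H_bound: "\<bar>H c\<bar> \<le> D * (\<integral>t. \<bar>w t\<bar> \<partial>lborel)" for c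
    unfolding H_def by (rule integrable_mult_bounded(2)[OF w_int]) (simp_all add: D)
  have proj: "(\<integral>x. f x * g (x \<bullet> u) \<partial>lborel) = (\<integral>t. w t * g t \<partial>lborel)"
    if "norm u = 1" "g \<in> borel_measurable borel" "\<And>x. \<bar>g x\<bar> \<le> K" for u :: "real ^ 'n" and g K
    unfolding f_def w_def by (rule integral_tpoly_projection[OF that(1) dim that(2,3)])
  have mass: "(\<integral>x. f x \<partial>lborel) = (\<integral>t. w t \<partial>lborel)"
  proof -
    show ?thesis using proj[of "axis undefined 1" "\<lambda>_. 1" 1] by simp
  qed
  have pot_eq: "pot x = (\<integral>u. H (x \<bullet> u) \<partial>direction_measure)" for x
  proof -
    have "pot x = (\<integral>y. f y * (\<integral>u. phi p \<bar>x \<bullet> u - y \<bullet> u\<bar> \<partial>direction_measure) \<partial>lborel)"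
      unfolding pot_def dist_norm
      by (simp add: exp_norm_eq_direction_average[OF dim, symmetric] inner_diff_left)
    also have "\<dots> = (\<integral>u. (\<integral>y. f y * phi p \<bar>x \<bullet> u - y \<bullet> u\<bar> \<partial>lborel) \<partial>direction_measure)"
      by (rule Fubini_direction[OF f_int, of _ D]) (simp_all add: D)
    also have "\<dots> = (\<integral>u. H (x \<bullet> u) \<partial>direction_measure)"
    proof (rule integral_cong_AE)
      show "AE u in direction_measure. (\<integral>y. f y * phi p \<bar>x \<bullet> u - y \<bullet> u\<bar> \<partial>lborel) = H (x \<bullet> u)"
        using AE_direction_measure[where 'a = "real ^ 'n"]
      proof eventually_elim
        case (elim u)
        show ?case
          unfolding H_def by (rule proj[OF elim, of "\<lambda>t. phi p \<bar>x \<bullet> u - t\<bar>" D]) (simp_all add: D)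
      qed
    qed measurable
    finally show ?thesis .
  qed
  have pot_close: "\<bar>pot x - 1\<bar> \<le> e" if "norm x \<le> R" for x
  proof -
    interpret prob_space "direction_measure :: (real ^ 'n) measure" by (rule prob_space_direction_measure)
    have int: "integrable direction_measure (\<lambda>u. H (x \<bullet> u))"
      by (rule integrable_direction[OF _ H_bound]) measurable
    have "pot x - 1 = (\<integral>u. H (x \<bullet> u) - 1 \<partial>direction_measure)"
      using int by (simp add: pot_eq prob_space)
    also have "\<bar>\<dots>\<bar> \<le> (\<integral>u. \<bar>H (x \<bullet> u) - 1\<bar> \<partial>direction_measure)"
      using integral_norm_bound[of direction_measure "\<lambda>u. H (x \<bullet> u) - 1"] by simp
    also have "\<dots> \<le> (\<integral>u. e \<partial>(direction_measure :: (real ^ 'n) measure))"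
    proof (rule integral_mono_AE)
      show "AE u in direction_measure. \<bar>H (x \<bullet> u) - 1\<bar> \<le> e"
        using AE_direction_measure[where 'a = "real ^ 'n"]
      proof eventually_elim
        case (elim u)
        have "\<bar>x \<bullet> u\<bar> \<le> R" using Cauchy_Schwarz_ineq2[of x u] elim that by simp
        then show ?case using F(1) by (simp add: H_def w_def)
      qed
    qed (use int in simp_all)
    finally show ?thesis by (simp add: prob_space)
  qed
  have pot_meas [measurable]: "pot \<in> borel_measurable borel"
    unfolding pot_def[abs_def] by measurable
  have pot_bound: "\<bar>pot x\<bar> \<le> T" for x
    using integrable_mult_bounded(2)[OF f_int, of "\<lambda>y. exp (- dist x y)" 1] by (simp add: pot_def T_def)
  have pot_lip: "\<bar>pot x - pot y\<bar> \<le> T * dist x y" for x y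
  proof -
    have int: "integrable lborel (\<lambda>z. f z * exp (- dist x z))" for x
      by (rule integrable_mult_bounded(1)[OF f_int, of _ 1]) simp_all
    have "pot x - pot y = (\<integral>z. f z * exp (- dist x z) - f z * exp (- dist y z) \<partial>lborel)"
      unfolding pot_def by (rule Bochner_Integration.integral_diff[OF int int, symmetric])
    also have "\<dots> = (\<integral>z. f z * (exp (- dist z x) - exp (- dist z y)) \<partial>lborel)"
      by (simp only: right_diff_distrib dist_commute)
    also have "\<bar>\<dots>\<bar> \<le> dist x y * T"
      unfolding T_def by (rule integrable_mult_bounded(2)[OF f_int]) (simp_all add: exp_neg_dist_lipschitz)
    finally show ?thesis by (simp add: mult.commute)
  qed
  have energy: "\<bar>(\<integral>x. f x * pot x \<partial>lborel) - (\<integral>t. w t \<partial>lborel)\<bar> \<le> e * C"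
  proof -
    interpret prob_space "direction_measure :: (real ^ 'n) measure" by (rule prob_space_direction_measure)
    have "(\<integral>x. f x * pot x \<partial>lborel) = (\<integral>u. (\<integral>x. f x * H (x \<bullet> u) \<partial>lborel) \<partial>direction_measure)"
      unfolding pot_eq by (rule Fubini_direction[OF f_int _ H_bound]) measurable
    also have "\<dots> = (\<integral>u. (\<integral>t. w t * H t \<partial>lborel) \<partial>(direction_measure :: (real ^ 'n) measure))"
    proof (rule integral_cong_AE)
      show "AE u in (direction_measure :: (real ^ 'n) measure). (\<integral>x. f x * H (x \<bullet> u) \<partial>lborel) = (\<integral>t. w t * H t \<partial>lborel)"
        using AE_direction_measure[where 'a = "real ^ 'n"]
        by eventually_elim (rule proj[OF _ _ H_bound], simp_all)
    qed measurable
    also have "\<dots> = (\<integral>t. w t * H t \<partial>lborel)" by (simp add: prob_space)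
    finally have "(\<integral>x. f x * pot x \<partial>lborel) - (\<integral>t. w t \<partial>lborel) = (\<integral>t. w t * (H t - 1) \<partial>lborel)"
      using w_int integrable_mult_bounded(1)[OF w_int _ H_bound] by (simp add: right_diff_distrib)
    \<comment> \<open>\<open>H\<close> is close to \<open>1\<close> only on \<open>[-R, R]\<close>;
      outside this interval \<open>w\<close> vanishes.\<close>
    also have "\<dots> = (\<integral>t. w t * (if \<bar>t\<bar> \<le> R then H t - 1 else 0) \<partial>lborel)"
    proof (rule Bochner_Integration.integral_cong[OF refl])
      fix t
      have "w t = 0" if "\<not> \<bar>t\<bar> \<le> R"
      proof -
        have "R\<^sup>2 < \<bar>t\<bar>\<^sup>2" using R that by (intro power_strict_mono) auto
        then show ?thesis by (simp add: w_def tpoly_def)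
      qed
      then show "w t * (H t - 1) = w t * (if \<bar>t\<bar> \<le> R then H t - 1 else 0)" by auto
    qed
    also have "\<bar>\<dots>\<bar> \<le> e * (\<integral>t. \<bar>w t\<bar> \<partial>lborel)"
    proof (rule integrable_mult_bounded(2)[OF w_int])
      show "\<bar>if \<bar>t\<bar> \<le> R then H t - 1 else 0\<bar> \<le> e" for t
        using F(1)[of t] e(1) by (simp add: H_def w_def)
    qed measurable
    also have "\<dots> \<le> e * C" using F(3) e(1) by (simp add: w_def)
    finally show ?thesis .
  qed
  \<comment> \<open>This makes both \<open>d * T\<close> and \<open>d * T * T\<close> at most
    \<open>e\<close>: the former bounds the error of the potential, the latter each of the two
    errors of the energy.\<close>
  define d where "d = e / (1 + T) ^ 2"
  have d: "0 < d" using e T by (simp add: d_def)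
  have dT: "d * T \<le> e" "d * T * T \<le> e"
  proof -
    have "(1 + T)\<^sup>2 = 1 + 2 * T + T * T" by (simp add: power2_eq_square algebra_simps)
    moreover have "0 \<le> T * T" using T by simp
    ultimately have "T \<le> (1 + T)\<^sup>2" "T * T \<le> (1 + T)\<^sup>2" using T by linarith+
    from mult_left_mono[OF this(1), of d] mult_left_mono[OF this(2), of d]
    have "d * T \<le> d * (1 + T)\<^sup>2" "d * (T * T) \<le> d * (1 + T)\<^sup>2"
      using d by simp_all
    moreover have "d * (1 + T)\<^sup>2 = e" using T by (simp add: d_def)
    ultimately show "d * T \<le> e" "d * T * T \<le> e" by (simp_all add: mult.assoc)
  qed
  obtain B v where B: "finite B" "B \<subseteq> cball 0 R" "(\<Sum>b\<in>B. \<bar>v b\<bar>) \<le> T"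
    and err: "\<And>g K L. g \<in> borel_measurable borel \<Longrightarrow> (\<And>x. \<bar>g x\<bar> \<le> K) \<Longrightarrow> 0 \<le> L \<Longrightarrow> (\<And>x y. \<bar>g x - g y\<bar> \<le> L * dist x y)
      \<Longrightarrow> \<bar>(\<Sum>b\<in>B. v b * g b) - (\<integral>x. f x * g x \<partial>lborel)\<bar> \<le> L * d * T"
  proof -
    from discretise_integral[OF compact_cball d f_int supp]
    obtain B v where Bv: "finite B" "B \<subseteq> cball 0 R" "(\<Sum>b\<in>B. \<bar>v b\<bar>) \<le> (\<integral>x. \<bar>f x\<bar> \<partial>lborel)"
      and err: "\<forall>g K L. g \<in> borel_measurable borel \<longrightarrow> (\<forall>x. \<bar>g x\<bar> \<le> K) \<longrightarrow> 0 \<le> L \<longrightarrow> (\<forall>x y. \<bar>g x - g y\<bar> \<le> L * dist x y) \<longrightarrow>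
      \<bar>(\<Sum>b\<in>B. v b * g b) - (\<integral>x. f x * g x \<partial>lborel)\<bar> \<le> L * d * (\<integral>x. \<bar>f x\<bar> \<partial>lborel)"
      by (elim exE conjE)
    show thesis
    proof (rule that[of B v])
      fix g :: "real ^ 'n \<Rightarrow> real" and K L
      assume "g \<in> borel_measurable borel" "\<And>x. \<bar>g x\<bar> \<le> K" "0 \<le> L" "\<And>x y. \<bar>g x - g y\<bar> \<le> L * dist x y"
      then show "\<bar>(\<Sum>b\<in>B. v b * g b) - (\<integral>x. f x * g x \<partial>lborel)\<bar> \<le> L * d * T"
        unfolding T_def by (intro err[rule_format])
    qed (use Bv in \<open>simp_all only: T_def\<close>)
  qed
  have sum_v: "sum v B = (\<integral>t. w t \<partial>lborel)"
    using err[of "\<lambda>_. 1" 1 0] mass by simp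
  have p_close: "\<bar>(\<Sum>y\<in>B. v y * exp (- dist x y)) - pot x\<bar> \<le> d * T" for x
    unfolding pot_def using err[of "\<lambda>y. exp (- dist x y)" 1 1] by (simp add: exp_neg_dist_lipschitz)
  have z_close: "\<bar>zform B B v v - (\<integral>x. f x * pot x \<partial>lborel)\<bar> \<le> 2 * (d * T * T)"
  proof -
    have "zform B B v v - (\<Sum>x\<in>B. v x * pot x) = (\<Sum>x\<in>B. v x * ((\<Sum>y\<in>B. v y * exp (- dist x y)) - pot x))"
      by (simp add: zform_eq_potential sum_subtractf right_diff_distrib)
    also have "\<bar>\<dots>\<bar> \<le> (\<Sum>x\<in>B. \<bar>v x * ((\<Sum>y\<in>B. v y * exp (- dist x y)) - pot x)\<bar>)"
      by (rule sum_abs)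
    also have "\<dots> \<le> (\<Sum>x\<in>B. \<bar>v x\<bar> * (d * T))"
      unfolding abs_mult by (intro sum_mono mult_left_mono p_close) simp
    also have "\<dots> \<le> T * (d * T)"
      unfolding sum_distrib_right[symmetric] using B(3) d T by (intro mult_right_mono) auto
    finally have "\<bar>zform B B v v - (\<Sum>x\<in>B. v x * pot x)\<bar> \<le> d * T * T" by (simp add: mult_ac)
    moreover have "\<bar>(\<Sum>x\<in>B. v x * pot x) - (\<integral>x. f x * pot x \<partial>lborel)\<bar> \<le> T * d * T"
      by (rule err[OF pot_meas pot_bound T pot_lip])
    ultimately show ?thesis by (simp add: mult_ac)
  qed
  have e_le: "e * C + 3 * e = e'" using e(2) by (simp add: algebra_simps)
  have eC: "0 \<le> e * C" using e C by simp
  show "\<exists>B v. finite B \<and> B \<subseteq> cball (0 :: real ^ 'n) R \<and> \<bar>sum v B - M\<bar> \<le> e' \<and>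
        \<bar>zform B B v v - M\<bar> \<le> e' \<and> (\<forall>x\<in>cball 0 R. \<bar>(\<Sum>y\<in>B. v y * exp (- dist x y)) - 1\<bar> \<le> e')"
  proof (intro exI[of _ B] exI[of _ v] conjI ballI B)
    have M: "\<bar>(\<integral>t. w t \<partial>lborel) - M\<bar> \<le> e" using F(2) by (simp add: w_def)
    show "\<bar>sum v B - M\<bar> \<le> e'" unfolding sum_v using M eC e(1) e_le by linarith
    show "\<bar>zform B B v v - M\<bar> \<le> e'" using M z_close energy dT(2) e_le e(1) by linarith
    fix x :: "real ^ 'n" assume "x \<in> cball 0 R"
    then have "\<bar>pot x - 1\<bar> \<le> e" by (intro pot_close) simp
    then show "\<bar>(\<Sum>y\<in>B. v y * exp (- dist x y)) - 1\<bar> \<le> e'"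
      using p_close[of x] dT(1) e_le eC e(1) by linarith
  qed
qed

section \<open>Reverse Bessel polynomials and the one-dimensional equation\<close>

lemma pderiv_fixpoint_eq_0:
  fixes g :: "real poly"
  assumes "g - pderiv g = 0"
  shows "g = 0"
proof (rule ccontr)
  assume "g \<noteq> 0"
  have eq: "pderiv g = g" using assms by simp
  show False
  proof (cases "degree g = 0")
    case True
    then have "pderiv g = 0" by (simp add: pderiv_eq_0_iff)
    with eq \<open>g \<noteq> 0\<close> show False by simp
  next
    case False
    then show False using eq degree_pderiv[of g] by simp
  qed
qed

text \<open>The solution is the finite sum of all derivatives of \<open>f\<close>, built by
  induction on the degree.\<close>

lemma laplace_poly_exists: "\<exists>g :: real poly. g - pderiv g = f"
proof (induction "degree f" arbitrary: f rule: less_induct)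
  case less
  show ?case
  proof (cases "degree f = 0")
    case True
    then have "pderiv f = 0" by (simp add: pderiv_eq_0_iff)
    then show ?thesis by (intro exI[of _ f]) simp
  next
    case False
    then have "degree (pderiv f) < degree f" by (simp add: degree_pderiv)
    then obtain g where "g - pderiv g = pderiv f" using less by blast
    then have "(f + g) - pderiv (f + g) = f" by (simp add: pderiv_add)
    then show ?thesis by blast
  qed
qed

text \<open>\<open>lap f\<close> at \<open>c\<close> is the value of \<open>\<integral>\<^sub>0\<^sup>\<infinity> exp (- y) f (c + y) dy\<close>.\<close>
definition lap :: "real poly \<Rightarrow> real poly" where
  "lap f = (SOME g. g - pderiv g = f)"

lemma lap: "lap f - pderiv (lap f) = f"
  unfolding lap_def by (rule someI_ex[OF laplace_poly_exists])

lemma lap_eqI: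
  assumes "g - pderiv g = f"
  shows "lap f = g"
proof -
  have "(lap f - g) - pderiv (lap f - g) = 0"
    using assms lap[of f] by (simp add: pderiv_diff algebra_simps)
  then show ?thesis using pderiv_fixpoint_eq_0 by fastforce
qed

lemma lap_add: "lap (f + g) = lap f + lap g"
proof (rule lap_eqI)
  show "lap f + lap g - pderiv (lap f + lap g) = f + g"
    using lap[of f] lap[of g] by (simp add: pderiv_add algebra_simps)
qed

lemma lap_smult: "lap (smult c f) = smult c (lap f)"
proof (rule lap_eqI)
  show "smult c (lap f) - pderiv (smult c (lap f)) = smult c f"
    using lap[of f] by (metis pderiv_smult smult_diff_right)
qed

lemma lap_0 [simp]: "lap 0 = 0"
  by (rule lap_eqI) simp

lemma lap_sum: "lap (\<Sum>i\<in>A. f i) = (\<Sum>i\<in>A. lap (f i))"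
  by (induction A rule: infinite_finite_induct) (simp_all add: lap_add)

lemma lap_diff_pderiv: "lap (g - pderiv g) = g"
  by (rule lap_eqI) simp

lemma lap_pcompose_translate: "lap (pcompose f [:c, 1:]) = pcompose (lap f) [:c, 1:]"
proof (rule lap_eqI)
  have "pderiv (pcompose (lap f) [:c, 1:]) = pcompose (pderiv (lap f)) [:c, 1:]"
    by (simp add: pderiv_pcompose pderiv_pCons)
  then show "pcompose (lap f) [:c, 1:] - pderiv (pcompose (lap f) [:c, 1:]) = pcompose f [:c, 1:]"
    by (metis lap pcompose_diff)
qed

lemma has_integral_exp_poly:
  fixes a b :: real
  assumes "a \<le> b"
  shows "((\<lambda>s. exp (- s) * poly f s) has_integral (exp (- a) * poly (lap f) a - exp (- b) * poly (lap f) b)) {a..b}"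
proof -
  have "((\<lambda>s. exp (- s) * poly f s) has_integral (- (exp (- b) * poly (lap f) b) - - (exp (- a) * poly (lap f) a))) {a..b}"
  proof (rule fundamental_theorem_of_calculus[OF assms])
    fix x
    have e: "((\<lambda>t. - exp (- t)) has_real_derivative exp (- x)) (at x within {a..b})"
      by (rule derivative_eq_intros refl | simp)+
    have "((\<lambda>s. - exp (- s) * poly (lap f) s) has_real_derivative
        exp (- x) * poly (lap f) x + poly (pderiv (lap f)) x * - exp (- x)) (at x within {a..b})"
      by (rule DERIV_mult[OF e has_field_derivative_at_within[OF poly_DERIV]])
    moreover have "exp (- x) * poly (lap f) x + poly (pderiv (lap f)) x * - exp (- x) = exp (- x) * poly (lap f - pderiv (lap f)) x"
      by (simp add: algebra_simps)
    ultimately have "((\<lambda>s. - exp (- s) * poly (lap f) s) has_real_derivative exp (- x) * poly f x) (at x within {a..b})"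
      by (simp only: lap)
    then show "((\<lambda>s. - (exp (- s) * poly (lap f) s)) has_vector_derivative exp (- x) * poly f x) (at x within {a..b})"
      by (simp add: has_real_derivative_iff_has_vector_derivative)
  qed
  then show ?thesis by simp
qed

section \<open>Reverse Bessel polynomials as formal polynomials\<close>

fun chip :: "nat \<Rightarrow> real poly" where
  "chip 0 = 1"
| "chip (Suc 0) = [:0, 1:]"
| "chip (Suc (Suc i)) = [:0, 1:]\<^sup>2 * chip i + smult (real (2 * i + 1)) (chip (Suc i))"

text \<open>The classical reverse Bessel polynomials \<open>1\<close>, \<open>x + 1\<close>,
  \<open>x^2 + 3 x + 3\<close>, and so on: the quotient of \<open>chip (Suc i)\<close> by the
  variable, and at the same time \<open>lap (chip i)\<close>.\<close>

fun chiq :: "nat \<Rightarrow> real poly" where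
  "chiq 0 = 1"
| "chiq (Suc 0) = [:1, 1:]"
| "chiq (Suc (Suc i)) = [:0, 1:]\<^sup>2 * chiq i + smult (real (2 * i + 3)) (chiq (Suc i))"

lemma poly_chip: "poly (chip i) R = chi i R"
  by (induction i rule: chip.induct) (simp_all add: power2_eq_square algebra_simps)

lemma chip_Suc: "chip (Suc i) = [:0, 1:] * chiq i"
proof (induction i rule: chiq.induct)
  case 2
  show ?case by (simp add: power2_eq_square)
next
  case (3 i)
  have "chip (Suc (Suc (Suc i))) = [:0, 1:]\<^sup>2 * chip (Suc i) + smult (real (2 * i + 3)) (chip (Suc (Suc i)))"
    by (subst chip.simps(3)) (simp add: add.commute)
  also have "\<dots> = [:0, 1:] * chiq (Suc (Suc i))"
    unfolding "3.IH" chiq.simps(3) by (simp only: distrib_left mult_smult_right mult.left_commute)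
  finally show ?case .
qed simp

text \<open>Differentiating the factor \<open>x^2\<close> in the recurrence produces twice
  \<open>x * chiq i = chip (Suc i)\<close>, which lowers the coefficient \<open>2 * i + 3\<close> to
  \<open>2 * i + 1\<close>.\<close>

lemma chiq_diff_pderiv: "chiq i - pderiv (chiq i) = chip i"
proof (induction i rule: chiq.induct)
  case 1
  show ?case by simp
next
  case 2
  show ?case by (simp add: pderiv_pCons)
next
  case (3 i)
  have x2: "pderiv ([:0, 1:]\<^sup>2 :: real poly) = smult 2 [:0, 1:]"
    by (simp add: power2_eq_square pderiv_pCons)
  have "chiq (Suc (Suc i)) - pderiv (chiq (Suc (Suc i)))
      = [:0, 1:]\<^sup>2 * (chiq i - pderiv (chiq i)) + smult (real (2 * i + 3)) (chiq (Suc i) - pderiv (chiq (Suc i)))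
        - smult 2 ([:0, 1:] * chiq i)"
    unfolding chiq.simps(3) pderiv_add pderiv_mult pderiv_smult x2
    by (simp only: smult_diff_right right_diff_distrib mult_smult_left mult_smult_right mult.commute[of "chiq i"])
  also have "\<dots> = [:0, 1:]\<^sup>2 * chip i + smult (real (2 * i + 3)) (chip (Suc i)) - smult 2 (chip (Suc i))"
    unfolding "3.IH" chip_Suc[symmetric] by (rule refl)
  also have "\<dots> = [:0, 1:]\<^sup>2 * chip i + smult (real (2 * i + 1)) (chip (Suc i))"
    by (simp add: smult_diff_left[symmetric] add_diff_eq[symmetric] del: of_nat_add of_nat_mult) simp
  finally show ?case by simp
qed

lemma degree_chip: "degree (chip i) = i \<and> coeff (chip i) i = 1"
proof (induction i rule: chip.induct)
  case (3 i)
  have x2: "[:0, 1:]\<^sup>2 * chip i = pCons 0 (pCons 0 (chip i))"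
    by (simp add: power2_eq_square)
  have ne: "chip i \<noteq> 0" using 3(1) by auto
  have d: "degree ([:0, 1:]\<^sup>2 * chip i) = Suc (Suc i)" unfolding x2 using ne 3 by simp
  have d2: "degree (smult (real (2 * i + 1)) (chip (Suc i))) < degree ([:0, 1:]\<^sup>2 * chip i)"
    using 3 d by (simp del: chip.simps)
  have "degree (chip (Suc (Suc i))) = Suc (Suc i)"
    unfolding chip.simps(3) using degree_add_eq_left[OF d2] d by simp
  moreover have "coeff (chip (Suc (Suc i))) (Suc (Suc i)) = 1"
  proof -
    have "coeff (smult (real (2 * i + 1)) (chip (Suc i))) (Suc (Suc i)) = 0"
      using d2 d by (intro coeff_eq_0) simp
    moreover have "coeff ([:0, 1:]\<^sup>2 * chip i) (Suc (Suc i)) = 1"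
      unfolding x2 using 3 by simp
    ultimately show ?thesis unfolding chip.simps(3) by (simp only: coeff_add)
  qed
  ultimately show ?case by blast
qed simp_all

text \<open>Since \<open>chip j\<close> is monic of degree \<open>j\<close>, these polynomials form
  a triangular basis and leading terms can be removed one by one.\<close>

lemma linear_vanishes_on_chip_span:
  fixes T :: "real poly \<Rightarrow> real"
  assumes add: "\<And>f g. T (f + g) = T f + T g" and smult: "\<And>c f. T (smult c f) = c * T f"
    and chip: "\<And>j. j \<le> p \<Longrightarrow> T (chip j) = 0" and deg: "degree f \<le> p"
  shows "T f = 0"
  using deg
proof (induction "degree f" arbitrary: f rule: less_induct)
  case less
  define n where "n = degree f"
  define g where "g = f - smult (coeff f n) (chip n)"
  have f: "f = g + smult (coeff f n) (chip n)" by (simp add: g_def)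
  have Tf: "T f = T g"
    by (subst f) (use less.prems in \<open>simp add: add smult chip n_def\<close>)
  show ?case
  proof (cases "g = 0")
    case True
    have "T 0 = 0" using smult[of 0 0] by simp
    then show ?thesis using Tf True by simp
  next
    case False
    have "degree g \<le> n"
      unfolding g_def by (intro degree_diff_le) (use degree_chip[of n] in \<open>simp_all add: n_def\<close>)
    moreover have "coeff g n = 0" using degree_chip[of n] by (simp add: g_def)
    ultimately have "degree g < n"
      using False by (metis le_neq_implies_less leading_coeff_0_iff)
    then show ?thesis using less Tf by (simp add: n_def)
  qed
qed

text \<open>Divided powers of \<open>(s\<^sup>2 - R\<^sup>2) / 2\<close>: the normalisation makes
  the derivative of each one the variable times its predecessor. All but the first vanish at
  \<open>R\<close>.\<close>

definition upow :: "real \<Rightarrow> nat \<Rightarrow> real poly" where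
  "upow R i = smult (1 / (2 ^ i * fact i)) ([:- R\<^sup>2, 0, 1:] ^ i)"

lemma poly_upow: "poly (upow R i) s = (s\<^sup>2 - R\<^sup>2) ^ i / (2 ^ i * fact i)"
  by (simp add: upow_def power2_eq_square algebra_simps)

lemma upow_0 [simp]: "upow R 0 = 1"
  by (simp add: upow_def)

lemma pderiv_upow_Suc: "pderiv (upow R (Suc i)) = [:0, 1:] * upow R i"
proof -
  have "pderiv ([:- R\<^sup>2, 0, 1:] ^ Suc i) = smult (2 * real (Suc i)) ([:0, 1:] * [:- R\<^sup>2, 0, 1:] ^ i)"
    unfolding pderiv_power_Suc by (simp add: pderiv_pCons mult.commute)
  moreover have "1 / (2 ^ Suc i * fact (Suc i)) * (2 * real (Suc i)) = 1 / (2 ^ i * fact i :: real)"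
    by (simp add: field_simps del: of_nat_Suc)
  ultimately show ?thesis
    unfolding upow_def pderiv_smult by (simp only: smult_smult mult_smult_right)
qed

text \<open>Integration by parts with \<open>chip j = chiq j - pderiv (chiq j)\<close>: the boundary
  term contains \<open>upow R (Suc i)\<close> and vanishes at \<open>R\<close>, and what remains is
  \<open>chip (Suc j) * upow R i\<close>. Each step moves one unit of index from \<open>upow\<close>
  to \<open>chip\<close>, which explains the Hankel structure.\<close>

lemma lap_chip_upow: "R \<noteq> 0 \<Longrightarrow> poly (lap (chip j * upow R i)) R = chi (i + j + 1) R / R"
proof (induction i arbitrary: j)
  case 0
  have "lap (chip j) = chiq j" by (rule lap_eqI[OF chiq_diff_pderiv])
  moreover have "chi (Suc j) R = R * poly (chiq j) R"
    unfolding poly_chip[symmetric] chip_Suc by simp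
  ultimately show ?case using 0 by simp
next
  case (Suc i)
  have "chip j * upow R (Suc i) = (chiq j * upow R (Suc i) - pderiv (chiq j * upow R (Suc i))) + chip (Suc j) * upow R i"
  proof -
    have "(a - a') * u = (a * u - (a * (x * v) + u * a')) + x * a * v" for a a' u v x :: "real poly"
      by (simp add: algebra_simps)
    note algebra = this
    show ?thesis
      unfolding chiq_diff_pderiv[of j, symmetric] pderiv_mult pderiv_upow_Suc chip_Suc by (rule algebra)
  qed
  then have "lap (chip j * upow R (Suc i)) = chiq j * upow R (Suc i) + lap (chip (Suc j) * upow R i)"
    by (simp only: lap_add lap_diff_pderiv)
  then show ?case using Suc.IH[of "Suc j"] Suc.prems by (simp add: poly_upow)
qed

text \<open>The index shift leaves \<open>b 0\<close> for the point masses of size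
  \<open>- b 0 / R\<close>, so that tail condition and point masses combine into the single system
  with entries \<open>chi (k + j) R\<close>.\<close>

definition qpoly :: "nat \<Rightarrow> real \<Rightarrow> (nat \<Rightarrow> real) \<Rightarrow> real poly" where
  "qpoly p R b = (\<Sum>i\<le>p. smult (b (Suc i)) (upow R i))"

lemma lap_mult_qpoly:
  assumes R: "R \<noteq> 0" and b: "\<And>j. j \<le> p \<Longrightarrow> (\<Sum>k\<le>Suc p. b k * chi (k + j) R) = 0" and deg: "degree f \<le> p"
  shows "poly (lap (f * qpoly p R b)) R = - b 0 / R * poly f R"
proof -
  define T where "T f = poly (lap (f * qpoly p R b)) R + b 0 / R * poly f R" for f
  have "T f = 0"
  proof (rule linear_vanishes_on_chip_span[OF _ _ _ deg])
    fix j assume j: "j \<le> p"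
    have "poly (lap (chip j * qpoly p R b)) R = (\<Sum>i\<le>p. b (Suc i) * (chi (i + j + 1) R / R))"
      by (simp add: qpoly_def sum_distrib_left lap_sum lap_smult poly_sum lap_chip_upow[OF R])
    also have "\<dots> = (\<Sum>i\<le>p. b (Suc i) * chi (Suc i + j) R) / R"
      by (simp add: sum_divide_distrib)
    also have "(\<Sum>i\<le>p. b (Suc i) * chi (Suc i + j) R) = - b 0 * chi j R"
      using b[OF j] by (subst (asm) sum.atMost_Suc_shift) simp
    finally show "T (chip j) = 0" by (simp add: T_def poly_chip)
  qed (simp_all add: T_def distrib_right lap_add lap_smult algebra_simps)
  then show ?thesis by (simp add: T_def)
qed

text \<open>The moment of order \<open>m\<close> of \<open>phi p\<close> on the half-line, expressed
  through \<open>lap\<close> so that no improper integral occurs.\<close>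

definition ell_moment :: "nat \<Rightarrow> nat \<Rightarrow> real" where
  "ell_moment p m = poly (lap (ell p * monom 1 m)) 0"

lemma ell_moment_0: "ell_moment 0 m = fact m"
proof -
  have "poly (lap (monom 1 m)) 0 = (fact m :: real)"
  proof (induction m)
    case 0
    have "lap 1 = 1" by (rule lap_eqI) simp
    then show ?case by simp
  next
    case (Suc m)
    have "monom 1 (Suc m) = (monom 1 (Suc m) - pderiv (monom 1 (Suc m))) + smult (real (Suc m)) (monom (1::real) m)"
      by (simp add: pderiv_monom smult_monom)
    then have "lap (monom 1 (Suc m)) = monom 1 (Suc m) + smult (real (Suc m)) (lap (monom 1 m))"
      by (metis lap_add lap_diff_pderiv lap_smult)
    then show ?case using Suc.IH by (simp add: poly_monom)
  qed
  then show ?thesis by (simp add: ell_moment_def)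
qed

text \<open>The derivative in the recursion for \<open>ell\<close> is integrated by parts against
  the power of order \<open>m + 1\<close>; the boundary term vanishes at \<open>0\<close>, leaving
  the factor \<open>1 - (m + 1) / (2 * l + 1)\<close>.\<close>

lemma ell_moment_Suc: "ell_moment (Suc l) m = (2 * real l - real m) / real (2 * l + 1) * ell_moment l m"
proof -
  define c where "c = real (2 * l + 1)"
  have c: "c \<noteq> 0" by (simp add: c_def)
  define x where "x = (monom 1 (Suc m) :: real poly)"
  have dx: "pderiv x = smult (real (Suc m)) (monom 1 m)"
    by (simp add: x_def pderiv_monom smult_monom)
  have "pCons 0 (pderiv (ell l) - ell l) * monom 1 m = (pderiv (ell l) - ell l) * x"
    by (simp add: x_def monom_Suc mult.commute)
  also have "\<dots> = smult (-1) (ell l * x - pderiv (ell l * x)) - smult (real (Suc m)) (ell l * monom 1 m)"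
    unfolding pderiv_mult dx mult_smult_right by (simp add: algebra_simps)
  also have "\<dots> = smult (-1) (ell l * x - pderiv (ell l * x)) + smult (- real (Suc m)) (ell l * monom 1 m)"
    by (simp only: diff_conv_add_uminus smult_minus_left)
  finally have e: "ell (Suc l) * monom 1 m = smult (1 / c) (smult (-1) (ell l * x - pderiv (ell l * x)) + smult (- real (Suc m)) (ell l * monom 1 m))
      + ell l * monom 1 m"
    by (simp only: ell.simps c_def distrib_right mult_smult_left)
  have "lap (ell (Suc l) * monom 1 m) = smult (1 / c) (smult (-1) (ell l * x) + smult (- real (Suc m)) (lap (ell l * monom 1 m)))
      + lap (ell l * monom 1 m)"
    unfolding e by (simp only: lap_add lap_smult lap_diff_pderiv)
  then have "ell_moment (Suc l) m = 1 / c * (- real (Suc m) * ell_moment l m) + ell_moment l m"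
    by (simp add: ell_moment_def x_def poly_monom)
  also have "\<dots> = (2 * real l - real m) / c * ell_moment l m"
    using c by (simp add: field_simps) (simp add: c_def algebra_simps)
  finally show ?thesis by (simp add: c_def)
qed

lemma ell_moment_eq: "ell_moment p m = fact m * (\<Prod>l<p. (2 * real l - real m) / real (2 * l + 1))"
  by (induction p) (simp_all add: ell_moment_0 ell_moment_Suc del: of_nat_add of_nat_mult of_nat_Suc)

text \<open>The factor with \<open>l = k\<close> vanishes. This is why convolution with
  \<open>phi p\<close> over the whole line retains only the leading coefficient of a polynomial of
  degree at most \<open>2 * p\<close>.\<close>

lemma ell_moment_even_eq_0: "k < p \<Longrightarrow> ell_moment p (2 * k) = 0"
  unfolding ell_moment_eq by (auto simp: prod_zero_iff)

lemma ell_moment_top: "ell_moment p (2 * p) = fact (2 * p) * ((-1) ^ p * 2 ^ p * fact p / (\<Prod>l<p. real (2 * l + 1)))"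
proof -
  have "(\<Prod>l<p. 2 * real l - real (2 * p)) = (\<Prod>l<p. (-2) * real (p - l))"
    by (intro prod.cong) (auto simp: of_nat_diff)
  also have "\<dots> = (-2) ^ p * (\<Prod>l<p. real (p - l))"
    unfolding prod.distrib by simp
  also have "(\<Prod>l<p. real (p - l)) = fact p"
  proof -
    have "(\<Prod>l<p. real (p - l)) = (\<Prod>l<p. real (Suc l))"
      by (subst prod.nat_diff_reindex[symmetric]) (intro prod.cong, auto)
    then show ?thesis by (simp add: fact_prod_Suc atLeast0LessThan)
  qed
  also have "(-2 :: real) ^ p = (-1) ^ p * 2 ^ p" by (simp add: power_mult_distrib[symmetric])
  finally show ?thesis unfolding ell_moment_eq by (simp add: prod_dividef)
qed

lemma lap_ell_mult:
  assumes "degree E \<le> n"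
  shows "poly (lap (ell p * E)) 0 = (\<Sum>m\<le>n. coeff E m * ell_moment p m)"
proof -
  have "E = (\<Sum>m\<le>n. smult (coeff E m) (monom 1 m))"
    using poly_as_sum_of_monoms'[OF assms] by (simp add: smult_monom)
  then have "ell p * E = (\<Sum>m\<le>n. smult (coeff E m) (ell p * monom 1 m))"
    by (metis (no_types, lifting) mult_smult_right sum.cong sum_distrib_left)
  then show ?thesis
    by (simp add: lap_sum lap_smult poly_sum ell_moment_def)
qed

lemma degree_ell: "degree (ell l) \<le> l"
proof (induction l)
  case (Suc l)
  have "degree (pderiv (ell l) - ell l) \<le> l"
    using Suc by (intro degree_diff_le) (simp_all add: degree_pderiv)
  then have "degree (pCons 0 (pderiv (ell l) - ell l)) \<le> Suc l"
    by (metis degree_pCons_le le_trans Suc_le_mono)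
  then show ?case
    unfolding ell.simps using Suc by (intro degree_add_le order_trans[OF degree_smult_le]) simp_all
qed simp

lemma coeff_pcompose_translate_top:
  fixes q :: "real poly"
  assumes "degree q \<le> n"
  shows "coeff (pcompose q [:t, 1:]) n = coeff q n"
proof (cases "degree q = n")
  case True
  then show ?thesis
    using lead_coeff_comp[of "[:t, 1:]" q] by (simp add: degree_pcompose)
next
  case False
  then show ?thesis using assms by (simp add: coeff_eq_0 degree_pcompose)
qed

text \<open>The constant term is the convolution over the whole line. The missing tails beyond
  \<open>R\<close> and \<open>- R\<close> are evaluated by \<open>boundary\<close>, which applies
  because beyond the endpoint the kernel is an exponential times a polynomial of degree at most
  \<open>p\<close>; they equal potentials of point masses \<open>\<beta>\<close>.\<close>

lemma has_integral_phi_even: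
  fixes q :: "real poly"
  assumes R: "0 < R" and t: "\<bar>t\<bar> \<le> R" and deg: "degree q \<le> 2 * p"
    and even: "\<And>s. poly q (- s) = poly q s"
    and boundary: "\<And>f. degree f \<le> p \<Longrightarrow> poly (lap (f * q)) R = \<beta> * poly f R"
  shows "((\<lambda>s. phi p \<bar>t - s\<bar> * poly q s) has_integral
      (2 * coeff q (2 * p) * ell_moment p (2 * p) - \<beta> * (phi p (R - t) + phi p (R + t)))) {-R..R}"
proof -
  define A where "A t = poly (lap (ell p * pcompose q [:t, 1:])) 0" for t
  have half: "((\<lambda>s. phi p (s - t) * poly q s) has_integral (A t - \<beta> * phi p (R - t))) {t..R}" if "t \<le> R" for t
  proof -
    define f where "f = pcompose (ell p) [:- t, 1:] * q"
    have shift: "pcompose f [:t, 1:] = ell p * pcompose q [:t, 1:]"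
      unfolding f_def pcompose_mult pcompose_assoc[symmetric] by (simp add: pcompose_pCons)
    have "((\<lambda>s. exp t * (exp (- s) * poly f s)) has_integral (exp t * (exp (- t) * poly (lap f) t - exp (- R) * poly (lap f) R))) {t..R}"
      by (intro has_integral_mult_right has_integral_exp_poly that)
    moreover have "poly (lap f) t = A t"
      unfolding A_def shift[symmetric] lap_pcompose_translate by (simp add: poly_pcompose)
    moreover have "poly (lap f) R = \<beta> * poly (ell p) (R - t)"
      unfolding f_def using degree_ell[of p] by (subst boundary) (simp_all add: degree_pcompose poly_pcompose)
    moreover have "exp t * (exp (- s) * poly f s) = phi p (s - t) * poly q s" for s
      by (simp add: phi_def f_def poly_pcompose exp_diff exp_minus field_simps)
    moreover have "exp t * (exp (- t) * A t - exp (- R) * (\<beta> * poly (ell p) (R - t))) = A t - \<beta> * phi p (R - t)"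
    proof -
      have "exp t * (exp (- t) * A t - exp (- R) * (\<beta> * poly (ell p) (R - t)))
          = exp (t + - t) * A t - \<beta> * (exp (t + - R) * poly (ell p) (R - t))"
        unfolding exp_add by (simp only: right_diff_distrib mult_ac)
      then show ?thesis by (simp add: phi_def)
    qed
    ultimately show ?thesis by simp
  qed
  have right: "((\<lambda>s. phi p \<bar>t - s\<bar> * poly q s) has_integral (A t - \<beta> * phi p (R - t))) {t..R}"
    by (rule has_integral_eq[OF _ half]) (use t in auto)
  have "((\<lambda>s. phi p (- s + t) * poly q (- s)) has_integral (A (- t) - \<beta> * phi p (R + t))) {-R..-(-t)}"
    using half[of "- t"] t by (subst has_integral_reflect_real) simp
  then have reflected: "((\<lambda>s. phi p (- s + t) * poly q (- s)) has_integral (A (- t) - \<beta> * phi p (R + t))) {-R..t}"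
    by simp
  have left: "((\<lambda>s. phi p \<bar>t - s\<bar> * poly q s) has_integral (A (- t) - \<beta> * phi p (R + t))) {-R..t}"
    by (rule has_integral_eq[OF _ reflected]) (simp add: even)
  have sum: "A t + A (- t) = 2 * coeff q (2 * p) * ell_moment p (2 * p)"
  proof -
    \<comment> \<open>Since \<open>q\<close> is even, the integral to the left of \<open>t\<close>
      is the one to the right of \<open>- t\<close>. The sum involves the even polynomial
      \<open>E\<close>: its odd coefficients vanish, and the even moments below \<open>2 * p\<close>
      do too.\<close>
    define E where "E = pcompose q [:t, 1:] + pcompose q [:- t, 1:]"
    have "degree E \<le> 2 * p"
      unfolding E_def using deg by (intro degree_add_le) (simp_all add: degree_pcompose)
    have "pcompose E [:0, - 1:] = E"
    proof (rule poly_eq_poly_eq_iff[THEN iffD1, OF ext])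
      fix x
      have "poly q (t + - x) = poly q (- t + x)" "poly q (- t + - x) = poly q (t + x)"
        using even[of "t - x"] even[of "t + x"] by simp_all
      then show "poly (pcompose E [:0, - 1:]) x = poly E x"
        by (simp add: E_def poly_pcompose)
    qed
    then have "coeff E m = (-1) ^ m * coeff E m" for m
      using coeff_pcompose_linear[of E "-1" m] by simp
    then have odd: "coeff E m = 0" if "odd m" for m
      using that by (metis add.inverse_inverse equal_neg_zero mult_minus1 power_minus_odd power_one mult_1)
    have "A t + A (- t) = poly (lap (ell p * E)) 0"
      by (simp add: A_def E_def distrib_left lap_add)
    also have "\<dots> = (\<Sum>m\<le>2 * p. coeff E m * ell_moment p m)"
      by (rule lap_ell_mult) fact
    also have "\<dots> = (\<Sum>m\<in>{2 * p}. coeff E m * ell_moment p m)"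
    proof (rule sum.mono_neutral_right)
      show "\<forall>m\<in>{..2 * p} - {2 * p}. coeff E m * ell_moment p m = 0"
      proof
        fix m assume m: "m \<in> {..2 * p} - {2 * p}"
        show "coeff E m * ell_moment p m = 0"
        proof (cases "odd m")
          case False
          then have "even m" by simp
          then obtain k where "m = 2 * k" by (rule evenE)
          with m ell_moment_even_eq_0[of k p] show ?thesis by simp
        qed (simp add: odd)
      qed
    qed auto
    also have "\<dots> = 2 * coeff q (2 * p) * ell_moment p (2 * p)"
      by (simp add: E_def coeff_pcompose_translate_top[OF deg])
    finally show ?thesis .
  qed
  have "((\<lambda>s. phi p \<bar>t - s\<bar> * poly q s) has_integral ((A (- t) - \<beta> * phi p (R + t)) + (A t - \<beta> * phi p (R - t)))) {-R..R}"
    by (rule has_integral_combine[OF _ _ left right]) (use t in auto)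
  moreover have "(A (- t) - \<beta> * phi p (R + t)) + (A t - \<beta> * phi p (R - t))
      = 2 * coeff q (2 * p) * ell_moment p (2 * p) - \<beta> * (phi p (R - t) + phi p (R + t))"
    unfolding sum[symmetric] by (simp add: algebra_simps)
  ultimately show ?thesis by simp
qed

section \<open>Non-degeneracy of the Hankel matrix\<close>

lemma exp_poly_tendsto_0: "((\<lambda>x::real. exp (- x) * poly f x) \<longlongrightarrow> 0) at_top"
proof -
  have "((\<lambda>x::real. \<Sum>i\<le>degree f. coeff f i * (x ^ i / exp x)) \<longlongrightarrow> (\<Sum>i\<le>degree f. coeff f i * 0)) at_top"
    by (intro tendsto_sum tendsto_mult tendsto_const tendsto_power_div_exp_0)
  moreover have "(\<Sum>i\<le>degree f. coeff f i * (x ^ i / exp x)) = exp (- x) * poly f x" for x :: real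
    by (simp add: poly_altdef sum_distrib_left exp_minus divide_inverse mult_ac)
  ultimately show ?thesis by simp
qed

text \<open>\<open>exp (- t) * poly (lap F) t\<close> is the integral of
  \<open>exp (- s) * poly F s\<close> over \<open>[t, \<infinity>)\<close>: it decreases to
  \<open>0\<close> on \<open>[R, \<infinity>)\<close> and starts at \<open>0\<close>, so it is zero
  throughout.\<close>

lemma lap_nonneg_eq_0:
  assumes nonneg: "\<And>s. R \<le> s \<Longrightarrow> 0 \<le> poly F s" and zero: "poly (lap F) R = 0"
  shows "F = 0"
proof -
  have mono: "exp (- b) * poly (lap F) b \<le> exp (- a) * poly (lap F) a" if "R \<le> a" "a \<le> b" for a b
    using has_integral_nonneg[OF has_integral_exp_poly[OF that(2), of F]] nonneg that by simp
  have "poly (lap F) t = 0" if t: "R \<le> t" for t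
  proof -
    have "exp (- t) * poly (lap F) t \<le> 0" using mono[OF order_refl t] zero by simp
    moreover have "0 \<le> exp (- t) * poly (lap F) t"
    proof (rule tendsto_upperbound[OF exp_poly_tendsto_0])
      show "\<forall>\<^sub>F x in at_top. exp (- x) * poly (lap F) x \<le> exp (- t) * poly (lap F) t"
        using eventually_ge_at_top[of t] by eventually_elim (rule mono[OF t])
    qed simp
    ultimately have "exp (- t) * poly (lap F) t = 0" by (rule antisym)
    then show ?thesis by simp
  qed
  then have "{R..} \<subseteq> {x. poly (lap F) x = 0}" by auto
  then have "\<not> finite {x. poly (lap F) x = 0}"
    using infinite_Ici finite_subset by blast
  then have "lap F = 0" using poly_roots_finite by blast
  then show ?thesis using lap[of F] by simp
qed

lemma degree_linear_mult:
  fixes g :: "real poly"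
  assumes "g \<noteq> 0"
  shows "degree ([:a, 1:] * g) = Suc (degree g)"
  using degree_mult_eq[of "[:a, 1:]" g] assms by (simp del: mult_pCons_left)

text \<open>A positive root \<open>z\<close> of \<open>P\<close> is matched by the factor
  \<open>s - sqrt (z + R\<^sup>2)\<close>, which changes sign where
  \<open>s\<^sup>2 - R\<^sup>2 - z\<close> does. Once no positive root is left, the sign is constant
  and a constant \<open>g\<close> suffices.\<close>

lemma sign_compensating_poly:
  fixes P :: "real poly"
  assumes "P \<noteq> 0" and R: "0 < R"
  shows "\<exists>g. g \<noteq> 0 \<and> degree g \<le> degree P \<and> (\<forall>s\<ge>R. 0 \<le> poly g s * poly P (s\<^sup>2 - R\<^sup>2))"
  using assms(1)
proof (induction "degree P" arbitrary: P rule: less_induct)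
  case less
  show ?case
  proof (cases "\<exists>z>0. poly P z = 0")
    case True
    then obtain z where z: "0 < z" "poly P z = 0" by blast
    then obtain Q where Q: "P = [:- z, 1:] * Q" by (metis poly_eq_0_iff_dvd dvdE)
    with less.prems have Q0: "Q \<noteq> 0" by auto
    then have degQ: "degree P = Suc (degree Q)" unfolding Q by (rule degree_linear_mult)
    obtain g where g: "g \<noteq> 0" "degree g \<le> degree Q" "\<forall>s\<ge>R. 0 \<le> poly g s * poly Q (s\<^sup>2 - R\<^sup>2)"
      using less.hyps[of Q] Q0 degQ by auto
    define r where "r = sqrt (z + R\<^sup>2)"
    have r: "0 < r" "r\<^sup>2 = z + R\<^sup>2" using z by (simp_all add: r_def add_pos_nonneg)
    show ?thesis
    proof (intro exI[of _ "[:- r, 1:] * g"] conjI allI impI)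
      show "[:- r, 1:] * g \<noteq> 0" using g(1) by (simp del: mult_pCons_left)
      show "degree ([:- r, 1:] * g) \<le> degree P"
        using g(2) degQ degree_linear_mult[OF g(1), of "- r"] by simp
      fix s assume s: "R \<le> s"
      have "poly ([:- r, 1:] * g) s * poly P (s\<^sup>2 - R\<^sup>2) = (s - r)\<^sup>2 * (s + r) * (poly g s * poly Q (s\<^sup>2 - R\<^sup>2))"
      proof -
        have "s\<^sup>2 - R\<^sup>2 - z = (s - r) * (s + r)"
          using r(2) by (simp add: power2_eq_square algebra_simps)
        then have "poly P (s\<^sup>2 - R\<^sup>2) = (s - r) * (s + r) * poly Q (s\<^sup>2 - R\<^sup>2)"
          unfolding Q by (simp add: left_diff_distrib[symmetric] del: mult_pCons_left)
        moreover have "poly ([:- r, 1:] * g) s = (s - r) * poly g s"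
          by (simp add: left_diff_distrib)
        ultimately show ?thesis by (simp add: power2_eq_square)
      qed
      also have "\<dots> \<ge> 0"
      proof (rule mult_nonneg_nonneg)
        show "0 \<le> (s - r)\<^sup>2 * (s + r)" using s r(1) R by simp
        show "0 \<le> poly g s * poly Q (s\<^sup>2 - R\<^sup>2)" using g(3) s by blast
      qed
      finally show "0 \<le> poly ([:- r, 1:] * g) s * poly P (s\<^sup>2 - R\<^sup>2)" .
    qed
  next
    case False
    then have P1: "poly P 1 \<noteq> 0" by (auto dest: spec[of _ 1])
    have sgn: "0 \<le> poly P 1 * poly P z" if z: "0 \<le> z" for z
    proof (rule ccontr)
      assume neg: "\<not> 0 \<le> poly P 1 * poly P z"
      then have "z \<noteq> 1" by auto
      then consider "z < 1" | "1 < z" by linarith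
      then show False
      proof cases
        case 1
        then obtain x where "z < x" "x < 1" "poly P x = 0"
          using poly_IVT[of z 1 P] neg by (auto simp: mult.commute)
        then have "0 < x" using z by linarith
        with False \<open>poly P x = 0\<close> show False by blast
      next
        case 2
        then obtain x where "1 < x" "x < z" "poly P x = 0"
          using poly_IVT[of 1 z P] neg by auto
        then have "0 < x" by linarith
        with False \<open>poly P x = 0\<close> show False by blast
      qed
    qed
    show ?thesis
    proof (intro exI[of _ "[:poly P 1:]"] conjI allI impI)
      fix s assume "R \<le> s"
      then have "0 \<le> s\<^sup>2 - R\<^sup>2" using R by (simp add: power_mono)
      then show "0 \<le> poly [:poly P 1:] s * poly P (s\<^sup>2 - R\<^sup>2)" using sgn by simp
    qed (use P1 in auto)
  qed
qed

definition qbase :: "nat \<Rightarrow> (nat \<Rightarrow> real) \<Rightarrow> real poly" where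
  "qbase p b = (\<Sum>i\<le>p. monom (b (Suc i) / (2 ^ i * fact i)) i)"

lemma poly_qpoly: "poly (qpoly p R b) s = poly (qbase p b) (s\<^sup>2 - R\<^sup>2)"
  by (simp add: qpoly_def qbase_def poly_sum poly_upow poly_monom)

lemma coeff_qbase: "coeff (qbase p b) i = (if i \<le> p then b (Suc i) / (2 ^ i * fact i) else 0)"
  by (simp add: qbase_def coeff_sum coeff_monom)

text \<open>A kernel vector yields a \<open>q\<close> of degree less than \<open>2 p\<close> for which the integral of
  \<open>exp (- s) f s q s\<close> over \<open>[R, \<infinity>)\<close> is a multiple of \<open>f R\<close> whenever \<open>degree f \<le> p\<close>; a suitable \<open>f\<close>
  vanishing at \<open>R\<close> makes the integrand nonnegative.\<close>
lemma hankel_kernel_trivial: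
  assumes R: "0 < R" and v: "\<And>j. j \<le> p \<Longrightarrow> (\<Sum>k\<le>p. v k * chi (k + j) R) = 0"
  shows "\<forall>k\<le>p. v k = 0"
proof -
  define b where "b k = (if k \<le> p then v k else 0)" for k
  have b: "(\<Sum>k\<le>Suc p. b k * chi (k + j) R) = 0" if "j \<le> p" for j
    using v[OF that] by (simp add: b_def del: chi.simps)
  define P where "P = qbase p b"
  have P0: "P = 0"
  proof (rule ccontr)
    assume P: "P \<noteq> 0"
    \<comment> \<open>The missing entry \<open>b (Suc p)\<close> lowers the degree of
      \<open>P\<close> below \<open>p\<close>, which leaves room for the additional factor vanishing
      at \<open>R\<close> in \<open>f\<close>.\<close>
    have top: "coeff P p = 0" by (simp add: P_def coeff_qbase b_def)
    have "degree P \<le> p" unfolding P_def by (intro degree_le) (simp add: coeff_qbase)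
    with top P have deg: "degree P < p"
      by (metis le_neq_implies_less leading_coeff_0_iff)
    obtain g where g: "g \<noteq> 0" "degree g \<le> degree P" "\<forall>s\<ge>R. 0 \<le> poly g s * poly P (s\<^sup>2 - R\<^sup>2)"
      using sign_compensating_poly[OF P R] by blast
    define f where "f = [:- R, 1:] * g"
    have "degree f \<le> p" using g(2) deg degree_linear_mult[OF g(1), of "- R"] unfolding f_def by simp
    from lap_mult_qpoly[OF _ b this] have "poly (lap (f * qpoly p R b)) R = 0"
      using R by (simp add: f_def)
    then have "f * qpoly p R b = 0"
    proof (rule lap_nonneg_eq_0[rotated])
      fix s assume s: "R \<le> s"
      have "poly (f * qpoly p R b) s = (s - R) * (poly g s * poly P (s\<^sup>2 - R\<^sup>2))"
        by (simp add: f_def poly_qpoly P_def[symmetric] left_diff_distrib)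
      then show "0 \<le> poly (f * qpoly p R b) s" using g(3) s by simp
    qed
    moreover have "f \<noteq> 0" using g(1) by (simp add: f_def del: mult_pCons_left)
    ultimately have "qpoly p R b = 0" by simp
    then have root: "poly P (s\<^sup>2 - R\<^sup>2) = 0" for s
      using poly_qpoly[of p R b s] by (simp add: P_def)
    have "{0..} \<subseteq> {x. poly P x = 0}"
    proof
      fix x :: real assume "x \<in> {0..}"
      then show "x \<in> {x. poly P x = 0}" using root[of "sqrt (x + R\<^sup>2)"] by simp
    qed
    then have "\<not> finite {x. poly P x = 0}"
      using infinite_Ici finite_subset by blast
    then show False using P poly_roots_finite by blast
  qed
  have vS: "v (Suc i) = 0" if "i < p" for i
  proof -
    have "coeff P i = 0" using P0 by simp
    then show ?thesis using that by (simp add: P_def coeff_qbase b_def)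
  qed
  have "(\<Sum>k\<le>p. v k * chi (k + 0) R) = (\<Sum>k\<in>{0}. v k * chi (k + 0) R)"
  proof (rule sum.mono_neutral_right)
    show "\<forall>k\<in>{..p} - {0}. v k * chi (k + 0) R = 0"
    proof
      fix k assume "k \<in> {..p} - {0}"
      then obtain i where "k = Suc i" "i < p" by (cases k) auto
      then show "v k * chi (k + 0) R = 0" using vS by simp
    qed
  qed auto
  then have "v 0 = 0" using v[of 0] by simp
  then show ?thesis using vS by (metis Suc_le_lessD not0_implies_Suc)
qed

section \<open>Approximating the boundary terms of the profile\<close>

lemma integral_Icc_lborel:
  fixes f :: "real \<Rightarrow> real"
  assumes "continuous_on {a..b} f"
  shows "(\<integral>t. indicator {a..b} t * f t \<partial>lborel) = integral {a..b} f"
proof -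
  have "set_integrable lborel {a..b} f"
    using assms by (rule borel_integrable_atLeastAtMost')
  from set_borel_integral_eq_integral(2)[OF this] show ?thesis
    by (simp add: set_lebesgue_integral_def)
qed

lemma tpoly_Icc:
  assumes "0 < R"
  shows "tpoly W (R\<^sup>2 - t\<^sup>2) = indicator {-R..R} t * poly W (R\<^sup>2 - t\<^sup>2)"
proof -
  have "0 \<le> R\<^sup>2 - t\<^sup>2 \<longleftrightarrow> t \<in> {-R..R}"
    using assms abs_le_square_iff[of t R] by auto
  then show ?thesis by (simp add: tpoly_def indicator_def)
qed

text \<open>Divisibility by the \<open>p\<close>-th power is the only condition for being a
  projected profile. A profile \<open>q\<close> that does not vanish suitably at \<open>R\<close>
  and \<open>- R\<close> must first be cut off there.\<close>

lemma proj_poly_surj: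
  assumes "monom 1 p dvd W"
  shows "\<exists>F. proj_poly p F = W"
proof -
  obtain G where G: "W = monom 1 p * G" using assms by (rule dvdE)
  define F where "F = (\<Sum>j\<le>degree G. monom (coeff G j / proj_const p j) j)"
  have cF: "coeff F j = coeff G j / proj_const p j" for j
    by (simp add: F_def coeff_sum coeff_monom coeff_eq_0)
  have "coeff (proj_poly p F) n = coeff W n" for n
  proof (cases "n < p")
    case True
    then have "coeff (proj_poly p F) n = 0"
      unfolding proj_poly_def coeff_sum by (intro sum.neutral) simp
    then show ?thesis using True by (simp add: G coeff_monom_mult)
  next
    case False
    then obtain j where j: "n = j + p" by (metis add.commute le_add_diff_inverse not_less)
    have "coeff (proj_poly p F) n = (\<Sum>i\<le>degree F. if i = j then coeff F i * proj_const p i else 0)"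
      unfolding proj_poly_def coeff_sum j by (intro sum.cong) simp_all
    also have "\<dots> = coeff F j * proj_const p j"
      by (simp add: coeff_eq_0)
    also have "\<dots> = coeff G j" using proj_const_pos[of p j] by (simp add: cF del: proj_const.simps)
    finally show ?thesis by (simp add: G j coeff_monom_mult)
  qed
  then show ?thesis by (intro exI[of _ F] poly_eqI)
qed

lemma has_integral_half_beta_scaled:
  assumes R: "0 < R"
  shows "((\<lambda>t. (R\<^sup>2 - t\<^sup>2) ^ j * (t / R) ^ m) has_integral R ^ (2 * j + 1) * half_beta j m) {0..R}"
proof -
  have "((\<lambda>x. (1 / R * x) ^ m * (1 - (1 / R * x)\<^sup>2) ^ j) has_integral (1 / \<bar>1 / R\<bar>) * half_beta j m) ((\<lambda>x. x / (1 / R)) ` {0..1})"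
    using has_integral_stretch_real[OF has_integral_half_beta[of m j], of "1 / R"] R by simp
  moreover have "(\<lambda>x. x / (1 / R)) ` {0..1} = {0..R}"
    using R image_mult_atLeastAtMost[of R 0 1] by (simp add: mult.commute)
  ultimately have "((\<lambda>x. (1 / R * x) ^ m * (1 - (1 / R * x)\<^sup>2) ^ j) has_integral (R * half_beta j m)) {0..R}"
    using R by simp
  then have scaled: "((\<lambda>x. R ^ (2 * j) * ((1 / R * x) ^ m * (1 - (1 / R * x)\<^sup>2) ^ j)) has_integral R ^ (2 * j) * (R * half_beta j m)) {0..R}"
    by (rule has_integral_mult_right)
  have integrand: "R ^ (2 * j) * ((1 / R * t) ^ m * (1 - (1 / R * t)\<^sup>2) ^ j) = (R\<^sup>2 - t\<^sup>2) ^ j * (t / R) ^ m" for t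
  proof -
    have e: "R\<^sup>2 - t\<^sup>2 = R\<^sup>2 * (1 - (t / R)\<^sup>2)" using R by (simp add: field_simps)
    have d: "1 / R * t = t / R" by simp
    show ?thesis
      unfolding e d power_mult_distrib[of "R\<^sup>2"] power_mult[of R 2 j] by (simp only: mult_ac)
  qed
  have "R ^ (2 * j) * (R * half_beta j m) = R ^ (2 * j + 1) * half_beta j m" by simp
  with scaled show ?thesis unfolding integrand by (simp only:)
qed

lemma half_beta_Suc_ratio: "half_beta (Suc j) m = half_beta j m * (2 * real (Suc j) / real (m + 2 * j + 3))"
proof -
  define d where "d = (\<Prod>i\<le>j. real (m + 2 * i + 1))"
  have d: "d > 0" by (auto simp: d_def intro!: prod_pos)
  have 1: "half_beta j m = 2 ^ j * fact j / d" by (simp add: half_beta_def d_def)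
  have 2: "half_beta (Suc j) m = 2 ^ Suc j * fact (Suc j) / (d * real (m + 2 * j + 3))"
    by (simp add: half_beta_def d_def add_ac)
  have "2 ^ Suc j * fact (Suc j) = (2 ^ j * fact j) * (2 * real (Suc j) :: real)"
    by (simp add: mult_ac del: of_nat_Suc)
  then show ?thesis unfolding 1 2 by simp
qed

text \<open>On \<open>[-R, R]\<close> these projections of radial densities tend to point masses at \<open>R\<close> and \<open>- R\<close>.\<close>
definition bump :: "nat \<Rightarrow> real \<Rightarrow> nat \<Rightarrow> real \<Rightarrow> real" where
  "bump p R k t = 1 / (R ^ (2 * p + 1) * half_beta p (2 * k)) * ((R\<^sup>2 - t\<^sup>2) ^ p * (t / R) ^ (2 * k))"

lemma bump_even: "bump p R k (- t) = bump p R k t"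
  by (simp add: bump_def)

lemma continuous_on_bump: "R \<noteq> 0 \<Longrightarrow> continuous_on S (bump p R k)"
  unfolding bump_def[abs_def] by (intro continuous_intros) auto

lemma bump_nonneg: "0 < R \<Longrightarrow> \<bar>t\<bar> \<le> R \<Longrightarrow> 0 \<le> bump p R k t"
  unfolding bump_def using half_beta_pos[of p "2 * k"] abs_le_square_iff[of t R]
  by (intro mult_nonneg_nonneg) (auto simp: zero_le_even_power)

lemma has_integral_bump:
  assumes R: "0 < R"
  shows "(bump p R k has_integral 1) {0..R}"
proof -
  have "(bump p R k has_integral 1 / (R ^ (2 * p + 1) * half_beta p (2 * k)) * (R ^ (2 * p + 1) * half_beta p (2 * k))) {0..R}"
    unfolding bump_def[abs_def] by (intro has_integral_mult_right has_integral_half_beta_scaled R)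
  moreover have "R ^ (2 * p + 1) * half_beta p (2 * k) \<noteq> 0"
    using R half_beta_pos[of p "2 * k"] by simp
  ultimately show ?thesis by simp
qed

lemma has_integral_bump_moment:
  assumes R: "0 < R"
  shows "((\<lambda>t. bump p R k t * (R\<^sup>2 - t\<^sup>2)) has_integral R\<^sup>2 * (2 * real (Suc p) / real (2 * k + 2 * p + 3))) {0..R}"
proof -
  define N where "N = R ^ (2 * p + 1) * half_beta p (2 * k)"
  have N: "N \<noteq> 0" using R half_beta_pos[of p "2 * k"] by (simp add: N_def)
  have "((\<lambda>t. 1 / N * ((R\<^sup>2 - t\<^sup>2) ^ Suc p * (t / R) ^ (2 * k))) has_integral 1 / N * (R ^ (2 * Suc p + 1) * half_beta (Suc p) (2 * k))) {0..R}"
    by (intro has_integral_mult_right has_integral_half_beta_scaled R)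
  moreover have "R ^ (2 * Suc p + 1) * half_beta (Suc p) (2 * k) = N * (R\<^sup>2 * (2 * real (Suc p) / real (2 * k + 2 * p + 3)))"
    unfolding half_beta_Suc_ratio N_def by (simp add: power2_eq_square mult_ac del: of_nat_Suc)
  moreover have "1 / N * ((R\<^sup>2 - t\<^sup>2) ^ Suc p * (t / R) ^ (2 * k)) = bump p R k t * (R\<^sup>2 - t\<^sup>2)" for t
    by (simp add: bump_def N_def mult_ac)
  ultimately show ?thesis using N by simp
qed

text \<open>Folding at \<open>0\<close> by evenness reduces the error on each side to
  \<open>L * (R - t)\<close>, which is at most \<open>L * (R\<^sup>2 - t\<^sup>2) / R\<close>; the
  mean of the latter under the bump is an explicit moment of order \<open>1 / k\<close>.\<close>

lemma bump_concentrates: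
  fixes V :: "real \<Rightarrow> real"
  assumes R: "0 < R" and V: "continuous_on {-R..R} V"
    and lip: "\<And>s t. \<bar>s\<bar> \<le> R \<Longrightarrow> \<bar>t\<bar> \<le> R \<Longrightarrow> \<bar>V s - V t\<bar> \<le> L * \<bar>s - t\<bar>" and L: "0 \<le> L"
  shows "\<bar>integral {-R..R} (\<lambda>t. bump p R k t * V t) - (V R + V (- R))\<bar> \<le> 4 * L * R * real (Suc p) / real (2 * k + 1)"
proof -
  define D where "D = bump p R k"
  have D: "continuous_on S D" for S unfolding D_def using R by (intro continuous_on_bump) simp
  have V1: "continuous_on {0..R} V" and V2: "continuous_on {0..R} (\<lambda>t. V (- t))"
    using R by (auto intro!: continuous_on_subset[OF V] continuous_on_compose2[OF V] continuous_intros)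
  have int: "(\<lambda>t. D t * V t) integrable_on {-R..R}"
    by (intro integrable_continuous_real continuous_intros D V)
  have i1: "(\<lambda>t. D t * V t) integrable_on {0..R}" and i2: "(\<lambda>t. D t * V (- t)) integrable_on {0..R}"
    and i3: "(\<lambda>t. D t * (V R + V (- R))) integrable_on {0..R}"
    by (intro integrable_continuous_real continuous_intros D V1 V2)+
  have "integral {-R..R} (\<lambda>t. D t * V t) = integral {-R..0} (\<lambda>t. D t * V t) + integral {0..R} (\<lambda>t. D t * V t)"
    using R int by (intro Henstock_Kurzweil_Integration.integral_combine[symmetric]) auto
  also have "integral {-R..0} (\<lambda>t. D t * V t) = integral {0..R} (\<lambda>t. D t * V (- t))"
    using Henstock_Kurzweil_Integration.integral_reflect_real[of R 0 "\<lambda>t. D t * V (- t)"]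
    by (simp add: D_def bump_even)
  finally have fold: "integral {-R..R} (\<lambda>t. D t * V t) = integral {0..R} (\<lambda>t. D t * V t + D t * V (- t))"
    using i1 i2 by (simp add: Henstock_Kurzweil_Integration.integral_add)
  have "integral {0..R} (\<lambda>t. D t * (V R + V (- R))) = 1 * (V R + V (- R))"
    unfolding D_def by (rule integral_unique[OF has_integral_mult_left[OF has_integral_bump[OF R]]])
  then have diff: "integral {-R..R} (\<lambda>t. D t * V t) - (V R + V (- R))
      = integral {0..R} (\<lambda>t. D t * V t + D t * V (- t) - D t * (V R + V (- R)))"
    unfolding fold Henstock_Kurzweil_Integration.integral_diff[OF integrable_add[OF i1 i2] i3] by (simp only: mult_1)
  have "\<bar>integral {-R..R} (\<lambda>t. D t * V t) - (V R + V (- R))\<bar> \<le> integral {0..R} (\<lambda>t. 2 * L / R * (D t * (R\<^sup>2 - t\<^sup>2)))"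
    unfolding diff
  proof (rule integral_norm_bound_integral[where 'a = real, unfolded real_norm_def])
    show "(\<lambda>t. D t * V t + D t * V (- t) - D t * (V R + V (- R))) integrable_on {0..R}"
      by (intro integrable_diff integrable_add i1 i2 i3)
    show "(\<lambda>t. 2 * L / R * (D t * (R\<^sup>2 - t\<^sup>2))) integrable_on {0..R}"
      by (intro integrable_continuous_real continuous_intros D)
    fix t assume t: "t \<in> {0..R}"
    have D0: "0 \<le> D t" using t R by (simp add: D_def bump_nonneg)
    have "\<bar>V t - V R + (V (- t) - V (- R))\<bar> \<le> 2 * L * (R - t)"
    proof -
      have "\<bar>V t - V R\<bar> \<le> L * (R - t)" using lip[of t R] t by simp
      moreover have "\<bar>V (- t) - V (- R)\<bar> \<le> L * (R - t)" using lip[of "- t" "- R"] t by simp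
      ultimately show ?thesis by linarith
    qed
    also have "\<dots> \<le> 2 * L / R * (R\<^sup>2 - t\<^sup>2)"
    proof -
      have "(R - t) * R \<le> (R - t) * (R + t)" using t by (intro mult_left_mono) auto
      then have "(R - t) * R \<le> R\<^sup>2 - t\<^sup>2" by (simp add: power2_eq_square algebra_simps)
      then have "R - t \<le> (R\<^sup>2 - t\<^sup>2) / R" using R by (simp add: field_simps)
      from mult_left_mono[OF this, of "2 * L"] L show ?thesis by simp
    qed
    finally have "D t * \<bar>V t - V R + (V (- t) - V (- R))\<bar> \<le> D t * (2 * L / R * (R\<^sup>2 - t\<^sup>2))"
      by (rule mult_left_mono[OF _ D0])
    moreover have "D t * V t + D t * V (- t) - D t * (V R + V (- R)) = D t * (V t - V R + (V (- t) - V (- R)))"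
      by (simp add: algebra_simps)
    ultimately show "\<bar>D t * V t + D t * V (- t) - D t * (V R + V (- R))\<bar> \<le> 2 * L / R * (D t * (R\<^sup>2 - t\<^sup>2))"
      using D0 by (simp add: abs_mult mult_ac)
  qed
  also have "\<dots> = 2 * L / R * (R\<^sup>2 * (2 * real (Suc p) / real (2 * k + 2 * p + 3)))"
    unfolding D_def by (intro integral_unique has_integral_mult_right has_integral_bump_moment R)
  also have "\<dots> = 4 * L * R * real (Suc p) / real (2 * k + 2 * p + 3)"
    using R by (simp add: power2_eq_square mult_ac del: of_nat_Suc of_nat_add)
  also have "\<dots> \<le> 4 * L * R * real (Suc p) / real (2 * k + 1)"
    using L R by (intro divide_left_mono mult_nonneg_nonneg mult_pos_pos) simp_all
  finally show ?thesis by (simp add: D_def)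
qed

text \<open>Bernoulli's inequality bounds the deviation of the cutoff from \<open>1\<close> by
  \<open>p * (t / R) ^ (2 * k)\<close>, whose integral is of order \<open>1 / k\<close>.\<close>

lemma cutoff_close:
  fixes g :: "real \<Rightarrow> real"
  assumes R: "0 < R" and g: "continuous_on {-R..R} g" "\<And>t. \<bar>t\<bar> \<le> R \<Longrightarrow> \<bar>g t\<bar> \<le> C"
  shows "\<bar>integral {-R..R} (\<lambda>t. (1 - (t / R) ^ (2 * k)) ^ p * g t) - integral {-R..R} g\<bar> \<le> C * real p * (2 * R / real (2 * k + 1))"
proof -
  have i1: "(\<lambda>t. (1 - (t / R) ^ (2 * k)) ^ p * g t) integrable_on {-R..R}" and i2: "g integrable_on {-R..R}"
    using R by (intro integrable_continuous_real continuous_intros g; simp)+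
  have "((\<lambda>t. (t / R) ^ (2 * k)) has_integral 2 * (R / real (2 * k + 1))) {-R..R}"
  proof (rule has_integral_even_Icc)
    show "((\<lambda>t. (t / R) ^ (2 * k)) has_integral R / real (2 * k + 1)) {0..R}"
      using has_integral_half_beta_scaled[OF R, of 0 "2 * k"] by (simp add: half_beta_def)
  qed (use R in simp_all)
  then have pow: "((\<lambda>t. C * real p * (t / R) ^ (2 * k)) has_integral C * real p * (2 * (R / real (2 * k + 1)))) {-R..R}"
    by (rule has_integral_mult_right)
  have "\<bar>integral {-R..R} (\<lambda>t. (1 - (t / R) ^ (2 * k)) ^ p * g t - g t)\<bar> \<le> integral {-R..R} (\<lambda>t. C * real p * (t / R) ^ (2 * k))"
  proof (rule integral_norm_bound_integral[where 'a = real, unfolded real_norm_def])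
    show "(\<lambda>t. (1 - (t / R) ^ (2 * k)) ^ p * g t - g t) integrable_on {-R..R}" by (intro integrable_diff i1 i2)
    show "(\<lambda>t. C * real p * (t / R) ^ (2 * k)) integrable_on {-R..R}" using pow by blast
    fix t assume t: "t \<in> {-R..R}"
    define x where "x = (t / R) ^ (2 * k)"
    have x: "0 \<le> x" "x \<le> 1"
    proof -
      have "\<bar>t / R\<bar> \<le> 1" using t R by (simp add: abs_le_iff divide_simps)
      then have "(t / R)\<^sup>2 \<le> 1" by (simp add: abs_square_le_1)
      then show "x \<le> 1" unfolding x_def power_mult by (intro power_le_one[of "(t / R)\<^sup>2"]) simp_all
      show "0 \<le> x" unfolding x_def by (rule zero_le_even_power) simp
    qed
    have "1 - real p * x \<le> (1 - x) ^ p" using Bernoulli_inequality[of "- x" p] x by simp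
    moreover have "(1 - x) ^ p \<le> 1" using x by (intro power_le_one) auto
    ultimately have "\<bar>(1 - x) ^ p - 1\<bar> \<le> real p * x" by (simp add: abs_if)
    moreover have "\<bar>g t\<bar> \<le> C" using g(2) t by (auto simp: abs_le_iff)
    ultimately have "\<bar>(1 - x) ^ p - 1\<bar> * \<bar>g t\<bar> \<le> real p * x * C"
      using x by (intro mult_mono) auto
    moreover have "(1 - x) ^ p * g t - g t = ((1 - x) ^ p - 1) * g t"
      by (simp add: left_diff_distrib)
    ultimately show "\<bar>(1 - (t / R) ^ (2 * k)) ^ p * g t - g t\<bar> \<le> C * real p * (t / R) ^ (2 * k)"
      unfolding x_def[symmetric] by (simp add: abs_mult mult_ac)
  qed
  then show ?thesis
    using i1 i2 integral_unique[OF pow] by (simp add: Henstock_Kurzweil_Integration.integral_diff)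
qed

text \<open>The profile is \<open>q\<close> times a cutoff of order \<open>p\<close> at the
  endpoints, plus \<open>\<beta>\<close> times a bump. Both are polynomials in
  \<open>R\<^sup>2 - t\<^sup>2\<close> divisible by its \<open>p\<close>-th power, and their errors
  are of order \<open>1 / k\<close> against bounded Lipschitz functions, uniformly over the
  translates of the kernel.\<close>

lemma profile_exists:
  assumes R: "0 < R"
    and b: "\<And>j. j \<le> p \<Longrightarrow> (\<Sum>k\<le>Suc p. b k * chi (k + j) R) = 0"
    and norm: "2 * coeff (qpoly p R b) (2 * p) * ell_moment p (2 * p) = 1"
    and e: "0 < e"
  defines "\<beta> \<equiv> - b 0 / R"
  defines "q \<equiv> poly (qpoly p R b)"
  shows "\<exists>F. (\<forall>c. \<bar>c\<bar> \<le> R \<longrightarrow> \<bar>(\<integral>t. tpoly (proj_poly p F) (R\<^sup>2 - t\<^sup>2) * phi p \<bar>c - t\<bar> \<partial>lborel) - 1\<bar> \<le> e) \<and>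
        \<bar>(\<integral>t. tpoly (proj_poly p F) (R\<^sup>2 - t\<^sup>2) \<partial>lborel) - (integral {-R..R} q + 2 * \<beta>)\<bar> \<le> e \<and>
        (\<integral>t. \<bar>tpoly (proj_poly p F) (R\<^sup>2 - t\<^sup>2)\<bar> \<partial>lborel) \<le> integral {-R..R} (\<lambda>t. \<bar>q t\<bar>) + 2 * \<bar>\<beta>\<bar>"
proof -
  have q_cont: "continuous_on S q" for S unfolding q_def by (intro continuous_intros)
  have q_even: "q (- t) = q t" for t by (simp add: q_def poly_qpoly)
  have "bounded (q ` {-R..R})"
    by (intro compact_imp_bounded compact_continuous_image q_cont compact_Icc)
  then obtain Cq where "\<forall>x\<in>q ` {-R..R}. \<bar>x\<bar> \<le> Cq"
    unfolding bounded_real by blast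
  then have Cq: "\<bar>q t\<bar> \<le> Cq" if "\<bar>t\<bar> \<le> R" for t
    using that by (auto simp: abs_le_iff)
  have Cq0: "0 \<le> Cq" using Cq[of 0] R by simp
  obtain D where D: "\<And>t. 0 \<le> t \<Longrightarrow> \<bar>phi p t\<bar> \<le> D" using phi_bounded by blast
  have D0: "0 \<le> D" using D[of 0] by linarith
  obtain L where L: "0 \<le> L" "\<And>s t. 0 \<le> s \<Longrightarrow> 0 \<le> t \<Longrightarrow> \<bar>phi p s - phi p t\<bar> \<le> L * \<bar>s - t\<bar>"
    using phi_lipschitz by metis
  \<comment> \<open>The error constants of cutoff and bump. The bound \<open>D + 1\<close> serves
    both test functions: the kernel, bounded by \<open>D\<close>, and the constant \<open>1\<close>
    used for the mass.\<close>
  define K where "K = Cq * (D + 1) * real p * (2 * R) + \<bar>\<beta>\<bar> * (4 * L * R * real (Suc p))"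
  have "0 \<le> K" unfolding K_def using Cq0 D0 L(1) R by simp
  obtain k0 :: nat where k0: "K / e < real k0" using reals_Archimedean2 by blast
  define k where "k = Suc k0"
  have "K / e \<le> real (2 * k + 1)" using k0 by (simp add: k_def)
  then have Ke: "K / real (2 * k + 1) \<le> e" using e by (simp add: field_simps)
  have split_le: "Cq * D' * real p * (2 * R / real (2 * k + 1)) + \<bar>\<beta>\<bar> * (4 * L' * R * real (Suc p) / real (2 * k + 1)) \<le> e"
    if "D' \<le> D + 1" "L' \<le> L" for D' L'
  proof -
    have "Cq * D' * real p * (2 * R) \<le> Cq * (D + 1) * real p * (2 * R)"
      using that(1) Cq0 R by (intro mult_right_mono mult_left_mono) auto
    moreover have "\<bar>\<beta>\<bar> * (4 * L' * R * real (Suc p)) \<le> \<bar>\<beta>\<bar> * (4 * L * R * real (Suc p))"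
      using that(2) R by (intro mult_right_mono mult_left_mono) auto
    ultimately have "(Cq * D' * real p * (2 * R) + \<bar>\<beta>\<bar> * (4 * L' * R * real (Suc p))) / real (2 * k + 1) \<le> K / real (2 * k + 1)"
      unfolding K_def by (intro divide_right_mono add_mono) auto
    then show ?thesis using Ke by (simp add: add_divide_distrib)
  qed

  \<comment> \<open>At \<open>R\<^sup>2 - t\<^sup>2\<close> this takes the value
    \<open>(t / R)\<^sup>2\<close>. As \<open>Y\<close> is \<open>1\<close> at \<open>0\<close>, the
    factor \<open>(1 - Y ^ k) ^ p\<close> supplies the required divisibility.\<close>
  define Y where "Y = [:1, - 1 / R\<^sup>2:]"
  define N where "N = R ^ (2 * p + 1) * half_beta p (2 * k)"
  define W where "W = pcompose (qbase p b) [:0, - 1:] * (1 - Y ^ k) ^ p + smult (\<beta> / N) (monom 1 p * Y ^ k)"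
  define w where "w t = (1 - (t / R) ^ (2 * k)) ^ p * q t + \<beta> * bump p R k t" for t
  have "[:0, 1:] dvd 1 - Y ^ k"
    using poly_eq_0_iff_dvd[of "1 - Y ^ k" 0] by (simp add: Y_def)
  then have "monom 1 p dvd (1 - Y ^ k) ^ p"
    by (simp add: monom_altdef dvd_power_same)
  then have "monom 1 p dvd W"
    unfolding W_def by (intro dvd_add dvd_mult dvd_smult dvd_triv_left)
  then obtain F where F: "proj_poly p F = W" using proj_poly_surj by blast
  have polyW: "poly W (R\<^sup>2 - t\<^sup>2) = w t" for t
  proof -
    have Y: "poly Y (R\<^sup>2 - t\<^sup>2) = (t / R)\<^sup>2" using R by (simp add: Y_def field_simps)
    have "poly (pcompose (qbase p b) [:0, - 1:]) (R\<^sup>2 - t\<^sup>2) = q t"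
      by (simp add: poly_pcompose q_def poly_qpoly)
    moreover have "poly ((1 - Y ^ k) ^ p) (R\<^sup>2 - t\<^sup>2) = (1 - (t / R) ^ (2 * k)) ^ p"
      by (simp add: poly_power Y power_mult)
    moreover have "poly (smult (\<beta> / N) (monom 1 p * Y ^ k)) (R\<^sup>2 - t\<^sup>2) = \<beta> * bump p R k t"
      by (simp add: poly_power Y power_mult bump_def N_def poly_monom)
    ultimately show ?thesis unfolding W_def w_def poly_add poly_mult by (simp only: mult.commute)
  qed
  have tp: "tpoly (proj_poly p F) (R\<^sup>2 - t\<^sup>2) = indicator {-R..R} t * w t" for t
    unfolding F tpoly_Icc[OF R] polyW ..
  have bump_cont: "continuous_on S (bump p R k)" for S using R by (intro continuous_on_bump) simp
  have w_cont: "continuous_on S w" for S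
    unfolding w_def using R by (intro continuous_intros q_cont bump_cont) simp
  have key: "\<bar>integral {-R..R} (\<lambda>t. w t * V t) - (integral {-R..R} (\<lambda>t. q t * V t) + \<beta> * (V R + V (- R)))\<bar> \<le> e"
    if V: "continuous_on {-R..R} V" "\<And>t. \<bar>t\<bar> \<le> R \<Longrightarrow> \<bar>V t\<bar> \<le> D'"
      "\<And>s t. \<bar>s\<bar> \<le> R \<Longrightarrow> \<bar>t\<bar> \<le> R \<Longrightarrow> \<bar>V s - V t\<bar> \<le> L' * \<bar>s - t\<bar>" "0 \<le> L'" "D' \<le> D + 1" "L' \<le> L" for V D' L'
  proof -
    have "integral {-R..R} (\<lambda>t. w t * V t) = integral {-R..R} (\<lambda>t. (1 - (t / R) ^ (2 * k)) ^ p * (q t * V t) + \<beta> * (bump p R k t * V t))"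
      by (simp add: w_def distrib_right mult.assoc)
    also have "\<dots> = integral {-R..R} (\<lambda>t. (1 - (t / R) ^ (2 * k)) ^ p * (q t * V t)) + integral {-R..R} (\<lambda>t. \<beta> * (bump p R k t * V t))"
      using R by (intro Henstock_Kurzweil_Integration.integral_add integrable_continuous_real continuous_intros q_cont bump_cont V(1)) simp
    finally have "integral {-R..R} (\<lambda>t. w t * V t) = integral {-R..R} (\<lambda>t. (1 - (t / R) ^ (2 * k)) ^ p * (q t * V t)) + \<beta> * integral {-R..R} (\<lambda>t. bump p R k t * V t)"
      by simp
    moreover have "\<bar>integral {-R..R} (\<lambda>t. (1 - (t / R) ^ (2 * k)) ^ p * (q t * V t)) - integral {-R..R} (\<lambda>t. q t * V t)\<bar>
        \<le> Cq * D' * real p * (2 * R / real (2 * k + 1))"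
    proof (rule cutoff_close[OF R])
      show "\<bar>q t * V t\<bar> \<le> Cq * D'" if "\<bar>t\<bar> \<le> R" for t
        unfolding abs_mult by (intro mult_mono Cq V(2) that Cq0) simp
    qed (intro continuous_intros q_cont V(1))
    moreover have "\<bar>\<beta> * integral {-R..R} (\<lambda>t. bump p R k t * V t) - \<beta> * (V R + V (- R))\<bar> \<le> \<bar>\<beta>\<bar> * (4 * L' * R * real (Suc p) / real (2 * k + 1))"
      unfolding right_diff_distrib[symmetric] abs_mult
      by (intro mult_left_mono bump_concentrates[OF R V(1) V(3) V(4)]) simp_all
    ultimately show ?thesis using split_le[OF V(5,6)] by linarith
  qed
  have pot: "\<bar>(\<integral>t. tpoly (proj_poly p F) (R\<^sup>2 - t\<^sup>2) * phi p \<bar>c - t\<bar> \<partial>lborel) - 1\<bar> \<le> e" if c: "\<bar>c\<bar> \<le> R" for c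
  proof -
    define V where "V t = phi p \<bar>c - t\<bar>" for t
    have phi_cont: "continuous_on UNIV (phi p)"
      unfolding phi_def[abs_def] by (intro continuous_intros)
    have V_cont: "continuous_on S V" for S
      unfolding V_def by (intro continuous_on_compose2[OF phi_cont] continuous_intros) simp
    have "(\<integral>t. tpoly (proj_poly p F) (R\<^sup>2 - t\<^sup>2) * phi p \<bar>c - t\<bar> \<partial>lborel) = integral {-R..R} (\<lambda>t. w t * V t)"
      unfolding tp mult.assoc V_def[symmetric] by (intro integral_Icc_lborel continuous_intros w_cont V_cont)
    moreover have "integral {-R..R} (\<lambda>t. q t * V t) + \<beta> * (V R + V (- R)) = 1"
    proof -
      have "((\<lambda>s. phi p \<bar>c - s\<bar> * poly (qpoly p R b) s) has_integral
        (2 * coeff (qpoly p R b) (2 * p) * ell_moment p (2 * p) - \<beta> * (phi p (R - c) + phi p (R + c)))) {-R..R}"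
      proof (rule has_integral_phi_even[OF R c])
        show "degree (qpoly p R b) \<le> 2 * p"
        proof -
          have "degree (upow R i) \<le> 2 * p" if "i \<le> p" for i
          proof -
            have "degree ([:- R\<^sup>2, 0, 1:] ^ i) \<le> degree [:- R\<^sup>2, 0, 1:] * i" by (rule degree_power_le)
            then show ?thesis using that unfolding upow_def by simp
          qed
          then show ?thesis
            unfolding qpoly_def by (intro degree_sum_le) (auto intro: order_trans[OF degree_smult_le])
        qed
        show "poly (lap (f * qpoly p R b)) R = \<beta> * poly f R" if "degree f \<le> p" for f
          unfolding \<beta>_def by (rule lap_mult_qpoly[OF _ b that]) (use R in simp_all)
      qed (use q_even in \<open>simp add: q_def\<close>)
      then have "integral {-R..R} (\<lambda>t. q t * V t) = 1 - \<beta> * (phi p (R - c) + phi p (R + c))"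
        unfolding norm by (simp add: integral_unique q_def V_def mult.commute)
      moreover have "V R = phi p (R - c)" "V (- R) = phi p (R + c)"
      proof -
        have "\<bar>c - R\<bar> = R - c" "\<bar>c - - R\<bar> = R + c" using c by linarith+
        then show "V R = phi p (R - c)" "V (- R) = phi p (R + c)" by (simp_all only: V_def)
      qed
      ultimately show ?thesis by simp
    qed
    moreover have "\<bar>integral {-R..R} (\<lambda>t. w t * V t) - (integral {-R..R} (\<lambda>t. q t * V t) + \<beta> * (V R + V (- R)))\<bar> \<le> e"
    proof (rule key[OF V_cont, of D L])
      show "\<bar>V s - V t\<bar> \<le> L * \<bar>s - t\<bar>" for s t
      proof -
        have "\<bar>V s - V t\<bar> \<le> L * \<bar>\<bar>c - s\<bar> - \<bar>c - t\<bar>\<bar>" unfolding V_def by (rule L(2)) simp_all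
        also have "\<dots> \<le> L * \<bar>s - t\<bar>" using L(1) by (intro mult_left_mono) auto
        finally show ?thesis .
      qed
    qed (use L(1) in \<open>simp_all add: V_def D\<close>)
    ultimately show ?thesis by simp
  qed
  have mass: "\<bar>(\<integral>t. tpoly (proj_poly p F) (R\<^sup>2 - t\<^sup>2) \<partial>lborel) - (integral {-R..R} q + 2 * \<beta>)\<bar> \<le> e"
  proof -
    have "(\<integral>t. tpoly (proj_poly p F) (R\<^sup>2 - t\<^sup>2) \<partial>lborel) = integral {-R..R} w"
      unfolding tp by (intro integral_Icc_lborel w_cont)
    moreover have "\<bar>integral {-R..R} (\<lambda>t. w t * 1) - (integral {-R..R} (\<lambda>t. q t * 1) + \<beta> * (1 + 1))\<bar> \<le> e"
      by (rule key[of "\<lambda>_. 1" 1 0]) (use D0 L(1) in simp_all)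
    ultimately show ?thesis by (simp add: mult.commute)
  qed
  have tv: "(\<integral>t. \<bar>tpoly (proj_poly p F) (R\<^sup>2 - t\<^sup>2)\<bar> \<partial>lborel) \<le> integral {-R..R} (\<lambda>t. \<bar>q t\<bar>) + 2 * \<bar>\<beta>\<bar>"
  proof -
    have "(\<integral>t. \<bar>tpoly (proj_poly p F) (R\<^sup>2 - t\<^sup>2)\<bar> \<partial>lborel) = integral {-R..R} (\<lambda>t. \<bar>w t\<bar>)"
      unfolding tp abs_mult abs_indicator by (intro integral_Icc_lborel continuous_intros w_cont)
    also have "\<dots> \<le> integral {-R..R} (\<lambda>t. \<bar>q t\<bar> + \<bar>\<beta>\<bar> * bump p R k t)"
    proof (rule Henstock_Kurzweil_Integration.integral_le)
      fix t assume t: "t \<in> {-R..R}"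
      then have tR: "\<bar>t\<bar> \<le> R" by auto
      have "\<bar>t / R\<bar> \<le> 1" using tR R by (simp add: divide_simps)
      then have "(t / R)\<^sup>2 \<le> 1" by (simp add: abs_square_le_1)
      then have "(t / R) ^ (2 * k) \<le> 1" "0 \<le> (t / R) ^ (2 * k)"
        unfolding power_mult by (auto intro: power_le_one[of "(t / R)\<^sup>2"])
      then have "0 \<le> (1 - (t / R) ^ (2 * k)) ^ p" "(1 - (t / R) ^ (2 * k)) ^ p \<le> 1"
        by (auto intro: power_le_one)
      then have "\<bar>(1 - (t / R) ^ (2 * k)) ^ p * q t\<bar> \<le> \<bar>q t\<bar>"
        unfolding abs_mult by (intro mult_left_le_one_le) auto
      moreover have "\<bar>\<beta> * bump p R k t\<bar> = \<bar>\<beta>\<bar> * bump p R k t"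
        using bump_nonneg[OF R tR] by (simp add: abs_mult)
      ultimately show "\<bar>w t\<bar> \<le> \<bar>q t\<bar> + \<bar>\<beta>\<bar> * bump p R k t" unfolding w_def by linarith
    qed (intro integrable_continuous_real continuous_intros w_cont q_cont bump_cont)+
    also have "\<dots> = integral {-R..R} (\<lambda>t. \<bar>q t\<bar>) + \<bar>\<beta>\<bar> * integral {-R..R} (bump p R k)"
      by (subst Henstock_Kurzweil_Integration.integral_add)
        (auto intro!: integrable_continuous_real continuous_intros q_cont bump_cont)
    also have "integral {-R..R} (bump p R k) = 2 * 1"
      by (intro integral_unique has_integral_even_Icc has_integral_bump bump_even) (use R in simp_all)
    finally show ?thesis by (simp add: mult.commute)
  qed
  show ?thesis using pot mass tv by blast
qed

section \<open>Hankel determinants\<close>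

lemma det_sq_eq_det: "det_sq n M = Determinant.det (Matrix.mat n n (\<lambda>(i, j). M i j))"
proof -
  have "(\<Prod>i<n. M i (\<sigma> i)) = (\<Prod>i = 0..<n. Matrix.mat n n (\<lambda>(i, j). M i j) $$ (i, \<sigma> i))"
    if "\<sigma> permutes {..<n}" for \<sigma>
    unfolding atLeast0LessThan[symmetric]
    using permutes_in_image[OF that] by (intro prod.cong) auto
  then show ?thesis
    by (auto simp: det_sq_def Determinant.det_def atLeast0LessThan intro!: sum.cong)
qed

lemma det_lower_triangular_mat:
  assumes "\<And>i j. i < j \<Longrightarrow> j < n \<Longrightarrow> f i j = 0"
  shows "Determinant.det (Matrix.mat n n (\<lambda>(i, j). f i j)) = (\<Prod>i<n. f i i :: real)"
proof -
  have "Determinant.det (Matrix.mat n n (\<lambda>(i, j). f i j)) = prod_list (diag_mat (Matrix.mat n n (\<lambda>(i, j). f i j)))"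
    using assms by (intro det_lower_triangular[of n]) auto
  then show ?thesis by (simp add: prod_list_diag_prod atLeast0LessThan)
qed

lemma mat_mult_mat:
  "Matrix.mat n n (\<lambda>(i, j). f i j) * Matrix.mat n n (\<lambda>(i, j). g i j)
    = Matrix.mat n n (\<lambda>(i, j). \<Sum>k<n. f i k * g k j :: real)"
  by (rule eq_matI) (simp_all add: scalar_prod_def atLeast0LessThan)

lemma chi_recurrence: "R\<^sup>2 * chi (i + j) R + real (2 * i + 1) * chi (Suc i + j) R = chi (i + j + 2) R - 2 * real j * chi (i + j + 1) R"
  by (simp add: algebra_simps)

text \<open>Up to the factor \<open>- 2 / R\<close>, \<open>tau R (Suc i)\<close> is the integral of
  \<open>upow R i\<close> over \<open>[-R, R]\<close>, and \<open>tau R 0\<close> accounts for the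
  point masses. The sequence is annihilated by the left-hand side of the recurrence for
  \<open>chi\<close>, and the row operations on the bordered matrix exploit this.\<close>

definition tau :: "real \<Rightarrow> nat \<Rightarrow> real" where
  "tau R k = (- R\<^sup>2) ^ k / (\<Prod>l<k. real (2 * l + 1))"

lemma tau_0 [simp]: "tau R 0 = 1"
  by (simp add: tau_def)

lemma tau_recurrence: "R\<^sup>2 * tau R i + real (2 * i + 1) * tau R (Suc i) = 0"
proof -
  define d where "d = (\<Prod>l<i. real (2 * l + 1))"
  have "d > 0" by (auto simp: d_def intro!: prod_pos)
  moreover have "tau R i = (- R\<^sup>2) ^ i / d" "tau R (Suc i) = (- R\<^sup>2) ^ i * - R\<^sup>2 / (d * real (2 * i + 1))"
    by (simp_all add: tau_def d_def mult.commute)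
  moreover have "r * (a / d) + c * (a * - r / (d * c)) = 0" if "d > 0" "c > 0" for a c d r :: real
    using that by (simp add: field_simps)
  ultimately show ?thesis by simp
qed

text \<open>The last column holds the functional giving the total mass, so one set of cofactors
  yields both the solution of the Hankel system and its mass.\<close>

definition bordered :: "nat \<Rightarrow> real \<Rightarrow> nat \<Rightarrow> nat \<Rightarrow> real" where
  "bordered p R i j = (if j \<le> p then chi (i + j) R else tau R i)"

text \<open>Replacing row \<open>i + 1\<close> by \<open>R\<^sup>2\<close> times row \<open>i\<close> plus \<open>2 i + 1\<close> times row \<open>i + 1\<close> clears the
  last column, and by the recurrence the remaining block differs from the shifted Hankel matrix by
  unitriangular column operations.\<close>
lemma det_bordered:
  "(\<Prod>i\<le>p. real (2 * i + 1)) * det_sq (p + 2) (bordered p R)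
    = (-1) ^ (p + 1) * det_sq (p + 1) (\<lambda>i j. chi (i + j + 2) R)"
proof -
  define n where "n = p + 2"
  define P where "P i k = (if i = 0 then (if k = 0 then 1 else 0) else if k = i then real (2 * (i - 1) + 1)
      else if Suc k = i then R\<^sup>2 else 0)" for i k
  define T where "T i j = (if i = 0 then bordered p R 0 j else if j \<le> p
      then chi (i - 1 + j + 2) R - 2 * real j * chi (i - 1 + j + 1) R else 0)" for i j
  \<comment> \<open>The term \<open>2 * real j * chi (i + j + 1) R\<close> is a multiple of column
    \<open>j - 1\<close> of the shifted Hankel matrix, and it vanishes for
    \<open>j = 0\<close>.\<close>
  define U where "U k j = (if k = j then 1 else if Suc k = j then - 2 * real j else 0)" for k j :: nat
  have PB: "(\<Sum>k<n. P i k * bordered p R k j) = T i j" if "i < n" for i j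
  proof (cases i)
    case 0
    have "(\<Sum>k<n. P i k * bordered p R k j) = (\<Sum>k\<in>{0}. P i k * bordered p R k j)"
      using 0 by (intro sum.mono_neutral_right) (auto simp: P_def n_def)
    then show ?thesis using 0 by (simp add: P_def T_def)
  next
    case (Suc i')
    have "(\<Sum>k<n. P i k * bordered p R k j) = (\<Sum>k\<in>{i', Suc i'}. P i k * bordered p R k j)"
      using that Suc by (intro sum.mono_neutral_right) (auto simp: P_def)
    also have "\<dots> = R\<^sup>2 * bordered p R i' j + real (2 * i' + 1) * bordered p R (Suc i') j"
      using Suc by (simp add: P_def)
    also have "\<dots> = T i j"
      using Suc chi_recurrence[of R i' j] tau_recurrence[of R i'] by (simp add: bordered_def T_def del: chi.simps)
    finally show ?thesis .
  qed
  have detP: "Determinant.det (Matrix.mat n n (\<lambda>(i, j). P i j)) = (\<Prod>i\<le>p. real (2 * i + 1))"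
  proof -
    have "Determinant.det (Matrix.mat n n (\<lambda>(i, j). P i j)) = (\<Prod>i<n. P i i)"
      by (rule det_lower_triangular_mat) (auto simp: P_def)
    also have "\<dots> = (\<Prod>i<Suc p. P (Suc i) (Suc i))"
      unfolding n_def using prod.lessThan_Suc_shift[of "\<lambda>i. P i i" "Suc p"] by (simp add: P_def)
    finally show ?thesis by (simp add: P_def lessThan_Suc_atMost)
  qed
  have "(\<Prod>i\<le>p. real (2 * i + 1)) * det_sq n (bordered p R)
      = Determinant.det (Matrix.mat n n (\<lambda>(i, j). P i j) * Matrix.mat n n (\<lambda>(i, j). bordered p R i j))"
    unfolding det_sq_eq_det detP[symmetric] by (subst det_mult) auto
  also have "Matrix.mat n n (\<lambda>(i, j). P i j) * Matrix.mat n n (\<lambda>(i, j). bordered p R i j) = Matrix.mat n n (\<lambda>(i, j). T i j)"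
    unfolding mat_mult_mat by (rule eq_matI) (simp_all add: PB)
  also have "Determinant.det (Matrix.mat n n (\<lambda>(i, j). T i j))
      = (\<Sum>i<n. Matrix.mat n n (\<lambda>(i, j). T i j) $$ (i, p + 1) * cofactor (Matrix.mat n n (\<lambda>(i, j). T i j)) i (p + 1))"
    by (rule laplace_expansion_column) (simp_all add: n_def)
  also have "\<dots> = (\<Sum>i\<in>{0}. Matrix.mat n n (\<lambda>(i, j). T i j) $$ (i, p + 1) * cofactor (Matrix.mat n n (\<lambda>(i, j). T i j)) i (p + 1))"
    by (rule sum.mono_neutral_right) (auto simp: n_def T_def)
  also have "\<dots> = cofactor (Matrix.mat n n (\<lambda>(i, j). T i j)) 0 (p + 1)"
    by (simp add: n_def T_def bordered_def)
  also have "\<dots> = (-1) ^ (p + 1) * Determinant.det (mat_delete (Matrix.mat n n (\<lambda>(i, j). T i j)) 0 (p + 1))"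
    by (simp add: cofactor_def)
  also have "mat_delete (Matrix.mat n n (\<lambda>(i, j). T i j)) 0 (p + 1)
      = Matrix.mat (p + 1) (p + 1) (\<lambda>(i, j). \<Sum>k<p + 1. chi (i + k + 2) R * U k j)"
  proof (rule eq_matI)
    fix i j assume "i < dim_row (Matrix.mat (p + 1) (p + 1) (\<lambda>(i, j). \<Sum>k<p + 1. chi (i + k + 2) R * U k j))"
      "j < dim_col (Matrix.mat (p + 1) (p + 1) (\<lambda>(i, j). \<Sum>k<p + 1. chi (i + k + 2) R * U k j))"
    then have ij: "i < p + 1" "j < p + 1" by simp_all
    have "(\<Sum>k<p + 1. chi (i + k + 2) R * U k j) = chi (i + j + 2) R - 2 * real j * chi (i + j + 1) R"
    proof (cases j)
      case 0
      have "(\<Sum>k<p + 1. chi (i + k + 2) R * U k j) = (\<Sum>k\<in>{0}. chi (i + k + 2) R * U k j)"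
        using 0 by (intro sum.mono_neutral_right) (auto simp: U_def)
      then show ?thesis using 0 by (simp add: U_def del: chi.simps)
    next
      case (Suc j')
      have "(\<Sum>k<p + 1. chi (i + k + 2) R * U k j) = (\<Sum>k\<in>{j', Suc j'}. chi (i + k + 2) R * U k j)"
        using Suc ij by (intro sum.mono_neutral_right) (auto simp: U_def)
      also have "\<dots> = chi (i + j + 2) R - 2 * real j * chi (i + j + 1) R"
        using Suc by (simp add: U_def algebra_simps del: chi.simps)
      finally show ?thesis .
    qed
    then show "mat_delete (Matrix.mat n n (\<lambda>(i, j). T i j)) 0 (p + 1) $$ (i, j)
        = Matrix.mat (p + 1) (p + 1) (\<lambda>(i, j). \<Sum>k<p + 1. chi (i + k + 2) R * U k j) $$ (i, j)"
      using ij by (simp add: mat_delete_def n_def T_def del: chi.simps)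
  qed (simp_all add: n_def)
  also have "\<dots> = Matrix.mat (p + 1) (p + 1) (\<lambda>(i, j). chi (i + j + 2) R) * Matrix.mat (p + 1) (p + 1) (\<lambda>(i, j). U i j)"
    unfolding mat_mult_mat ..
  also have "Determinant.det \<dots> = det_sq (p + 1) (\<lambda>i j. chi (i + j + 2) R) * Determinant.det (Matrix.mat (p + 1) (p + 1) (\<lambda>(i, j). U i j))"
    unfolding det_sq_eq_det by (rule det_mult[of _ "p + 1"]) (rule mat_carrier)+
  also have "Determinant.det (Matrix.mat (p + 1) (p + 1) (\<lambda>(i, j). U i j)) = 1"
  proof -
    have "Determinant.det (Matrix.mat (p + 1) (p + 1) (\<lambda>(i, j). U i j)) = prod_list (diag_mat (Matrix.mat (p + 1) (p + 1) (\<lambda>(i, j). U i j)))"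
      by (rule det_upper_triangular[of _ "p + 1"]) (auto simp: upper_triangular_def U_def)
    then show ?thesis by (simp add: prod_list_diag_prod U_def)
  qed
  finally show ?thesis by (simp add: n_def)
qed

lemma det_sq_nonzero:
  assumes "\<And>v. (\<And>i. i < n \<Longrightarrow> (\<Sum>j<n. M i j * v j) = 0) \<Longrightarrow> \<forall>j<n. v j = 0"
  shows "det_sq n M \<noteq> 0"
proof
  define A where "A = Matrix.mat n n (\<lambda>(i, j). M i j)"
  assume "det_sq n M = 0"
  then have "Determinant.det A = 0" by (simp add: det_sq_eq_det A_def)
  then obtain w where w: "w \<in> carrier_vec n" "w \<noteq> 0\<^sub>v n" "A *\<^sub>v w = 0\<^sub>v n"
    using det_0_iff_vec_prod_zero[of A n] by (auto simp: A_def)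
  have "(\<Sum>j<n. M i j * vec_index w j) = 0" if "i < n" for i
  proof -
    have "vec_index (A *\<^sub>v w) i = 0" using w(3) that by simp
    then show ?thesis using that w(1) by (simp add: A_def scalar_prod_def atLeast0LessThan)
  qed
  then have "\<forall>j<n. vec_index w j = 0" by (rule assms)
  then have "w = 0\<^sub>v n" using w(1) by (intro eq_vecI) auto
  with w(2) show False by simp
qed

text \<open>The coefficients are cofactors along the last column, as in Cramer's rule.\<close>
lemma hankel_solution:
  assumes H: "det_sq (p + 1) (\<lambda>i j. chi (i + j) R) \<noteq> 0"
  shows "\<exists>b. b (Suc p) = c \<and> (\<forall>j\<le>p. (\<Sum>k\<le>Suc p. b k * chi (k + j) R) = 0) \<and>
    (\<Sum>k\<le>Suc p. b k * tau R k) = c * (-1) ^ (p + 1) * det_sq (p + 1) (\<lambda>i j. chi (i + j + 2) R)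
      / ((\<Prod>i\<le>p. real (2 * i + 1)) * det_sq (p + 1) (\<lambda>i j. chi (i + j) R))"
proof -
  define A where "A = Matrix.mat (p + 2) (p + 2) (\<lambda>(i, j). bordered p R i j)"
  have A: "A \<in> carrier_mat (p + 2) (p + 2)" by (simp add: A_def)
  define h where "h = det_sq (p + 1) (\<lambda>i j. chi (i + j) R)"
  \<comment> \<open>The corner cofactor is the Hankel determinant \<open>h\<close>, so this scaling
    gives \<open>b (Suc p) = c\<close>. Pairing the cofactors with one of the other columns gives
    \<open>0\<close>.\<close>
  define b where "b k = c / h * cofactor A k (p + 1)" for k
  have adj: "(\<Sum>k<p + 2. cofactor A k (p + 1) * bordered p R k j) = (if j = p + 1 then Determinant.det A else 0)"
    if j: "j < p + 2" for j
  proof -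
    have "(adj_mat A * A) $$ (p + 1, j) = (\<Sum>k<p + 2. cofactor A k (p + 1) * bordered p R k j)"
      using j by (simp add: adj_mat_def A_def scalar_prod_def atLeast0LessThan)
    moreover have "(adj_mat A * A) $$ (p + 1, j) = (if j = p + 1 then Determinant.det A else 0)"
      unfolding adj_mat(3)[OF A] using j by simp
    ultimately show ?thesis by simp
  qed
  have sets: "{..Suc p} = {..<p + 2}" by auto
  have "mat_delete A (p + 1) (p + 1) = Matrix.mat (p + 1) (p + 1) (\<lambda>(i, j). chi (i + j) R)"
    by (rule eq_matI) (auto simp: mat_delete_def A_def bordered_def)
  then have "cofactor A (p + 1) (p + 1) = h"
    by (simp add: cofactor_def h_def det_sq_eq_det)
  then have "b (Suc p) = c" using H by (simp add: b_def h_def)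
  moreover have "(\<Sum>k\<le>Suc p. b k * chi (k + j) R) = 0" if "j \<le> p" for j
  proof -
    have "(\<Sum>k\<le>Suc p. b k * chi (k + j) R) = c / h * (\<Sum>k<p + 2. cofactor A k (p + 1) * bordered p R k j)"
      unfolding sets sum_distrib_left using that by (intro sum.cong) (auto simp: b_def bordered_def)
    then show ?thesis using adj[of j] that by simp
  qed
  moreover have sum_tau: "(\<Sum>k\<le>Suc p. b k * tau R k) = c / h * Determinant.det A"
  proof -
    have "(\<Sum>k\<le>Suc p. b k * tau R k) = c / h * (\<Sum>k<p + 2. cofactor A k (p + 1) * bordered p R k (p + 1))"
      unfolding sets sum_distrib_left by (intro sum.cong) (auto simp: b_def bordered_def)
    then show ?thesis using adj[of "p + 1"] by simp
  qed
  moreover have det_A: "Determinant.det A = (-1) ^ (p + 1) * det_sq (p + 1) (\<lambda>i j. chi (i + j + 2) R) / (\<Prod>i\<le>p. real (2 * i + 1))"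
  proof -
    have pos: "(\<Prod>i\<le>p. real (2 * i + 1)) > 0" by (auto intro!: prod_pos)
    have "y = z / x" if "x * y = z" "0 < x" for x y z :: real
      using that by (simp add: field_simps)
    from this[OF det_bordered pos] show ?thesis
      unfolding A_def det_sq_eq_det[of "p + 2"] .
  qed
  moreover have "c / h * (s * k / d) = c * s * k / (d * h)" for s k d :: real
    by (simp add: mult_ac)
  ultimately show ?thesis
    unfolding h_def[symmetric] by (intro exI[of _ b] conjI allI impI) (simp_all only:)
qed

section \<open>Normalisation and mass of the one-dimensional solution\<close>

lemma coeff_qpoly_top: "coeff (qpoly p R b) (2 * p) = b (Suc p) / (2 ^ p * fact p)"
proof -
  have deg: "degree ([:- R\<^sup>2, 0, 1:] ^ i) = 2 * i" for i
    by (simp add: degree_power_eq)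
  have "coeff (upow R i) (2 * p) = 0" if "i < p" for i
    using that deg[of i] by (simp add: upow_def coeff_eq_0)
  moreover have "coeff (upow R p) (2 * p) = 1 / (2 ^ p * fact p)"
    using lead_coeff_power[of "[:- R\<^sup>2, 0, 1:]" p] deg[of p] by (simp add: upow_def)
  ultimately have "(\<Sum>i\<le>p. b (Suc i) * coeff (upow R i) (2 * p)) = (\<Sum>i\<in>{p}. b (Suc i) * coeff (upow R i) (2 * p))"
    by (intro sum.mono_neutral_right) auto
  then show ?thesis
    using \<open>coeff (upow R p) (2 * p) = _\<close> by (simp add: qpoly_def coeff_sum)
qed

lemma integral_upow:
  assumes R: "0 < R"
  shows "(poly (upow R i) has_integral (- 2 / R * tau R (Suc i))) {-R..R}"
proof -
  define d where "d = (\<Prod>l<Suc i. real (2 * l + 1))"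
  have d: "d > 0" unfolding d_def by (rule prod_pos) simp
  have hb: "half_beta i 0 = 2 ^ i * fact i / d"
    by (simp add: half_beta_def d_def lessThan_Suc_atMost)
  have "((\<lambda>t. (R\<^sup>2 - t\<^sup>2) ^ i) has_integral (2 * (R ^ (2 * i + 1) * half_beta i 0))) {-R..R}"
    using has_integral_half_beta_scaled[OF R, of i 0] R by (intro has_integral_even_Icc) simp_all
  then have "((\<lambda>t. (-1) ^ i / (2 ^ i * fact i) * (R\<^sup>2 - t\<^sup>2) ^ i) has_integral
      (-1) ^ i / (2 ^ i * fact i) * (2 * (R ^ (2 * i + 1) * half_beta i 0))) {-R..R}"
    by (rule has_integral_mult_right)
  moreover have "(-1) ^ i / (2 ^ i * fact i) * (R\<^sup>2 - t\<^sup>2) ^ i = poly (upow R i) t" for t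
    using power_mult_distrib[of "-1" "R\<^sup>2 - t\<^sup>2" i] by (simp add: poly_upow)
  moreover have "(-1) ^ i / (2 ^ i * fact i) * (2 * (R ^ (2 * i + 1) * half_beta i 0)) = - 2 / R * tau R (Suc i)"
  proof -
    have "(- R\<^sup>2) ^ Suc i = (-1) ^ Suc i * R ^ (2 * Suc i)"
      unfolding power_mult by (rule power_minus)
    also have "R ^ (2 * Suc i) = R ^ (2 * i + 1) * R" by simp
    finally have "tau R (Suc i) = (-1) ^ Suc i * (R ^ (2 * i + 1) * R) / d"
      unfolding tau_def d_def by (simp only:)
    moreover have "s / f * (2 * (x * (f / d))) = - 2 / R * (- 1 * s * (x * R) / d)" if "f \<noteq> 0" for s f x :: real
      using that R by simp
    from this[of "2 ^ i * fact i" "(-1) ^ i" "R ^ (2 * i + 1)"]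
    have "(-1) ^ i / (2 ^ i * fact i) * (2 * (R ^ (2 * i + 1) * (2 ^ i * fact i / d)))
        = - 2 / R * ((-1) ^ Suc i * (R ^ (2 * i + 1) * R) / d)"
      by simp
    ultimately show ?thesis unfolding hb by (simp only:)
  qed
  ultimately show ?thesis by simp
qed

text \<open>The two point masses contribute \<open>- 2 / R * b 0\<close>, which is the term
  \<open>k = 0\<close> because \<open>tau R 0 = 1\<close>; the integrals of the
  \<open>upow R i\<close> supply the others.\<close>

lemma total_mass:
  assumes R: "0 < R"
  shows "integral {-R..R} (poly (qpoly p R b)) + 2 * (- b 0 / R) = - 2 / R * (\<Sum>k\<le>Suc p. b k * tau R k)"
proof -
  have "((\<lambda>t. \<Sum>i\<le>p. b (Suc i) * poly (upow R i) t) has_integral (\<Sum>i\<le>p. b (Suc i) * (- 2 / R * tau R (Suc i)))) {-R..R}"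
    by (intro has_integral_sum has_integral_mult_right integral_upow R) simp
  moreover have "poly (qpoly p R b) = (\<lambda>t. \<Sum>i\<le>p. b (Suc i) * poly (upow R i) t)"
    by (rule ext) (simp add: qpoly_def poly_sum)
  ultimately have "integral {-R..R} (poly (qpoly p R b)) = (\<Sum>i\<le>p. b (Suc i) * (- 2 / R * tau R (Suc i)))"
    by (simp only: integral_unique)
  also have "\<dots> = - 2 / R * (\<Sum>i\<le>p. b (Suc i) * tau R (Suc i))"
    unfolding sum_distrib_left by (intro sum.cong refl) (simp only: mult.left_commute)
  finally show ?thesis
    unfolding sum.atMost_Suc_shift by (simp add: distrib_left)
qed

theorem theorem1p8:
  fixes p :: nat and R :: real
  assumes "CARD('n::finite) = 2 * p + 1"
    and "R > 0"
  shows "magnitude (cball (0 :: real ^ 'n) R) =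
    det_sq (p + 1) (\<lambda>i j. chi (i + j + 2) R) /
      (fact (2 * p + 1) * R * det_sq (p + 1) (\<lambda>i j. chi (i + j) R))"
proof -
  define h where "h = det_sq (p + 1) (\<lambda>i j. chi (i + j) R)"
  define g where "g = det_sq (p + 1) (\<lambda>i j. chi (i + j + 2) R)"
  define d where "d = (\<Prod>l<p. real (2 * l + 1))"
  have d: "0 < d" by (auto simp: d_def intro!: prod_pos)
  \<comment> \<open>Forced by the normalisation: the leading coefficient
    \<open>c / (2 ^ p * fact p)\<close> of \<open>q\<close> times twice the moment of order
    \<open>2 * p\<close> must be \<open>1\<close>.\<close>
  define c where "c = (-1) ^ p * d / (2 * fact (2 * p))"
  have "h \<noteq> 0"
    unfolding h_def
  proof (rule det_sq_nonzero)
    fix v assume v: "\<And>i. i < p + 1 \<Longrightarrow> (\<Sum>j<p + 1. chi (i + j) R * v j) = 0"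
    have "\<forall>k\<le>p. v k = 0"
    proof (rule hankel_kernel_trivial[OF assms(2)])
      fix j assume "j \<le> p"
      then show "(\<Sum>k\<le>p. v k * chi (k + j) R) = 0"
        using v[of j] by (simp add: lessThan_Suc_atMost mult.commute add.commute)
    qed
    then show "\<forall>j<p + 1. v j = 0" by simp
  qed
  then obtain b where b_top: "b (Suc p) = c"
    and b: "\<And>j. j \<le> p \<Longrightarrow> (\<Sum>k\<le>Suc p. b k * chi (k + j) R) = 0"
    and b_tau: "(\<Sum>k\<le>Suc p. b k * tau R k) = c * (-1) ^ (p + 1) * g / ((\<Prod>i\<le>p. real (2 * i + 1)) * h)"
    using hankel_solution[of p R c] unfolding h_def g_def by blast
  have norm: "2 * coeff (qpoly p R b) (2 * p) * ell_moment p (2 * p) = 1"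
  proof -
    have "(-1) ^ p * ((-1) ^ p :: real) = 1" by (simp add: power_mult_distrib[symmetric])
    then show ?thesis
      using d unfolding coeff_qpoly_top ell_moment_top b_top c_def d_def[symmetric]
      by (simp add: field_simps)
  qed
  have "magnitude (cball (0 :: real ^ 'n) R) = integral {-R..R} (poly (qpoly p R b)) + 2 * (- b 0 / R)"
    by (rule ball_magnitude_from_profile[OF assms]) (rule profile_exists[OF assms(2) b norm])
  also have "\<dots> = - 2 / R * (c * (-1) ^ (p + 1) * g / ((\<Prod>i\<le>p. real (2 * i + 1)) * h))"
    unfolding total_mass[OF assms(2)] b_tau ..
  \<comment> \<open>The odd product up to \<open>2 * p + 1\<close> cancels \<open>d\<close> and
    leaves \<open>2 * p + 1\<close>; with \<open>fact (2 * p)\<close> from \<open>c\<close> this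
    makes up the factorial of the dimension. The powers of \<open>-1\<close> combine with the sign
    of \<open>- 2 / R\<close>.\<close>
  also have "\<dots> = g / (fact (2 * p + 1) * R * h)"
  proof -
    have "(\<Prod>i\<le>p. real (2 * i + 1)) = d * real (2 * p + 1)"
      by (simp add: d_def lessThan_Suc_atMost[symmetric])
    moreover have "fact (2 * p + 1) = real (2 * p + 1) * fact (2 * p)" by simp
    moreover have "(-1) ^ p * ((-1) ^ (p + 1)) = (-1 :: real)" by (simp add: power_mult_distrib[symmetric])
    then have "c * (-1) ^ (p + 1) = - d / (2 * fact (2 * p))"
      unfolding c_def by (simp only: times_divide_eq_left mult.assoc mult.commute[of d] mult.left_commute[of d]) simp
    moreover have "- 2 / R * (- d / (2 * f) * g / (d * n * h)) = g / (n * f * R * h)" if "f \<noteq> 0" for f n :: real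
      using d that by simp
    ultimately show ?thesis by simp
  qed
  finally show ?thesis by (simp only: g_def h_def)
qed

end
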